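(* Let $\mathbb{F}$ be a finite field of odd order $q$ and let $\theta$ be a non-trivial additive character of $\mathbb{F}$. For $n\ge1$, $1\le s\le n$ and $0\le r\le n$, $$\Psi^{(1)}_n(s,r)=(-1)^{r+x}q^{x(x+1)}\,(q^{2N+(-1)^n};q^{-2})_x\begin{bmatrix} N \\ x \end{bmatrix}_{q^2}K^{\mathrm{Aff}}_y(x;q^{-2N-(-1)^n},N;q^2),$$ where $N=\lfloor\frac{n-1}{2}\rfloor$, $y=\lfloor\frac{s-1}{2}\rfloor$, $x=\lfloor\frac r2\rfloor$. Here $\Psi^{(1)}_n$ is the block defined in the context of the matrix of the Fourier transformation of $\operatorname{GL}_n(\mathbb{F})$-invariant functions on symmetric matrices.
   Context: $\operatorname{Sym}_n$ is the space of $n\times n$ symmetric matrices over $\mathbb{F}$, with $\operatorname{GL}_n(\mathbb{F})$ acting by $a\mapsto ga\,{}^tg$. Fix a non-square $\delta\in\mathbb{F}$. Every non-zero $a\in\operatorname{Sym}_n$ is in the orbit of exactly one of the matrices $\operatorname{diag}(1,\dots,1,0,\dots,0)$ or $\operatorname{diag}(1,\dots,1,\delta,0,\dots,0)$; put $\operatorname{sgn}(a)=1$ in the first case, $-1$ in the second, and $\operatorname{sgn}(0)=1$. Identify $\operatorname{Sym}_n$ with its character group via $a\mapsto\theta_a$, $\theta_a(b)=\theta(\operatorname{trace}({}^tab))$. On $\operatorname{Sym}_n$, let $\chi_r$ ($0\le r\le n$) be the characteristic function of the matrices of rank $r$, and ${}^{\operatorname{sgn}}\chi_r(a)=\operatorname{sgn}(a)\chi_r(a)$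 ($1\le r\le n$). These form a basis of the $\operatorname{GL}_n(\mathbb{F})$-invariant functions on $\operatorname{Sym}_n$. Use the same notation on the character group: $\chi_s(\theta_a)=\chi_s(a)$, ${}^{\operatorname{sgn}}\chi_s(\theta_a)={}^{\operatorname{sgn}}\chi_s(a)$. The Fourier transformation is $\mathcal{F}\varphi(\xi)=\sum_{a\in\operatorname{Sym}_n}\overline{\xi(a)}\varphi(a)$. The numbers $\Psi^{(i)}_n(s,r)$ are defined by $$\mathcal{F}(\chi_r)=\sum_{s=0}^n\Psi^{(1)}_n(s,r)\chi_s+\sum_{s=1}^n\Psi^{(3)}_n(s,r)\,{}^{\operatorname{sgn}}\chi_s\quad(0\le r\le n),$$ $$\mathcal{F}({}^{\operatorname{sgn}}\chi_r)=\sum_{s=0}^n\Psi^{(2)}_n(s,r)\chi_s+\sum_{s=1}^n\Psi^{(4)}_n(s,r)\,{}^{\operatorname{sgn}}\chi_s\quad(1\le r\le n).$$ Notation: $(a;q)_k=(1-a)(1-aq)\cdots(1-aq^{k-1})$, $(a;q)_0=1$; $\begin{bmatrix} N \\ x \end{bmatrix}_q=\dfrac{(q^N;q^{-1})_x}{(q;q)_x}$ (which is $0$ for $x=N+1$). Affine $q$-Krawtchouk polynomial: for integers $0\le y\le N$, $$K^{\mathrm{Aff}}_y(x;a,N;q)=\sum_{k=0}^{y}\frac{(q^{-y};q)_k\,(q^{-x};q)_k}{(q^{-N};q)_k\,(a;q)_k\,(q;q)_k}\,q^k$$ (a polynomial in $q^{-x}$); in the claim these are used with $q$ replaced by $q^2$.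 *)

theory Defs
  imports Complex_Main "HOL-Library.Cardinality" "Jordan_Normal_Form.DL_Rank"
begin

definition Sym_mat :: "nat \<Rightarrow> 'a::field mat set" where
  "Sym_mat n = {a \<in> carrier_mat n n. transpose_mat a = a}"

definition GL_orbit :: "nat \<Rightarrow> 'a::field mat \<Rightarrow> 'a mat set" where
  "GL_orbit n a = {g * a * transpose_mat g | g. g \<in> carrier_mat n n \<and> invertible_mat g}"

text \<open>The \<open>n \<times> n\<close> matrix \<open>diag(1, \<dots>, 1, d, 0, \<dots>, 0)\<close> with \<open>r\<close> non-zero entries,
  the last of which is \<open>d\<close>; used for \<open>1 \<le> r \<le> n\<close>.\<close>

definition diag_rep :: "nat \<Rightarrow> nat \<Rightarrow> 'a::field \<Rightarrow> 'a mat" where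
  "diag_rep n r d = mat n n (\<lambda>(i, j).
     if i \<noteq> j then 0 else if i + 1 < r then 1 else if i + 1 = r then d else 0)"

text \<open>The parameter \<open>\<delta>\<close> is the fixed non-square. When it is one (and the field is finite of
  odd order), the last branch is never reached for symmetric \<open>a\<close>.\<close>

definition sym_sgn :: "'a::field \<Rightarrow> nat \<Rightarrow> 'a mat \<Rightarrow> complex" where
  "sym_sgn \<delta> n a =
     (if a = 0\<^sub>m n n \<or> (\<exists>r\<in>{1..n}. a \<in> GL_orbit n (diag_rep n r 1)) then 1
      else if \<exists>r\<in>{1..n}. a \<in> GL_orbit n (diag_rep n r \<delta>) then - 1
      else 0)"

definition rank_chi :: "nat \<Rightarrow> nat \<Rightarrow> 'a::field mat \<Rightarrow> complex" where
  "rank_chi n r a = (if vec_space.rank n a = r then 1 else 0)"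

definition sgn_rank_chi :: "'a::field \<Rightarrow> nat \<Rightarrow> nat \<Rightarrow> 'a mat \<Rightarrow> complex" where
  "sgn_rank_chi \<delta> n r a = sym_sgn \<delta> n a * rank_chi n r a"

definition additive_character :: "('a::field \<Rightarrow> complex) \<Rightarrow> bool" where
  "additive_character \<theta> \<longleftrightarrow> \<theta> 0 = 1 \<and> (\<forall>x y. \<theta> (x + y) = \<theta> x * \<theta> y)"

definition nontrivial_additive_character :: "('a::field \<Rightarrow> complex) \<Rightarrow> bool" where
  "nontrivial_additive_character \<theta> \<longleftrightarrow> additive_character \<theta> \<and> (\<exists>x. \<theta> x \<noteq> 1)"

definition mat_trace :: "'a::field mat \<Rightarrow> 'a" where
  "mat_trace a = (\<Sum>i<dim_row a. a $$ (i, i))"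

definition dual_char :: "('a::field \<Rightarrow> complex) \<Rightarrow> 'a mat \<Rightarrow> 'a mat \<Rightarrow> complex" where
  "dual_char \<theta> a b = \<theta> (mat_trace (transpose_mat a * b))"

definition sym_fourier ::
    "nat \<Rightarrow> ('a::field mat \<Rightarrow> complex) \<Rightarrow> ('a mat \<Rightarrow> complex) \<Rightarrow> complex" where
  "sym_fourier n \<phi> \<xi> = (\<Sum>a\<in>Sym_mat n. cnj (\<xi> a) * \<phi> a)"

text \<open>The Fourier transform of \<open>\<phi>\<close>, a function on the characters of \<open>Sym_mat n\<close>, is the linear
  combination with coefficients \<open>c\<close> and \<open>d\<close> of the rank functions and the signed rank functions,
  which are evaluated on the character \<open>dual_char \<theta> b\<close> through \<open>b\<close>.\<close>

definition fourier_expansion ::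
    "('a::field \<Rightarrow> complex) \<Rightarrow> 'a \<Rightarrow> nat \<Rightarrow> ('a mat \<Rightarrow> complex) \<Rightarrow>
     (nat \<Rightarrow> complex) \<Rightarrow> (nat \<Rightarrow> complex) \<Rightarrow> bool" where
  "fourier_expansion \<theta> \<delta> n \<phi> c d \<longleftrightarrow>
     (\<forall>b\<in>Sym_mat n. sym_fourier n \<phi> (dual_char \<theta> b) =
        (\<Sum>s=0..n. c s * rank_chi n s b) + (\<Sum>s=1..n. d s * sgn_rank_chi \<delta> n s b))"

text \<open>Only the values \<open>c 0, \<dots>, c n\<close> and \<open>d 1, \<dots>, d n\<close> are determined by the expansion, so the
  definite description ranges over the single coefficient \<open>c s\<close>, for \<open>s \<le> n\<close>.\<close>

definition Psi1 :: "('a::field \<Rightarrow> complex) \<Rightarrow> 'a \<Rightarrow> nat \<Rightarrow> nat \<Rightarrow> nat \<Rightarrow> complex" where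
  "Psi1 \<theta> \<delta> n s r =
     (THE z. \<exists>c d. fourier_expansion \<theta> \<delta> n (rank_chi n r) c d \<and> z = c s)"

definition q_poch :: "'b::field \<Rightarrow> 'b \<Rightarrow> nat \<Rightarrow> 'b" where
  "q_poch a q k = (\<Prod>i<k. 1 - a * q ^ i)"

definition q_binom :: "nat \<Rightarrow> nat \<Rightarrow> 'b::field \<Rightarrow> 'b" where
  "q_binom N x q = q_poch (q ^ N) (inverse q) x / q_poch q q x"

definition K_Aff :: "nat \<Rightarrow> nat \<Rightarrow> 'b::field \<Rightarrow> nat \<Rightarrow> 'b \<Rightarrow> 'b" where
  "K_Aff y x a N q =
     (\<Sum>k=0..y. q_poch (q powi - int y) q k * q_poch (q powi - int x) q k /
        (q_poch (q powi - int N) q k * q_poch a q k * q_poch q q k) * q ^ k)"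

end

theory Submission
  imports Defs "Jordan_Normal_Form.Matrix_Kernel"
begin

text \<open>
  The coefficient for rank \<open>s\<close> is the mean of the Fourier transform of the rank function over the
  two classes of rank \<open>s\<close>, hence its mean \<open>P n s r\<close> over the matrices
  \<open>diag(1, \<dots>, 1, d, 0, \<dots>, 0)\<close> with \<open>d\<close> running over the non-zero scalars.
  Adding the value at \<open>d = 0\<close> completes a character sum, which kills all \<open>a\<close> whose diagonal entry
  at that place is non-zero. The remaining \<open>a\<close> have a border with zero corner, and
  either come from size \<open>n - 1\<close> or split off a hyperbolic plane, so that
  \<open>(q - 1) P n s r + P n (s - 1) r =
    q (P (n - 1) (s - 1) r + (q ^ (n - s) - 1) q ^ (n - 1) P (n - 2) (s - 1) (r - 2))\<close>.
  No Gauss sum is needed. The recurrence starts at \<open>s = 0\<close> with the numbers of symmetric matrices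
  of given rank. Its solution depends on \<open>s\<close> only through \<open>y\<close> and on \<open>r\<close>, up to the sign
  \<open>(-1) ^ r\<close>, only through \<open>x\<close>. Each step from \<open>y\<close> to \<open>y + 1\<close> subtracts a multiple of the
  solution for \<open>(n - 2, x - 1)\<close>. Iterating this by the \<open>q\<close>-Pascal rule gives the terms of
  the affine \<open>q\<close>-Krawtchouk sum.
\<close>

section \<open>Rank and the cardinality of the kernel\<close>

text \<open>The value of the Fourier transform at a single diagonal matrix may depend on the
  quadratic character of its entries, so a recurrence for single values would mix the two classes of
  each rank. The averages satisfy a closed recurrence for the following reason. If the last non-zero
  entry is e and a new entry d \<noteq> 0 is placed after it, the binary form with coefficients e
  and d represents 1. Hence diag(1, ..., 1, e, d) is congruent to diag(1, ..., 1, 1, e d), and for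
  fixed e the product e d runs over all non-zero scalars. The sum over d is therefore the same for
  every e. As q - 1 is not 0, the values for rank s follow from those for rank s - 1 at sizes n, n -
  1 and n - 2. The ranks of bordered matrices are compared through the cardinality of the kernel, so
  that each rank identity becomes a bijection between solution sets of linear equations.\<close>

lemma (in vectorspace) card_carrier:
  assumes "finite (carrier K)" "fin_dim"
  shows "card (carrier V) = card (carrier K) ^ dim"
proof -
  obtain A where A: "finite A" "basis A"
    using finite_basis_exists[OF assms(2)] by blast
  then have AV: "A \<subseteq> carrier V"
    by (simp add: basis_def)
  have u: "\<exists>!a. a \<in> A \<rightarrow>\<^sub>E carrier K \<and> lincomb a A = v" if "v \<in> carrier V" for v
    using basis_criterion[OF A(1) AV] A(2) that by blast
  have "bij_betw (\<lambda>a. lincomb a A) (A \<rightarrow>\<^sub>E carrier K) (carrier V)"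
  proof -
    have c: "lincomb a A \<in> carrier V" if "a \<in> A \<rightarrow>\<^sub>E carrier K" for a
      using that AV by (intro lincomb_closed) auto
    then show ?thesis
      unfolding bij_betw_def inj_on_def using u by (auto simp: image_iff) metis+
  qed
  then have "card (carrier V) = card (A \<rightarrow>\<^sub>E carrier K)"
    by (simp add: bij_betw_same_card)
  also have "\<dots> = card (carrier K) ^ card A"
    using A(1) by (simp add: card_PiE)
  finally show ?thesis
    using dim_basis[OF A] by simp
qed

lemma card_image_mat_vec:
  fixes A :: "'a::{field,finite} mat"
  assumes "A \<in> carrier_mat n m"
  shows "card ((*\<^sub>v) A ` carrier_vec m) = CARD('a) ^ vec_space.rank n A"
proof -
  interpret vec_space "TYPE('a)" n .
  have sub: "set (cols A) \<subseteq> carrier_vec n"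
    using assms cols_dim by blast
  interpret W: vectorspace class_ring "span_vs (set (cols A))"
    using sub by (simp add: span_is_subspace subspace_is_vs)
  have "(*\<^sub>v) A ` carrier_vec m = span (set (cols A))"
    using col_space_eq[OF assms] assms by (force simp: col_space_def)
  then show ?thesis
    using W.card_carrier fin_dim_span_cols[OF assms]
    by (simp add: rank_def class_ring_simps)
qed

lemma bij_betw_vec_PiE: "bij_betw (vec n) ({..<n} \<rightarrow>\<^sub>E UNIV) (carrier_vec n)"
proof (rule bij_betw_byWitness[where f' = "\<lambda>v. restrict (($) v) {..<n}"])
  show "\<forall>f\<in>{..<n} \<rightarrow>\<^sub>E UNIV. restrict (($) (vec n f)) {..<n} = f"
    by (auto simp: PiE_iff extensional_def fun_eq_iff)
  show "\<forall>v\<in>carrier_vec n. vec n (restrict (($) v) {..<n}) = v"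
    by (auto simp: vec_eq_iff)
qed (simp_all add: image_subset_iff)

lemma card_carrier_vec: "card (carrier_vec n :: 'a::finite vec set) = CARD('a) ^ n"
  using bij_betw_same_card[OF bij_betw_vec_PiE[where 'a='a], of n] by (simp add: card_PiE)

lemma finite_carrier_vec [simp]: "finite (carrier_vec n :: 'a::finite vec set)"
  using bij_betw_finite[OF bij_betw_vec_PiE[where 'a='a], of n] by (simp add: finite_PiE)

lemma Sym_mat_iff:
  "a \<in> Sym_mat n \<longleftrightarrow> a \<in> carrier_mat n n \<and> (\<forall>i<n. \<forall>k<n. a $$ (i, k) = a $$ (k, i))"
  unfolding Sym_mat_def by (auto simp: mat_eq_iff)

lemma in_mat_kernel_iff:
  assumes "A \<in> carrier_mat n m"
  shows "x \<in> mat_kernel A \<longleftrightarrow> x \<in> carrier_vec m \<and> (\<forall>i<n. (\<Sum>k<m. A $$ (i, k) * x $ k) = 0)"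
  using assms unfolding mat_kernel_def
  by (auto simp: vec_eq_iff scalar_prod_def atLeast0LessThan)

text \<open>Rank-nullity in counting form: every non-empty fibre of the map x \<mapsto> A x is a
  translate of the kernel.\<close>

lemma card_mat_kernel_rank:
  fixes A :: "'a::{field,finite} mat"
  assumes A: "A \<in> carrier_mat n m"
  shows "card (mat_kernel A) * CARD('a) ^ vec_space.rank n A = CARD('a) ^ m"
proof -
  have fib: "card {x \<in> carrier_vec m. A *\<^sub>v x = y} = card (mat_kernel A)"
    if y: "y \<in> (*\<^sub>v) A ` carrier_vec m" for y
  proof -
    obtain z where z: "z \<in> carrier_vec m" "y = A *\<^sub>v z"
      using y by blast
    have "bij_betw (\<lambda>x. x + z) (mat_kernel A) {x \<in> carrier_vec m. A *\<^sub>v x = y}"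
      by (rule bij_betw_byWitness[where f' = "\<lambda>x. x - z"])
        (use A z in \<open>auto simp: mat_kernel_def mult_add_distrib_mat_vec mult_minus_distrib_mat_vec\<close>)
    then show ?thesis
      by (simp add: bij_betw_same_card)
  qed
  have "CARD('a) ^ m = card (carrier_vec m :: 'a vec set)"
    by (simp add: card_carrier_vec)
  also have "\<dots> = (\<Sum>y\<in>(*\<^sub>v) A ` carrier_vec m. card {x \<in> carrier_vec m. A *\<^sub>v x = y})"
    using sum.image_gen[of "carrier_vec m" "\<lambda>_. 1 :: nat" "(*\<^sub>v) A"] by simp
  also have "\<dots> = card (mat_kernel A) * CARD('a) ^ vec_space.rank n A"
    by (simp add: fib card_image_mat_vec[OF A])
  finally show ?thesis by simp
qed

lemma CARD_field_gt_1: "CARD('a::{field,finite}) > 1"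
proof -
  have "card {0, 1 :: 'a} \<le> CARD('a)" by (rule card_mono) auto
  then show ?thesis by simp
qed

lemma card_mat_kernel:
  fixes A :: "'a::{field,finite} mat"
  assumes A: "A \<in> carrier_mat n n"
  shows "card (mat_kernel A) = CARD('a) ^ (n - vec_space.rank n A)"
proof -
  have "CARD('a) ^ n = CARD('a) ^ (n - vec_space.rank n A) * CARD('a) ^ vec_space.rank n A"
    using vec_space.rank_le_nc[OF A] by (simp flip: power_add)
  then show ?thesis
    unfolding card_mat_kernel_rank[OF A, symmetric] using CARD_field_gt_1[where 'a='a] by simp
qed

text \<open>The form in which ranks are compared below. \<open>k\<close> and \<open>l\<close> absorb
  free coordinates on either side; \<open>d\<close> is the gain in rank that remains once the sizes
  are taken into account.\<close>

lemma rank_eqI: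
  fixes A B :: "'a::{field,finite} mat"
  assumes A: "A \<in> carrier_mat n n" and B: "B \<in> carrier_mat m m"
    and "card (mat_kernel B) * CARD('a) ^ k = card (mat_kernel A) * CARD('a) ^ l" "m + k = n + l + d"
  shows "vec_space.rank m B = vec_space.rank n A + d"
proof -
  have "CARD('a) ^ (m - vec_space.rank m B + k) = CARD('a) ^ (n - vec_space.rank n A + l)"
    using assms by (simp add: card_mat_kernel power_add)
  then have "m - vec_space.rank m B + k = n - vec_space.rank n A + l"
    using CARD_field_gt_1[where 'a='a] by (simp add: power_inject_exp)
  then show ?thesis
    using vec_space.rank_le_nc[OF A] vec_space.rank_le_nc[OF B] assms(4) by simp
qed

section \<open>Bordered symmetric matrices\<close>

lemma insert_index_neq [simp]: "insert_index j i \<noteq> j" "j \<noteq> insert_index j i"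
  by (auto simp: insert_index_def)

lemma insert_index_less: "i < m \<Longrightarrow> insert_index j i < Suc m"
  by (auto simp: insert_index_def)

lemma all_less_Suc_insert_index:
  assumes "j \<le> m"
  shows "(\<forall>i<Suc m. P i) \<longleftrightarrow> P j \<and> (\<forall>i<m. P (insert_index j i))"
proof -
  have "P i" if "P j" "\<forall>i<m. P (insert_index j i)" "i < Suc m" for i
  proof (cases "i = j")
    case False
    then have "delete_index j i < m"
      using that(3) assms by (auto simp: delete_index_def)
    then show ?thesis
      using that(2) insert_delete_index[OF False] by metis
  qed (use that in auto)
  then show ?thesis
    using assms by (auto simp: insert_index_less)
qed

lemma sum_lessThan_Suc_insert_index:
  fixes g :: "nat \<Rightarrow> 'b::comm_monoid_add"
  assumes "j \<le> m"
  shows "(\<Sum>i<Suc m. g i) = g j + (\<Sum>i<m. g (insert_index j i))"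
proof -
  have "bij_betw (insert_index j) {..<m} ({..<Suc m} - {j})"
    by (rule bij_betw_byWitness[where f' = "delete_index j"])
      (use assms in \<open>auto simp: insert_index_less insert_delete_index, auto simp: delete_index_def split: if_splits\<close>)
  then have "(\<Sum>i<m. g (insert_index j i)) = sum g ({..<Suc m} - {j})"
    by (rule sum.reindex_bij_betw)
  then show ?thesis
    using assms sum.remove[of "{..<Suc m}" j g] by simp
qed

definition vec_insert :: "nat \<Rightarrow> 'a vec \<Rightarrow> 'a \<Rightarrow> 'a vec" where
  "vec_insert j x z = vec (Suc (dim_vec x)) (\<lambda>i. if i = j then z else x $ delete_index j i)"

text \<open>The new row and column may sit at any place \<open>j\<close>: the diagonal entry that is
  summed over stands just behind the support of \<open>f\<close>, whereas a hyperbolic plane is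
  split off at an arbitrary non-zero coordinate of \<open>v\<close>.\<close>

definition bordered :: "nat \<Rightarrow> 'a mat \<Rightarrow> 'a vec \<Rightarrow> 'a \<Rightarrow> 'a mat" where
  "bordered j a v c = mat (Suc (dim_row a)) (Suc (dim_row a)) (\<lambda>(i, k).
     if i = j then (if k = j then c else v $ delete_index j k)
     else if k = j then v $ delete_index j i else a $$ (delete_index j i, delete_index j k))"

lemma vec_insert_simps [simp]:
  assumes "x \<in> carrier_vec m" "j \<le> m"
  shows "vec_insert j x z \<in> carrier_vec (Suc m)" "vec_insert j x z $ j = z"
    "i < m \<Longrightarrow> vec_insert j x z $ insert_index j i = x $ i"
  using assms by (auto simp: vec_insert_def insert_index_less)

lemma bordered_simps [simp]:
  assumes "a \<in> carrier_mat m m" "j \<le> m"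
  shows "bordered j a v c \<in> carrier_mat (Suc m) (Suc m)" "bordered j a v c $$ (j, j) = c"
    "i < m \<Longrightarrow> bordered j a v c $$ (insert_index j i, j) = v $ i"
    "i < m \<Longrightarrow> bordered j a v c $$ (j, insert_index j i) = v $ i"
    "i < m \<Longrightarrow> k < m \<Longrightarrow> bordered j a v c $$ (insert_index j i, insert_index j k) = a $$ (i, k)"
  using assms by (auto simp: bordered_def insert_index_less)

lemma bij_betw_vec_insert:
  assumes "j \<le> m"
  shows "bij_betw (\<lambda>(x, z). vec_insert j x z) (carrier_vec m \<times> UNIV) (carrier_vec (Suc m))"
  by (rule bij_betw_byWitness[where f' = "\<lambda>y. (vec m (\<lambda>i. y $ insert_index j i), y $ j)"])
    (use assms in \<open>auto simp: vec_eq_iff all_less_Suc_insert_index[OF assms] carrier_vecD[OF vec_insert_simps(1)] simp del: all_simps\<close>)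

lemma vec_insert_cases:
  assumes "y \<in> carrier_vec (Suc m)" "j \<le> m"
  obtains x z where "x \<in> carrier_vec m" "y = vec_insert j x z"
  using bij_betw_imp_surj_on[OF bij_betw_vec_insert[OF assms(2)]] assms(1) by force

lemma vec_insert_inject:
  assumes "x \<in> carrier_vec m" "x' \<in> carrier_vec m" "j \<le> m"
  shows "vec_insert j x z = vec_insert j x' z' \<longleftrightarrow> x = x' \<and> z = z'"
  using bij_betw_imp_inj_on[OF bij_betw_vec_insert[OF assms(3)]] assms(1,2)
  by (auto simp: inj_on_def)

lemma bij_betw_bordered:
  assumes "j \<le> m"
  shows "bij_betw (\<lambda>(a, v, c). bordered j a v c) (Sym_mat m \<times> carrier_vec m \<times> UNIV)
    (Sym_mat (Suc m) :: 'a::field mat set)"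
proof (rule bij_betw_byWitness[where f' = "\<lambda>b. (mat m m (\<lambda>(i, k). b $$ (insert_index j i, insert_index j k)),
      vec m (\<lambda>i. b $$ (insert_index j i, j)), b $$ (j, j))"])
  let ?d = "\<lambda>b :: 'a mat. (mat m m (\<lambda>(i, k). b $$ (insert_index j i, insert_index j k)),
      vec m (\<lambda>i. b $$ (insert_index j i, j)), b $$ (j, j))"
  show "\<forall>p\<in>Sym_mat m \<times> carrier_vec m \<times> UNIV. ?d ((\<lambda>(a, v, c). bordered j a v c) p) = p"
    using assms by (auto simp: Sym_mat_iff mat_eq_iff vec_eq_iff)
  show "\<forall>b\<in>Sym_mat (Suc m). (\<lambda>(a, v, c). bordered j a v c) (?d b) = b"
  proof
    fix b :: "'a mat" assume b: "b \<in> Sym_mat (Suc m)"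
    define a v where "a = mat m m (\<lambda>(i, k). b $$ (insert_index j i, insert_index j k))"
      and "v = vec m (\<lambda>i. b $$ (insert_index j i, j))"
    have "a \<in> carrier_mat m m" by (simp add: a_def)
    note s = bordered_simps[OF this assms, where v = v and c = "b $$ (j, j)"]
    have "b $$ (j, insert_index j i) = b $$ (insert_index j i, j)" if "i < m" for i
      using b that assms by (simp add: Sym_mat_iff insert_index_less)
    then have "\<forall>i<Suc m. \<forall>k<Suc m. bordered j a v (b $$ (j, j)) $$ (i, k) = b $$ (i, k)"
      unfolding all_less_Suc_insert_index[OF assms] using s b
      by (auto simp: a_def v_def Sym_mat_iff insert_index_less assms)
    then have "bordered j a v (b $$ (j, j)) = b"
      using s(1) b by (auto simp: mat_eq_iff Sym_mat_iff)
    then show "(\<lambda>(a, v, c). bordered j a v c) (?d b) = b"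
      by (simp add: a_def v_def)
  qed
  have "bordered j a v c \<in> Sym_mat (Suc m)" if "a \<in> Sym_mat m" for a :: "'a mat" and v c
  proof -
    have ac: "a \<in> carrier_mat m m" using that by (simp add: Sym_mat_iff)
    have "\<forall>i<Suc m. \<forall>k<Suc m. bordered j a v c $$ (i, k) = bordered j a v c $$ (k, i)"
      unfolding all_less_Suc_insert_index[OF assms] using that
      by (auto simp: bordered_simps[OF ac assms] Sym_mat_iff)
    then show ?thesis
      by (simp add: Sym_mat_iff bordered_simps[OF ac assms])
  qed
  then show "(\<lambda>(a, v, c). bordered j a v c) ` (Sym_mat m \<times> carrier_vec m \<times> UNIV) \<subseteq> (Sym_mat (Suc m) :: 'a mat set)"
    by auto
  show "?d ` Sym_mat (Suc m) \<subseteq> Sym_mat m \<times> carrier_vec m \<times> UNIV"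
    using insert_index_less by (auto simp: Sym_mat_iff)
qed

lemma Sym_mat_bordered_cases:
  assumes "b \<in> Sym_mat (Suc m)" "j \<le> m"
  obtains a v c where "a \<in> Sym_mat m" "v \<in> carrier_vec m" "b = bordered j a v c"
  using bij_betw_imp_surj_on[OF bij_betw_bordered[OF assms(2)]] assms(1) by force

lemma vec_insert_in_kernel_bordered:
  assumes a: "a \<in> carrier_mat m m" and x: "x \<in> carrier_vec m" and j: "j \<le> m"
  shows "vec_insert j x z \<in> mat_kernel (bordered j a v c) \<longleftrightarrow>
    (\<Sum>k<m. v $ k * x $ k) + c * z = 0 \<and> (\<forall>i<m. (\<Sum>k<m. a $$ (i, k) * x $ k) + v $ i * z = 0)"
  unfolding in_mat_kernel_iff[OF bordered_simps(1)[OF a j]] all_less_Suc_insert_index[OF j]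
    sum_lessThan_Suc_insert_index[OF j]
  using assms by (simp add: add.commute)

text \<open>Pairs of the old coordinates \<open>x\<close> and the coordinate \<open>z\<close> at
  place \<open>j\<close> allow kernels of different bordered matrices to be matched by explicit
  maps.\<close>

lemma card_mat_kernel_bordered:
  assumes a: "a \<in> carrier_mat m m" and j: "j \<le> m"
  shows "card (mat_kernel (bordered j a v c)) = card {(x, z). x \<in> carrier_vec m \<and>
    (\<Sum>k<m. v $ k * x $ k) + c * z = 0 \<and> (\<forall>i<m. (\<Sum>k<m. a $$ (i, k) * x $ k) + v $ i * z = 0)}"
    (is "_ = card ?S")
proof -
  have "bij_betw (\<lambda>(x, z). vec_insert j x z) ?S (mat_kernel (bordered j a v c))"
  proof (rule bij_betw_imageI)
    show "inj_on (\<lambda>(x, z). vec_insert j x z) ?S"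
      by (rule inj_on_subset[OF bij_betw_imp_inj_on[OF bij_betw_vec_insert[OF j]]]) auto
    show "(\<lambda>(x, z). vec_insert j x z) ` ?S = mat_kernel (bordered j a v c)"
    proof (intro equalityI subsetI)
      fix y assume y: "y \<in> mat_kernel (bordered j a v c)"
      then have "y \<in> carrier_vec (Suc m)"
        using in_mat_kernel_iff[OF bordered_simps(1)[OF a j]] by blast
      then obtain x z where "x \<in> carrier_vec m" "y = vec_insert j x z"
        using vec_insert_cases j by blast
      then show "y \<in> (\<lambda>(x, z). vec_insert j x z) ` ?S"
        using y vec_insert_in_kernel_bordered[OF a _ j]
        by (intro image_eqI[where x = "(x, z)"]) auto
    qed (use vec_insert_in_kernel_bordered[OF a _ j] in auto)
  qed
  then show ?thesis by (simp add: bij_betw_same_card)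
qed

section \<open>Shifts of the block and the rank of bordered matrices\<close>

definition sym_shift :: "'a::field mat \<Rightarrow> 'a vec \<Rightarrow> 'a vec \<Rightarrow> 'a mat" where
  "sym_shift a v w = mat (dim_row a) (dim_row a)
     (\<lambda>(i, k). a $$ (i, k) + v $ i * w $ k + w $ i * v $ k)"

lemma sym_shift_simps [simp]:
  assumes "a \<in> carrier_mat m m"
  shows "sym_shift a v w \<in> carrier_mat m m"
    "i < m \<Longrightarrow> k < m \<Longrightarrow> sym_shift a v w $$ (i, k) = a $$ (i, k) + v $ i * w $ k + w $ i * v $ k"
  using assms by (auto simp: sym_shift_def)

lemma bij_betw_sym_shift:
  assumes "w \<in> carrier_vec m"
  shows "bij_betw (\<lambda>a. sym_shift a v w) (Sym_mat m) (Sym_mat m :: 'a::field mat set)"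
  by (rule bij_betw_byWitness[where f' = "\<lambda>a. sym_shift a v (- w)"])
    (use assms in \<open>auto simp: Sym_mat_iff mat_eq_iff sym_shift_def algebra_simps\<close>)

text \<open>Adding \<open>w $ i\<close> times the border to row and column \<open>i\<close> is a
  congruence, and as the corner is 0 it creates no term quadratic in \<open>w\<close>. On kernels it
  moves \<open>z\<close> by the scalar product of \<open>w\<close> and \<open>x\<close>; the other
  new term vanishes by the border equation.\<close>

lemma rank_bordered_sym_shift:
  fixes a :: "'a::{field,finite} mat"
  assumes a: "a \<in> carrier_mat m m" and j: "j \<le> m"
  shows "vec_space.rank (Suc m) (bordered j (sym_shift a v w) v 0) =
    vec_space.rank (Suc m) (bordered j a v 0)"
proof -
  let ?s = "\<lambda>x. \<Sum>k<m. w $ k * x $ k"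
  have e: "(\<Sum>k<m. sym_shift a v w $$ (i, k) * x $ k) = (\<Sum>k<m. a $$ (i, k) * x $ k) + v $ i * ?s x
      + w $ i * (\<Sum>k<m. v $ k * x $ k)" if "i < m" for i x
    using that a by (simp add: sum.distrib sum_distrib_left algebra_simps)
  have "card (mat_kernel (bordered j (sym_shift a v w) v 0)) = card (mat_kernel (bordered j a v 0))"
    unfolding card_mat_kernel_bordered[OF a j] card_mat_kernel_bordered[OF sym_shift_simps(1)[OF a] j]
    by (rule bij_betw_same_card[of "\<lambda>(x, z). (x, z + ?s x)"],
        rule bij_betw_byWitness[where f' = "\<lambda>(x, z). (x, z - ?s x)"])
      (auto simp: e distrib_left right_diff_distrib add_ac)
  then show ?thesis
    using rank_eqI[OF bordered_simps(1)[OF a j] bordered_simps(1)[OF sym_shift_simps(1)[OF a] j],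
        where k = 0 and l = 0 and d = 0]
    by simp
qed

lemma rank_bordered_0:
  fixes a :: "'a::{field,finite} mat"
  assumes a: "a \<in> carrier_mat m m" and j: "j \<le> m"
  shows "vec_space.rank (Suc m) (bordered j a (0\<^sub>v m) 0) = vec_space.rank m a"
proof -
  have "card (mat_kernel (bordered j a (0\<^sub>v m) 0)) = card (mat_kernel a \<times> (UNIV :: 'a set))"
    unfolding card_mat_kernel_bordered[OF a j]
    by (rule arg_cong[of _ _ card]) (auto simp: in_mat_kernel_iff[OF a])
  then show ?thesis
    using rank_eqI[OF a bordered_simps(1)[OF a j], where k = 0 and l = 1 and d = 0]
    by (simp add: card_cartesian_product)
qed

text \<open>Schur complement: the border equation can be solved for \<open>z\<close>, so the kernel
  is parametrised by \<open>x\<close> alone.\<close>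

lemma rank_bordered_corner:
  fixes a :: "'a::{field,finite} mat"
  assumes a: "a \<in> carrier_mat m m" and j: "j \<le> m" and "c \<noteq> 0"
  shows "vec_space.rank (Suc m) (bordered j a v c) =
    vec_space.rank m (mat m m (\<lambda>(i, k). a $$ (i, k) - v $ i * v $ k / c)) + 1"
proof -
  define b where "b = mat m m (\<lambda>(i, k). a $$ (i, k) - v $ i * v $ k / c)"
  let ?s = "\<lambda>x. \<Sum>k<m. v $ k * x $ k"
  have e: "(\<Sum>k<m. b $$ (i, k) * x $ k) = (\<Sum>k<m. a $$ (i, k) * x $ k) + v $ i * (- ?s x / c)"
    if "i < m" for i x
    using that by (simp add: b_def sum_subtractf sum_distrib_left sum_divide_distrib algebra_simps)
  have b: "b \<in> carrier_mat m m" by (simp add: b_def)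
  have "card (mat_kernel (bordered j a v c)) = card (mat_kernel b)"
    unfolding card_mat_kernel_bordered[OF a j]
  proof (rule bij_betw_same_card[of fst], rule bij_betw_byWitness[where f' = "\<lambda>x. (x, - ?s x / c)"])
    let ?S = "{(x, z). x \<in> carrier_vec m \<and> ?s x + c * z = 0 \<and>
      (\<forall>i<m. (\<Sum>k<m. a $$ (i, k) * x $ k) + v $ i * z = 0)}"
    have z: "z = - ?s x / c" if "?s x + c * z = 0" for x z
      using that assms(3) by (simp add: field_simps add_eq_0_iff)
    show "\<forall>p\<in>?S. (fst p, - ?s (fst p) / c) = p"
      using z by auto
    show "\<forall>x\<in>mat_kernel b. fst (x, - ?s x / c) = x" by simp
    show "fst ` ?S \<subseteq> mat_kernel b"
      using z by (auto simp: in_mat_kernel_iff[OF b] e)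
    show "(\<lambda>x. (x, - ?s x / c)) ` mat_kernel b \<subseteq> ?S"
      using assms(3) by (auto simp: in_mat_kernel_iff[OF b] e)
  qed
  then show ?thesis
    using rank_eqI[OF b bordered_simps(1)[OF a j], where k = 0 and l = 0 and d = 1] by (simp add: b_def)
qed

text \<open>Row \<open>j\<close> of the inner matrix is zero, so together with the border at
  \<open>t\<close> it spans a hyperbolic plane. The equation of row \<open>j\<close> forces z = 0,
  and the border equation fixes the coordinate at \<open>j\<close>. The kernel thus keeps its size
  while the matrix grows by 2.\<close>

lemma rank_bordered_bordered:
  fixes a :: "'a::{field,finite} mat"
  assumes a: "a \<in> carrier_mat m m" and j: "j \<le> m" and t: "t \<le> Suc m"
    and "v $ j \<noteq> 0"
  shows "vec_space.rank (Suc (Suc m)) (bordered t (bordered j a (0\<^sub>v m) 0) v 0) = vec_space.rank m a + 2"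
proof -
  let ?b = "bordered j a (0\<^sub>v m) 0"
  have b: "?b \<in> carrier_mat (Suc m) (Suc m)" using a j by simp
  let ?S = "{(x, z). x \<in> carrier_vec (Suc m) \<and> (\<Sum>k<Suc m. v $ k * x $ k) + 0 * z = 0 \<and>
    (\<forall>i<Suc m. (\<Sum>k<Suc m. ?b $$ (i, k) * x $ k) + v $ i * z = 0)}"
  let ?s = "\<lambda>x. - (\<Sum>k<m. v $ insert_index j k * x $ k) / v $ j"
  have S: "(vec_insert j x y, z) \<in> ?S \<longleftrightarrow> x \<in> mat_kernel a \<and> y = ?s x \<and> z = 0"
    if "x \<in> carrier_vec m" for x y z
  proof -
    have "(vec_insert j x y, z) \<in> ?S \<longleftrightarrow> v $ j * y + (\<Sum>k<m. v $ insert_index j k * x $ k) = 0 \<and>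
      v $ j * z = 0 \<and> (\<forall>i<m. (\<Sum>k<m. a $$ (i, k) * x $ k) + v $ insert_index j i * z = 0)"
      unfolding mem_Collect_eq prod.case sum_lessThan_Suc_insert_index[OF j] all_less_Suc_insert_index[OF j]
      using that a j by simp
    moreover have "v $ j * y + (\<Sum>k<m. v $ insert_index j k * x $ k) = 0 \<longleftrightarrow> y = ?s x"
      unfolding nonzero_eq_divide_eq[OF assms(4)] eq_neg_iff_add_eq_0 by (simp only: mult.commute)
    ultimately show ?thesis
      using that assms(4) by (auto simp: in_mat_kernel_iff[OF a])
  qed
  have "card (mat_kernel (bordered t ?b v 0)) = card ?S"
    by (rule card_mat_kernel_bordered[OF b t])
  also have "?S = (\<lambda>x. (vec_insert j x (?s x), 0)) ` mat_kernel a"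
  proof (intro equalityI subsetI)
    fix p :: "'a vec \<times> 'a" assume p: "p \<in> ?S"
    obtain u z where u: "p = (u, z)" by (cases p)
    have "u \<in> carrier_vec (Suc m)" using p unfolding u mem_Collect_eq prod.case by (rule conjunct1)
    then obtain x y where x: "x \<in> carrier_vec m" "u = vec_insert j x y"
      using vec_insert_cases j by metis
    have "x \<in> mat_kernel a \<and> y = ?s x \<and> z = 0"
      using S[OF x(1), THEN iffD1] p unfolding u x(2) .
    then show "p \<in> (\<lambda>x. (vec_insert j x (?s x), 0)) ` mat_kernel a"
      unfolding u x(2) by blast
  next
    fix p :: "'a vec \<times> 'a" assume "p \<in> (\<lambda>x. (vec_insert j x (?s x), 0)) ` mat_kernel a"
    then obtain x where x: "x \<in> mat_kernel a" "p = (vec_insert j x (?s x), 0)"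
      by blast
    then have "x \<in> carrier_vec m" using in_mat_kernel_iff[OF a] by blast
    then show "p \<in> ?S"
      unfolding x(2) by (rule S[THEN iffD2]) (use x(1) in simp)
  qed
  also have "card \<dots> = card (mat_kernel a)"
    by (rule card_image) (auto simp: inj_on_def vec_insert_inject[OF _ _ j] in_mat_kernel_iff[OF a])
  finally show ?thesis
    using rank_eqI[OF a bordered_simps(1)[OF b t], where k = 0 and l = 0 and d = 2] by simp
qed

section \<open>Character sums over the symmetric matrices of given rank\<close>

lemma sum_Sym_mat_bordered:
  fixes g :: "'a::{field,finite} mat \<Rightarrow> 'b::comm_monoid_add"
  assumes "j \<le> m"
  shows "(\<Sum>b\<in>Sym_mat (Suc m). g b) =
    (\<Sum>a\<in>Sym_mat m. \<Sum>v\<in>carrier_vec m. \<Sum>c\<in>UNIV. g (bordered j a v c))"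
  unfolding sum.reindex_bij_betw[OF bij_betw_bordered[OF assms], symmetric]
  by (simp add: sum.cartesian_product case_prod_unfold)

lemma card_carrier_vec_vanishing:
  assumes "t \<le> m"
  shows "card {v \<in> carrier_vec m :: 'a::{field,finite} vec set. \<forall>i<t. v $ i = 0} = CARD('a) ^ (m - t)"
proof -
  have "bij_betw (\<lambda>v. vec m (\<lambda>i. if i < t then 0 else v $ (i - t))) (carrier_vec (m - t))
    {v \<in> carrier_vec m :: 'a vec set. \<forall>i<t. v $ i = 0}"
    by (rule bij_betw_byWitness[where f' = "\<lambda>v. vec (m - t) (\<lambda>i. v $ (i + t))"])
      (use assms in \<open>auto simp: vec_eq_iff\<close>)
  then show ?thesis
    by (simp add: bij_betw_same_card[symmetric] card_carrier_vec)
qed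

text \<open>To be instantiated with the conjugate of \<theta>, because the Fourier sum conjugates
  the character. The odd order enters through \<open>two_nonzero\<close>, which permits the
  divisions by 2 in the shifts below.\<close>

locale nontrivial_character =
  fixes \<psi> :: "'a::{field,finite} \<Rightarrow> complex" and q :: complex
  assumes zero: "\<psi> 0 = 1" and add: "\<psi> (x + y) = \<psi> x * \<psi> y"
    and nontrivial: "\<exists>x. \<psi> x \<noteq> 1" and two_nonzero: "(2 :: 'a) \<noteq> 0" and q: "q = of_nat CARD('a)"
begin

lemma sum_character: "(\<Sum>d\<in>UNIV. \<psi> (d * c)) = (if c = 0 then q else 0)"
proof (cases "c = 0")
  case False
  obtain x where x: "\<psi> x \<noteq> 1" using nontrivial by blast
  have "(\<Sum>d\<in>UNIV. \<psi> (d * c)) = (\<Sum>d\<in>UNIV. \<psi> ((d + x / c) * c))"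
    by (rule sum.reindex_bij_witness[where i = "\<lambda>d. d + x / c" and j = "\<lambda>d. d - x / c"]) auto
  also have "\<dots> = \<psi> x * (\<Sum>d\<in>UNIV. \<psi> (d * c))"
  proof -
    have "(d + x / c) * c = x + d * c" for d
      using False by (simp add: field_simps)
    then show ?thesis by (simp add: add sum_distrib_left)
  qed
  finally show ?thesis using x False by simp
qed (simp add: zero q)

text \<open>The Fourier sum of the rank function at the diagonal matrix with entries
  \<open>f\<close>. As \<open>f\<close> lives on all natural numbers, the same \<open>f\<close>
  serves matrices of different sizes.\<close>

definition rank_sum :: "nat \<Rightarrow> nat \<Rightarrow> (nat \<Rightarrow> 'a) \<Rightarrow> complex" where
  "rank_sum n r f = (\<Sum>a\<in>Sym_mat n. of_bool (vec_space.rank n a = r) * \<psi> (\<Sum>i<n. f i * a $$ (i, i)))"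

text \<open>The contribution of one border \<open>v\<close> at place \<open>t\<close> after the
  corner has been forced to be 0.\<close>

definition hollow_sum :: "nat \<Rightarrow> nat \<Rightarrow> nat \<Rightarrow> (nat \<Rightarrow> 'a) \<Rightarrow> 'a vec \<Rightarrow> complex" where
  "hollow_sum t m r f v = (\<Sum>a\<in>Sym_mat m.
     of_bool (vec_space.rank (Suc m) (bordered t a v 0) = r) * \<psi> (\<Sum>i<m. f i * a $$ (i, i)))"

lemma hollow_sum_0:
  assumes "t \<le> m"
  shows "hollow_sum t m r f (0\<^sub>v m) = rank_sum m r f"
  unfolding hollow_sum_def rank_sum_def
  by (rule sum.cong) (auto simp: rank_bordered_0[OF _ assms] Sym_mat_def)

text \<open>Adding \<open>v w\<^sup>T + w v\<^sup>T\<close> to the block \<open>a\<close> does not change the rank of the bordered matrix,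
  but multiplies the character value by one that is non-trivial in \<open>w\<close>.\<close>

lemma hollow_sum_eq_0:
  assumes t: "t \<le> m" and l: "l < m" "f l * v $ l \<noteq> 0"
  shows "hollow_sum t m r f v = 0"
proof -
  obtain x where x: "\<psi> x \<noteq> 1" using nontrivial by blast
  \<comment> \<open>Chosen so that 2 * f l * v $ l * w $ l = x, which moves the weighted diagonal
    sum by exactly \<open>x\<close>.\<close>
  define w where "w = vec m (\<lambda>i. if i = l then x / (2 * f l * v $ l) else 0)"
  have w: "w \<in> carrier_vec m" by (simp add: w_def)
  have "(\<Sum>i<m. f i * (v $ i * w $ i + w $ i * v $ i)) = (\<Sum>i<m. if i = l then x else 0)"
    by (rule sum.cong) (use l two_nonzero in \<open>auto simp: w_def field_simps\<close>)
  then have e: "(\<Sum>i<m. f i * sym_shift a v w $$ (i, i)) = x + (\<Sum>i<m. f i * a $$ (i, i))"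
    if "a \<in> carrier_mat m m" for a
    using that l by (simp add: distrib_left sum.distrib)
  have "hollow_sum t m r f v = (\<Sum>a\<in>Sym_mat m.
     of_bool (vec_space.rank (Suc m) (bordered t (sym_shift a v w) v 0) = r) *
     \<psi> (\<Sum>i<m. f i * sym_shift a v w $$ (i, i)))"
    unfolding hollow_sum_def
    by (rule sum.reindex_bij_betw[OF bij_betw_sym_shift[OF w], symmetric])
  also have "\<dots> = \<psi> x * hollow_sum t m r f v"
    unfolding hollow_sum_def sum_distrib_left
    by (rule sum.cong) (auto simp: Sym_mat_def rank_bordered_sym_shift[OF _ t] e add)
  finally show ?thesis using x by simp
qed

text \<open>If \<open>v\<close> lies in the radical of the diagonal form \<open>f\<close>, the same shifts clear row and column
  \<open>j\<close> of \<open>a\<close> without changing the character value, which splits off a hyperbolic plane.\<close>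

lemma hollow_sum_radical:
  assumes t: "t \<le> Suc m" and j: "j \<le> m" "v $ j \<noteq> 0" and f: "\<And>i. i < Suc m \<Longrightarrow> f i * v $ i = 0"
  shows "hollow_sum t (Suc m) r f v =
    q ^ Suc m * (if 2 \<le> r then rank_sum m (r - 2) (\<lambda>i. f (insert_index j i)) else 0)"
proof -
  let ?f = "\<lambda>i. f (insert_index j i)"
  define v' where "v' = vec m (\<lambda>i. v $ insert_index j i)"
  have fj: "f j = 0" using f[of j] j by simp
  have f': "?f i * v' $ i = 0" if "i < m" for i
    using f[of "insert_index j i"] that by (simp add: v'_def insert_index_less)
  have inner: "(\<Sum>a\<in>Sym_mat m. of_bool (vec_space.rank (Suc (Suc m)) (bordered t (bordered j a u c) v 0) = r) *
      \<psi> (\<Sum>i<Suc m. f i * bordered j a u c $$ (i, i))) =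
    (if 2 \<le> r then rank_sum m (r - 2) ?f else 0)" (is "?L = _") if u: "u \<in> carrier_vec m" for u c
  proof -
    \<comment> \<open>\<open>z\<close> and \<open>w'\<close> solve c + 2 z v_j = 0 and u_i + v'_i z
      + v_j w'_i = 0, the conditions for the shift to annihilate row and column
      \<open>j\<close>.\<close>
    define z where "z = - c / (2 * v $ j)"
    define w' where "w' = vec m (\<lambda>i. - (u $ i + v' $ i * z) / v $ j)"
    define w where "w = vec_insert j w' z"
    have w': "w' \<in> carrier_vec m" by (simp add: w'_def)
    note ws = vec_insert_simps[OF w' j(1), where z = z, folded w_def]
    have shift: "sym_shift (bordered j a u c) v w = bordered j (sym_shift a v' w') (0\<^sub>v m) 0"
      if a: "a \<in> carrier_mat m m" for a
    proof -
      note B = bordered_simps[OF a j(1), where v = u and c = c]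
      note B' = bordered_simps[OF sym_shift_simps(1)[OF a, of v' w'] j(1), where v = "0\<^sub>v m" and c = 0]
      have z0: "c + v $ j * z + z * v $ j = 0"
        using j(2) two_nonzero by (simp add: z_def field_simps)
      have w0: "u $ i + v $ insert_index j i * z + w' $ i * v $ j = 0"
        "u $ i + v $ j * w' $ i + z * v $ insert_index j i = 0" if "i < m" for i
        using j(2) that by (simp_all add: w'_def v'_def field_simps)
      have "\<forall>i<Suc m. \<forall>k<Suc m. sym_shift (bordered j a u c) v w $$ (i, k) =
        bordered j (sym_shift a v' w') (0\<^sub>v m) 0 $$ (i, k)"
        unfolding all_less_Suc_insert_index[OF j(1)]
      proof (intro conjI allI impI)
        show "sym_shift (bordered j a u c) v w $$ (j, j) = bordered j (sym_shift a v' w') (0\<^sub>v m) 0 $$ (j, j)"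
          using j(1) B(2) B'(2) ws(2) z0 sym_shift_simps(2)[OF B(1), of j j v w] by simp
      next
        fix i assume i: "i < m"
        show "sym_shift (bordered j a u c) v w $$ (insert_index j i, j) =
            bordered j (sym_shift a v' w') (0\<^sub>v m) 0 $$ (insert_index j i, j)"
          "sym_shift (bordered j a u c) v w $$ (j, insert_index j i) =
            bordered j (sym_shift a v' w') (0\<^sub>v m) 0 $$ (j, insert_index j i)"
          using i j(1) B(3,4) B'(3,4) ws(2,3) w0
            sym_shift_simps(2)[OF B(1), of "insert_index j i" j v w]
            sym_shift_simps(2)[OF B(1), of j "insert_index j i" v w] by (simp_all add: insert_index_less)
        fix k assume k: "k < m"
        show "sym_shift (bordered j a u c) v w $$ (insert_index j i, insert_index j k) =
            bordered j (sym_shift a v' w') (0\<^sub>v m) 0 $$ (insert_index j i, insert_index j k)"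
          using i k a B(5) B'(5) ws(3)
            sym_shift_simps(2)[OF B(1), of "insert_index j i" "insert_index j k" v w]
          by (simp add: insert_index_less) (simp add: v'_def)
      qed
      then show ?thesis
        using carrier_matD[OF sym_shift_simps(1)[OF B(1), of v w]] carrier_matD[OF B'(1)]
        by (simp add: mat_eq_iff)
    qed
    have "?L = (\<Sum>a\<in>Sym_mat m. of_bool (vec_space.rank m (sym_shift a v' w') + 2 = r) *
      \<psi> (\<Sum>i<m. ?f i * sym_shift a v' w' $$ (i, i)))"
    proof (rule sum.cong)
      fix a :: "'a mat" assume "a \<in> Sym_mat m"
      then have a: "a \<in> carrier_mat m m" by (simp add: Sym_mat_def)
      note B = bordered_simps[OF a j(1), where v = u and c = c]
      have "vec_space.rank (Suc (Suc m)) (bordered t (bordered j a u c) v 0) =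
        vec_space.rank m (sym_shift a v' w') + 2"
        using rank_bordered_sym_shift[OF B(1) t, of v w]
          rank_bordered_bordered[OF sym_shift_simps(1)[OF a] j(1) t j(2), of v' w'] shift[OF a] by simp
      moreover have "(\<Sum>i<Suc m. f i * bordered j a u c $$ (i, i)) = (\<Sum>i<m. ?f i * a $$ (i, i))"
        unfolding sum_lessThan_Suc_insert_index[OF j(1)] using B by (simp add: fj)
      moreover have "(\<Sum>i<m. ?f i * sym_shift a v' w' $$ (i, i)) = (\<Sum>i<m. ?f i * a $$ (i, i))"
        using f' a by (intro sum.cong) (auto simp: distrib_left)
      ultimately show "of_bool (vec_space.rank (Suc (Suc m)) (bordered t (bordered j a u c) v 0) = r) *
          \<psi> (\<Sum>i<Suc m. f i * bordered j a u c $$ (i, i)) =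
        of_bool (vec_space.rank m (sym_shift a v' w') + 2 = r) * \<psi> (\<Sum>i<m. ?f i * sym_shift a v' w' $$ (i, i))"
        by simp
    qed simp
    also have "\<dots> = (\<Sum>a\<in>Sym_mat m. of_bool (vec_space.rank m a + 2 = r) * \<psi> (\<Sum>i<m. ?f i * a $$ (i, i)))"
      by (rule sum.reindex_bij_betw[OF bij_betw_sym_shift[OF w']])
    also have "\<dots> = (if 2 \<le> r then rank_sum m (r - 2) ?f else 0)"
      unfolding rank_sum_def by (auto intro!: sum.cong sum.neutral)
    finally show ?thesis .
  qed
  \<comment> \<open>The inner sum over \<open>a\<close> is the same for all \<open>u\<close> and
    \<open>c\<close>; their number is \<open>q ^ Suc m\<close>.\<close>
  have "hollow_sum t (Suc m) r f v = (\<Sum>u\<in>carrier_vec m. \<Sum>c\<in>UNIV. \<Sum>a\<in>Sym_mat m.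
      of_bool (vec_space.rank (Suc (Suc m)) (bordered t (bordered j a u c) v 0) = r) *
      \<psi> (\<Sum>i<Suc m. f i * bordered j a u c $$ (i, i)))"
    unfolding hollow_sum_def sum_Sym_mat_bordered[OF j(1)]
    by (rule trans[OF sum.swap], rule sum.cong[OF refl], rule sum.swap)
  also have "\<dots> = (\<Sum>u\<in>(carrier_vec m :: 'a vec set). \<Sum>c\<in>(UNIV :: 'a set). (if 2 \<le> r then rank_sum m (r - 2) ?f else 0))"
    by (intro sum.cong refl inner)
  finally show ?thesis
    by (simp add: card_carrier_vec q)
qed

text \<open>The support of \<open>f\<close> is exactly the first \<open>t\<close> places. Borders
  that meet it contribute 0, the zero border gives size \<open>m\<close>, and each of the
  \<open>q ^ (m - t) - 1\<close> non-zero borders off the support splits off a hyperbolic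
  plane.\<close>

lemma sum_hollow_sum:
  assumes t: "t \<le> m" and f: "\<And>i. f i = 0 \<longleftrightarrow> t \<le> i"
  shows "(\<Sum>v\<in>carrier_vec m. hollow_sum t m r f v) = rank_sum m r f +
    (q ^ (m - t) - 1) * q ^ m * (if 2 \<le> r then rank_sum (m - 1) (r - 2) f else 0)"
proof -
  let ?V = "{v \<in> carrier_vec m :: 'a vec set. \<forall>i<t. v $ i = 0}"
  let ?G = "if 2 \<le> r then rank_sum (m - 1) (r - 2) f else 0"
  have V: "hollow_sum t m r f v = q ^ m * ?G" if v: "v \<in> ?V - {0\<^sub>v m}" for v
  proof -
    obtain j where j: "j < m" "v $ j \<noteq> 0"
      using v by (auto simp: vec_eq_iff)
    then obtain k where k: "m = Suc k" by (cases m) auto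
    have "t \<le> j" using j v by (cases "t \<le> j") auto
    \<comment> \<open>Deleting a place behind the support only shifts zeros of
      \<open>f\<close>.\<close>
    then have fj: "(\<lambda>i. f (insert_index j i)) = f"
      using f[THEN iffD2] by (auto simp: fun_eq_iff insert_index_def)
    have "f i * v $ i = 0" for i
      using f[of i] v by (cases "t \<le> i") auto
    then show ?thesis
      using hollow_sum_radical[of t k j v f r] t j fj k by simp
  qed
  have "(\<Sum>v\<in>carrier_vec m. hollow_sum t m r f v) = (\<Sum>v\<in>?V. hollow_sum t m r f v)"
  proof (rule sum.mono_neutral_right)
    show "\<forall>v\<in>carrier_vec m - ?V. hollow_sum t m r f v = 0"
    proof
      fix v assume "v \<in> carrier_vec m - ?V"
      then obtain i where "i < t" "v $ i \<noteq> 0" by blast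
      then show "hollow_sum t m r f v = 0"
        using hollow_sum_eq_0[OF t, of i f v] f[of i] t by simp
    qed
  qed auto
  also have "\<dots> = hollow_sum t m r f (0\<^sub>v m) + (\<Sum>v\<in>?V - {0\<^sub>v m}. hollow_sum t m r f v)"
    by (rule sum.remove) (use t in auto)
  also have "\<dots> = rank_sum m r f + of_nat (card (?V - {0\<^sub>v m})) * (q ^ m * ?G)"
    using V by (simp add: hollow_sum_0[OF t])
  also have "card (?V - {0\<^sub>v m}) = CARD('a) ^ (m - t) - 1"
    using t by (subst card_Diff_singleton) (auto simp: card_carrier_vec_vanishing)
  finally show ?thesis
    by (simp add: CARD_field_gt_1 Suc_leI q)
qed

lemma sum_rank_sum_update:
  assumes t: "t \<le> m" and f: "\<And>i. f i = 0 \<longleftrightarrow> t \<le> i"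
  shows "(\<Sum>d\<in>UNIV. rank_sum (Suc m) r (f(t := d))) = q * (rank_sum m r f +
    (q ^ (m - t) - 1) * q ^ m * (if 2 \<le> r then rank_sum (m - 1) (r - 2) f else 0))"
proof -
  let ?R = "\<lambda>a v c. of_bool (vec_space.rank (Suc m) (bordered t a v c) = r) :: complex"
  have e: "(\<Sum>i<Suc m. (f(t := d)) i * bordered t a v c $$ (i, i)) = d * c + (\<Sum>i<m. f i * a $$ (i, i))"
    if "a \<in> carrier_mat m m" for a v c d
  proof -
    have "f (insert_index t i) = f i" for i
      using f[THEN iffD2] by (auto simp: insert_index_def)
    then show ?thesis
      unfolding sum_lessThan_Suc_insert_index[OF t] using that t by simp
  qed
  have "(\<Sum>d\<in>UNIV. rank_sum (Suc m) r (f(t := d))) = (\<Sum>d\<in>UNIV. \<Sum>a\<in>Sym_mat m. \<Sum>v\<in>carrier_vec m. \<Sum>c\<in>UNIV.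
      ?R a v c * (\<psi> (d * c) * \<psi> (\<Sum>i<m. f i * a $$ (i, i))))"
    unfolding rank_sum_def sum_Sym_mat_bordered[OF t]
    by (intro sum.cong refl) (simp add: e Sym_mat_def add del: fun_upd_apply sum.lessThan_Suc)
  also have "\<dots> = (\<Sum>a\<in>Sym_mat m. \<Sum>v\<in>carrier_vec m. \<Sum>c\<in>UNIV. \<Sum>d\<in>UNIV.
      ?R a v c * (\<psi> (d * c) * \<psi> (\<Sum>i<m. f i * a $$ (i, i))))"
    by (rule trans[OF sum.swap], rule sum.cong[OF refl], rule trans[OF sum.swap], rule sum.cong[OF refl], rule sum.swap)
  also have "\<dots> = (\<Sum>a\<in>Sym_mat m. \<Sum>v\<in>carrier_vec m. \<Sum>c\<in>UNIV.
      if c = 0 then q * (?R a v c * \<psi> (\<Sum>i<m. f i * a $$ (i, i))) else 0)"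
    by (intro sum.cong refl) (simp add: sum_character flip: sum_distrib_left sum_distrib_right)
  also have "\<dots> = q * (\<Sum>v\<in>carrier_vec m. hollow_sum t m r f v)"
    unfolding hollow_sum_def sum_distrib_left by (subst sum.swap) simp
  finally show ?thesis
    by (simp add: sum_hollow_sum[OF assms])
qed

text \<open>The count is split by the corner. Corner 0 is the case \<open>t = 0\<close> of
  \<open>sum_hollow_sum\<close>; a non-zero corner leaves a Schur complement of rank r - 1.\<close>

lemma rank_sum_zero_Suc:
  "rank_sum (Suc m) r (\<lambda>_. 0) = rank_sum m r (\<lambda>_. 0) +
    (q ^ m - 1) * q ^ m * (if 2 \<le> r then rank_sum (m - 1) (r - 2) (\<lambda>_. 0) else 0) +
    (q - 1) * q ^ m * (if 1 \<le> r then rank_sum m (r - 1) (\<lambda>_. 0) else 0)"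
proof -
  let ?G = "if 1 \<le> r then rank_sum m (r - 1) (\<lambda>_. 0) else 0"
  have inner: "(\<Sum>a\<in>(Sym_mat m :: 'a mat set). of_bool (vec_space.rank (Suc m) (bordered 0 a v c) = r)) = ?G"
    if v: "v \<in> carrier_vec m" and c: "c \<noteq> 0" for v :: "'a vec" and c
  proof -
    \<comment> \<open>For w = - v / (2 c) the shift v w^T + w v^T is - v v^T / c. So passing to the
      Schur complement is a \<open>sym_shift\<close>, hence a bijection of
      \<open>Sym_mat m\<close>.\<close>
    have w: "- (1 / (2 * c)) \<cdot>\<^sub>v v \<in> carrier_vec m" using v by simp
    have "(\<Sum>a\<in>(Sym_mat m :: 'a mat set). of_bool (vec_space.rank (Suc m) (bordered 0 a v c) = r)) =
      (\<Sum>a\<in>(Sym_mat m :: 'a mat set). of_bool (vec_space.rank m (sym_shift a v (- (1 / (2 * c)) \<cdot>\<^sub>v v)) + 1 = r) :: complex)"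
    proof (rule sum.cong)
      fix a :: "'a mat" assume "a \<in> Sym_mat m"
      then have a: "a \<in> carrier_mat m m" by (simp add: Sym_mat_def)
      have "mat m m (\<lambda>(i, k). a $$ (i, k) - v $ i * v $ k / c) = sym_shift a v (- (1 / (2 * c)) \<cdot>\<^sub>v v)"
        by (rule eq_matI) (use a v c two_nonzero in \<open>auto simp: field_simps sym_shift_def\<close>)
      then show "of_bool (vec_space.rank (Suc m) (bordered 0 a v c) = r) =
        (of_bool (vec_space.rank m (sym_shift a v (- (1 / (2 * c)) \<cdot>\<^sub>v v)) + 1 = r) :: complex)"
        using rank_bordered_corner[OF a _ c, of 0 v] by simp
    qed simp
    also have "\<dots> = (\<Sum>a\<in>(Sym_mat m :: 'a mat set). of_bool (vec_space.rank m a + 1 = r))"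
      by (rule sum.reindex_bij_betw[OF bij_betw_sym_shift[OF w]])
    also have "\<dots> = ?G"
      unfolding rank_sum_def by (cases r) (simp_all add: zero)
    finally show ?thesis .
  qed
  have "rank_sum (Suc m) r (\<lambda>_. 0) = (\<Sum>a\<in>(Sym_mat m :: 'a mat set). \<Sum>v\<in>carrier_vec m. \<Sum>c\<in>UNIV.
      of_bool (vec_space.rank (Suc m) (bordered 0 a v c) = r))"
    unfolding rank_sum_def sum_Sym_mat_bordered[OF le0] by (simp add: zero)
  also have "\<dots> = (\<Sum>v\<in>carrier_vec m. \<Sum>a\<in>(Sym_mat m :: 'a mat set). \<Sum>c\<in>UNIV.
      of_bool (vec_space.rank (Suc m) (bordered 0 a v c) = r))"
    by (rule sum.swap)
  also have "\<dots> = (\<Sum>c\<in>UNIV. \<Sum>v\<in>carrier_vec m. \<Sum>a\<in>(Sym_mat m :: 'a mat set).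
      of_bool (vec_space.rank (Suc m) (bordered 0 a v c) = r))"
    by (rule trans[OF sum.cong[OF refl sum.swap] sum.swap])
  also have "\<dots> = (\<Sum>v\<in>carrier_vec m. hollow_sum 0 m r (\<lambda>_. 0) v) +
    (\<Sum>c\<in>UNIV - {0}. \<Sum>v\<in>carrier_vec m. \<Sum>a\<in>(Sym_mat m :: 'a mat set).
      of_bool (vec_space.rank (Suc m) (bordered 0 a v c) = r))"
    by (subst sum.remove[of _ 0]) (auto simp: hollow_sum_def zero)
  also have "(\<Sum>c\<in>UNIV - {0}. \<Sum>v\<in>carrier_vec m. \<Sum>a\<in>(Sym_mat m :: 'a mat set).
      of_bool (vec_space.rank (Suc m) (bordered 0 a v c) = r)) =
    (\<Sum>c\<in>UNIV - {0 :: 'a}. \<Sum>v\<in>(carrier_vec m :: 'a vec set). ?G)"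
    by (intro sum.cong refl inner) auto
  also have "\<dots> = (q - 1) * q ^ m * ?G"
    by (simp add: card_carrier_vec CARD_field_gt_1 Suc_leI q)
  finally show ?thesis
    by (simp add: sum_hollow_sum)
qed

end

section \<open>The \<open>q\<close>-hypergeometric side\<close>

lemma q_poch_Suc: "q_poch a q (Suc k) = q_poch a q k * (1 - a * q ^ k)"
  by (simp add: q_poch_def)

lemma q_poch_Suc': "q_poch a q (Suc k) = (1 - a) * q_poch (a * q) q k"
  unfolding q_poch_def prod.lessThan_Suc_shift by (simp add: ac_simps)

lemma q_poch_0 [simp]: "q_poch a q 0 = 1"
  by (simp add: q_poch_def)

lemma q_poch_eq_0I: "i < k \<Longrightarrow> a * q ^ i = 1 \<Longrightarrow> q_poch a q k = 0"
  by (auto simp: q_poch_def)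

locale q_base =
  fixes q :: "'b::field"
  assumes q_nonzero [simp]: "q \<noteq> 0" and q_power [simp]: "k > 0 \<Longrightarrow> q ^ k \<noteq> 1"
begin

text \<open>At z = q^n the factors are q^n - 1, q^(n-1) - 1 and so on, \<open>k\<close> of them, and
  the product vanishes for k > n.\<close>

definition falling :: "'b \<Rightarrow> nat \<Rightarrow> 'b" where
  "falling z k = (\<Prod>j<k. z / q ^ j - 1)"

definition coeff :: "nat \<Rightarrow> 'b" where
  "coeff x = (\<Prod>i<x. q ^ (2 * i + 2) / (q ^ (2 * i + 2) - 1))"

definition rank_count :: "'b \<Rightarrow> nat \<Rightarrow> 'b" where
  "rank_count z r = coeff (r div 2) * falling z r"

text \<open>Here \<open>z\<close> stands for \<open>q ^ n\<close>: passing to sizes \<open>n - 1\<close> and \<open>n - 2\<close> becomes the substitution of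
  \<open>z / q\<close> and \<open>z / q\<^sup>2\<close>, so the identities below need no lower bound on \<open>n\<close>. At \<open>z = q ^ n\<close>,
  \<open>rank_count\<close> is the number of symmetric matrices of rank \<open>r\<close>, and \<open>psi_sum y z x\<close> is
  \<open>(-1) ^ r\<close> times the coefficient of the theorem.\<close>

primrec psi_sum :: "nat \<Rightarrow> 'b \<Rightarrow> nat \<Rightarrow> 'b" where
  "psi_sum 0 z x = coeff x * falling (z / q) (2 * x)"
| "psi_sum (Suc y) z x = psi_sum y z x -
    (if x = 0 then 0 else z\<^sup>2 / q ^ (2 * y + 3) * psi_sum y (z / q\<^sup>2) (x - 1))"

lemma falling_0 [simp]: "falling z 0 = 1"
  by (simp add: falling_def)

lemma falling_Suc: "falling z (Suc k) = falling z k * (z / q ^ k - 1)"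
  by (simp add: falling_def)

lemma falling_Suc': "falling z (Suc k) = (z - 1) * falling (z / q) k"
  unfolding falling_def prod.lessThan_Suc_shift by (simp add: ac_simps)

lemma coeff_0 [simp]: "coeff 0 = 1"
  by (simp add: coeff_def)

text \<open>Written from the higher index to the lower one, so that all terms of a recurrence
  acquire the common factor \<open>coeff (Suc x)\<close>.\<close>

lemma coeff_eq_Suc: "coeff x = coeff (Suc x) * (1 - 1 / q ^ (2 * x + 2))"
  using q_power[of "2 * x + 2"] by (simp add: coeff_def field_simps del: q_power)

lemma psi_sum_x_0 [simp]: "psi_sum y z 0 = 1"
  by (induction y) simp_all

lemma psi_sum_0_Suc:
  "psi_sum 0 z (Suc x) * (1 - 1 / q ^ (2 * x + 2)) = (z / q - 1) * (z / q\<^sup>2 - 1) * psi_sum 0 (z / q\<^sup>2) x"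
  by (simp add: falling_Suc' power2_eq_square coeff_eq_Suc[of x] mult_ac)

text \<open>Its use is to eliminate the values for size n - 1, that is at \<open>z / q\<close>, from
  the recurrence in the rank.\<close>

lemma psi_sum_rec:
  "psi_sum y z x = psi_sum y (z / q) x +
    (z / q ^ (2 * y + 2) - 1) * (z / q) * (if x = 0 then 0 else psi_sum y (z / q\<^sup>2) (x - 1))"
proof (induction y arbitrary: z x)
  case 0
  show ?case
  proof (cases x)
    case (Suc k)
    define R where "R = falling (z / q ^ 3) (2 * k)"
    define e where "e = 1 / q ^ (2 * k + 2)"
    define C where "C = coeff (Suc k)"
    have e1: "psi_sum 0 z x = C * ((z / q - 1) * (z / q\<^sup>2 - 1) * R)"
      by (simp add: Suc C_def falling_Suc' R_def power2_eq_square power3_eq_cube mult_ac)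
    have e2: "psi_sum 0 (z / q) x = C * ((z / q\<^sup>2 - 1) * (R * (z / q * e - 1)))"
    proof -
      have "falling (z / q / q) (2 * x) = (z / q / q - 1) * (falling (z / q / q / q) (2 * k) * (z / q / q / q / q ^ (2 * k) - 1))"
        unfolding Suc mult_Suc_right add_2_eq_Suc falling_Suc'[of _ "Suc (2 * k)"] by (simp only: falling_Suc)
      moreover have "z / q / q / q = z / q ^ 3" "z / q / q = z / q\<^sup>2" "z / q ^ 3 / q ^ (2 * k) = z / q * e"
        by (simp_all add: e_def power2_eq_square power3_eq_cube power_add)
      ultimately show ?thesis
        by (simp only: psi_sum.simps) (simp add: Suc C_def R_def)
    qed
    have e3: "psi_sum 0 (z / q\<^sup>2) (x - 1) = C * (1 - e) * R"
      using coeff_eq_Suc[of k] by (simp add: Suc C_def e_def R_def power2_eq_square power3_eq_cube mult_ac)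
    \<comment> \<open>Once the common factors are extracted, \<open>z / q\<close> and
      \<open>z / q\<^sup>2\<close> can be treated as independent variables \<open>u\<close> and
      \<open>w\<close>.\<close>
    have "C * ((u - 1) * (w - 1) * R) = C * ((w - 1) * (R * (u * e - 1))) + (w - 1) * u * (C * (1 - e) * R)" for u w
      by (simp add: algebra_simps)
    then show ?thesis
      unfolding e1 e2 e3 using Suc by (simp add: power2_eq_square)
  qed simp
next
  case (Suc y)
  show ?case
  proof (cases "x = 0")
    case False
    define a where "a = q ^ (2 * y)"
    have a: "a \<noteq> 0" by (simp add: a_def)
    \<comment> \<open>\<open>B\<close>, \<open>C\<close> and \<open>D\<close> are the
      level-\<open>y\<close> values left after unfolding. The induction hypothesis is applied at
      \<open>z\<close>, \<open>x\<close> and again at \<open>z / q\<^sup>2\<close>,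
      \<open>x - 1\<close>.\<close>
    define B where "B = psi_sum y (z / q / q\<^sup>2) (x - 1)"
    define C where "C = (if x - 1 = 0 then 0 else psi_sum y (z / q\<^sup>2 / q\<^sup>2) (x - 1 - 1))"
    define D where "D = psi_sum y (z / q\<^sup>2) (x - 1)"
    have A: "D = B + (z / q\<^sup>2 / (a * q\<^sup>2) - 1) * (z / q\<^sup>2 / q) * C"
      unfolding D_def Suc.IH[of "z / q\<^sup>2" "x - 1"] B_def C_def a_def
      by (simp add: power_add eval_nat_numeral mult_ac)
    have e1: "psi_sum (Suc y) z x = psi_sum y (z / q) x + ((z / (a * q\<^sup>2) - 1) * (z / q) * D - z\<^sup>2 / (a * q ^ 3) * D)"
      unfolding psi_sum.simps using False Suc.IH[of z x] by (simp add: D_def a_def power_add eval_nat_numeral mult_ac)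
    have e2: "psi_sum (Suc y) (z / q) x = psi_sum y (z / q) x - (z / q)\<^sup>2 / (a * q ^ 3) * B"
      unfolding psi_sum.simps using False by (simp add: B_def a_def power_add mult_ac)
    have e3: "psi_sum (Suc y) (z / q\<^sup>2) (x - 1) = D - (z / q\<^sup>2)\<^sup>2 / (a * q ^ 3) * C"
      unfolding psi_sum.simps D_def C_def by (simp add: a_def power_add mult_ac)
    have e4: "(z / (a * q\<^sup>2) - 1) * (z / q) * D - z\<^sup>2 / (a * q ^ 3) * D = - ((z / q)\<^sup>2 / (a * q ^ 3) * B) +
       (z / (a * q ^ 4) - 1) * (z / q) * (D - (z / q\<^sup>2)\<^sup>2 / (a * q ^ 3) * C)"
    proof -
      \<comment> \<open>Reciprocals as variables turn the identity of fractions into one of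
        polynomials.\<close>
      define p b where "p = inverse q" and "b = inverse a"
      have D: "D = B + (z * b * p ^ 4 - 1) * (z * p ^ 3) * C"
        unfolding A p_def b_def
        by (simp add: divide_inverse power_inverse eval_nat_numeral mult_ac)
      have "(z * b * p\<^sup>2 - 1) * (z * p) * D - z\<^sup>2 * b * p ^ 3 * D = - ((z * p)\<^sup>2 * b * p ^ 3 * B) +
          (z * b * p ^ 4 - 1) * (z * p) * (D - (z * p\<^sup>2)\<^sup>2 * b * p ^ 3 * C)"
        unfolding D by (simp add: algebra_simps eval_nat_numeral)
      then show ?thesis
        unfolding p_def b_def by (simp add: divide_inverse power_inverse mult_ac)
    qed
    have "q ^ (2 * Suc y + 2) = a * q ^ 4"
      by (simp add: a_def eval_nat_numeral mult_ac)
    then show ?thesis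
      unfolding e1 e2 e3 using False by (simp only: if_False e4) (simp only: diff_conv_add_uminus add.assoc)
  qed simp
qed

text \<open>At a = q^m this is the recurrence of \<open>rank_sum_zero_Suc\<close>. Parity matters
  because passing from r to r - 1 lowers the index of \<open>coeff\<close> only for even r.\<close>

lemma rank_count_rec:
  "rank_count (q * a) r = rank_count a r +
    (a - 1) * a * (if 2 \<le> r then rank_count (a / q) (r - 2) else 0) +
    (q - 1) * a * (if 1 \<le> r then rank_count a (r - 1) else 0)"
proof -
  consider "r = 0" | "r = 1" | x where "r = 2 * x + 2" | x where "r = 2 * x + 3"
    by atomize_elim presburger
  then show ?thesis
  proof cases
    case (3 x)
    define R where "R = falling (a / q) (2 * x)"
    define e where "e = 1 / q ^ (2 * x + 2)"
    define C where "C = coeff (Suc x)"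
    have d: "r div 2 = Suc x" "(r - 2) div 2 = x" "(r - 1) div 2 = x" "r - 2 = 2 * x" "r - 1 = 2 * x + 1"
      using 3 by auto
    have e1: "rank_count (q * a) r = C * ((q * a - 1) * ((a - 1) * R))"
      by (simp add: rank_count_def d(1) C_def) (simp add: 3 falling_Suc' R_def)
    have e2: "rank_count a r = C * ((a - 1) * (R * (q * a * e - 1)))"
    proof -
      have "falling a r = (a - 1) * (R * (a / q / q ^ (2 * x) - 1))"
        unfolding 3 add_2_eq_Suc' falling_Suc'[of a "Suc (2 * x)"] by (simp only: falling_Suc R_def)
      then show ?thesis
        by (simp add: rank_count_def d(1) C_def e_def)
    qed
    have e3: "rank_count (a / q) (r - 2) = C * (1 - e) * R"
      by (simp add: rank_count_def d(2,4) C_def R_def e_def coeff_eq_Suc[of x])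
    have e4: "rank_count a (r - 1) = C * (1 - e) * ((a - 1) * R)"
      by (simp only: rank_count_def d(3) d(5) Suc_eq_plus1[symmetric] falling_Suc') (simp add: C_def R_def e_def coeff_eq_Suc[of x])
    show ?thesis
      unfolding e1 e2 e3 e4 using 3 by (simp add: algebra_simps)
  next
    case (4 x)
    define R where "R = falling (a / q) (2 * x + 1)"
    define e where "e = 1 / q ^ (2 * x + 2)"
    define C where "C = coeff (Suc x)"
    have d: "r div 2 = Suc x" "(r - 2) div 2 = x" "(r - 1) div 2 = Suc x" "r - 2 = 2 * x + 1" "r - 1 = 2 * x + 2"
      "r = Suc (Suc (2 * x + 1))"
      using 4 by auto
    have e1: "rank_count (q * a) r = C * ((q * a - 1) * ((a - 1) * R))"
      by (simp only: rank_count_def d(1) C_def) (simp add: d(6) falling_Suc' R_def)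
    have e2: "rank_count a r = C * ((a - 1) * (R * (a * e - 1)))"
    proof -
      have "falling a r = (a - 1) * (R * (a / q / q ^ (2 * x + 1) - 1))"
        unfolding d(6) falling_Suc'[of a "Suc _"] falling_Suc[of "a / q" "2 * x + 1"] R_def ..
      then show ?thesis
        by (simp add: rank_count_def d(1) C_def e_def)
    qed
    have e3: "rank_count (a / q) (r - 2) = C * (1 - e) * R"
      by (simp add: rank_count_def d(2,4) C_def R_def e_def coeff_eq_Suc[of x])
    have e4: "rank_count a (r - 1) = C * ((a - 1) * R)"
      by (simp only: rank_count_def d(3) C_def) (simp only: d(5) R_def add_2_eq_Suc' Suc_eq_plus1[symmetric] falling_Suc'[of a])
    show ?thesis
      unfolding e1 e2 e3 e4 using 4 by (simp add: algebra_simps)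
  qed (simp_all add: rank_count_def falling_Suc algebra_simps)
qed

text \<open>At z = q^n the left side is the averaged Fourier value for rank s = 1, as it results
  from the count at s = 0.\<close>

lemma rank_count_diff:
  "rank_count z r - z * (if 1 \<le> r then rank_count (z / q) (r - 1) else 0) = (- 1) ^ r * psi_sum 0 z (r div 2)"
proof -
  consider "r = 0" | x where "r = 2 * x + 1" | x where "r = 2 * x + 2"
    by atomize_elim presburger
  then show ?thesis
  proof cases
    case (2 x)
    then show ?thesis by (simp add: rank_count_def falling_Suc' algebra_simps)
  next
    case (3 x)
    define R where "R = falling (z / q) (2 * x + 1)"
    define e where "e = 1 / q ^ (2 * x + 2)"
    define C where "C = coeff (Suc x)"
    have d: "r div 2 = Suc x" "(r - 1) div 2 = x" "r - 1 = 2 * x + 1" "r = Suc (2 * x + 1)" "(- 1) ^ r = (1 :: 'b)"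
      using 3 by auto
    have e1: "psi_sum 0 z (r div 2) = C * (R * (z * e - 1))"
    proof -
      have "falling (z / q) (2 * Suc x) = R * (z / q / q ^ (2 * x + 1) - 1)"
        unfolding mult_Suc_right add_2_eq_Suc R_def falling_Suc[of "z / q" "Suc (2 * x)"] by simp
      then show ?thesis
        by (simp add: d(1) C_def e_def)
    qed
    have e2: "rank_count z r = C * ((z - 1) * R)"
      by (simp only: rank_count_def d(1) C_def) (simp only: d(4) R_def falling_Suc')
    have e3: "rank_count (z / q) (r - 1) = C * (1 - e) * R"
      by (simp only: rank_count_def d(2,3)) (simp add: C_def R_def e_def coeff_eq_Suc[of x])
    show ?thesis
      unfolding e1 e2 e3 d(5) using 3 by (simp add: algebra_simps)
  qed (simp add: rank_count_def)
qed

end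

section \<open>Expansion into affine q-Krawtchouk polynomials\<close>

context q_base
begin

lemma falling_power_eq_0: "m < k \<Longrightarrow> falling (q ^ m) k = 0"
  by (auto simp: falling_def intro!: bexI[of _ m])

text \<open>Up to the sign (-1)^k and a power of q, the Gaussian binomial coefficient of
  \<open>y\<close> over \<open>k\<close> in base q^2.\<close>

definition kraw_coeff :: "nat \<Rightarrow> nat \<Rightarrow> 'b" where
  "kraw_coeff y k = q_poch (1 / q ^ (2 * y)) (q\<^sup>2) k / q_poch (q\<^sup>2) (q\<^sup>2) k"

text \<open>Let S send a function F(z, x) to (z^2 / q) F(z / q^2, x - 1), and to 0 at x = 0. For k
  \<le> x this is the k-th iterate of S applied to \<open>psi_sum 0\<close>; its prefactor is the
  product of (z / q^(2 i))^2 / q over i < k.\<close>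

definition kraw_term :: "'b \<Rightarrow> nat \<Rightarrow> nat \<Rightarrow> 'b" where
  "kraw_term z x k = z ^ (2 * k) * q ^ k / q ^ (2 * k * k) * psi_sum 0 (z / q ^ (2 * k)) (x - k)"

lemma q2_power: "q\<^sup>2 * (q\<^sup>2) ^ i = q ^ (2 * i + 2)" "q * (q\<^sup>2) ^ i = q ^ (2 * i + 1)"
  by (metis add.commute power_add power_mult) (simp add: power_mult)

lemma q_poch_q2_nonzero [simp]: "q_poch (q\<^sup>2) (q\<^sup>2) k \<noteq> 0"
proof -
  have "1 - q\<^sup>2 * (q\<^sup>2) ^ i \<noteq> 0" for i
    using q_power[of "2 * i + 2"] by (simp add: q2_power del: q_power)
  then show ?thesis by (simp add: q_poch_def)
qed

lemma kraw_coeff_eq_0: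
  assumes "y < k"
  shows "kraw_coeff y k = 0"
proof -
  have "q_poch (1 / q ^ (2 * y)) (q\<^sup>2) k = 0"
    using assms by (intro q_poch_eq_0I[of y]) (simp_all flip: power_mult)
  then show ?thesis by (simp add: kraw_coeff_def)
qed

lemma kraw_coeff_0 [simp]: "kraw_coeff y 0 = 1"
  by (simp add: kraw_coeff_def)

text \<open>The Pascal rule for Gaussian binomials in the normalisation of
  \<open>kraw_coeff\<close>.\<close>

lemma kraw_coeff_Suc: "kraw_coeff (Suc y) (Suc k) = kraw_coeff y (Suc k) - kraw_coeff y k / q ^ (2 * y + 2)"
proof -
  define P where "P = q_poch (1 / q ^ (2 * y)) (q\<^sup>2) k"
  define Q where "Q = q_poch (q\<^sup>2) (q\<^sup>2) k"
  define u where "u = q ^ (2 * y + 2)"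
  define w where "w = q ^ (2 * k + 2)"
  have nz: "u \<noteq> 0" "Q \<noteq> 0" "1 - w \<noteq> 0"
    using q_power[of "2 * k + 2"] by (simp_all add: u_def Q_def w_def del: q_power)
  have "q_poch (1 / q ^ (2 * Suc y)) (q\<^sup>2) (Suc k) = (1 - 1 / u) * P"
    unfolding q_poch_Suc' P_def u_def by (simp add: power2_eq_square)
  moreover have "q_poch (1 / q ^ (2 * y)) (q\<^sup>2) (Suc k) = P * (1 - w / u)"
    unfolding q_poch_Suc P_def u_def w_def by (simp add: power_mult power_add power2_eq_square)
  moreover have "q_poch (q\<^sup>2) (q\<^sup>2) (Suc k) = Q * (1 - w)"
    unfolding q_poch_Suc Q_def w_def q2_power ..
  ultimately have "kraw_coeff (Suc y) (Suc k) = (1 - 1 / u) * P / (Q * (1 - w))"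
    "kraw_coeff y (Suc k) = P * (1 - w / u) / (Q * (1 - w))" "kraw_coeff y k = P / Q"
    by (simp_all only: kraw_coeff_def P_def Q_def)
  moreover have "(1 - 1 / u) * P / (Q * (1 - w)) = P * (1 - w / u) / (Q * (1 - w)) - P / Q / u"
    using nz by (simp add: divide_simps) (simp add: algebra_simps)
  ultimately show ?thesis
    by (simp only: u_def)
qed

lemma kraw_term_Suc: "kraw_term z (Suc x) (Suc k) = z\<^sup>2 / q * kraw_term (z / q\<^sup>2) x k"
proof -
  have "z ^ (2 * Suc k) * q ^ Suc k / q ^ (2 * Suc k * Suc k) = z\<^sup>2 / q * ((z / q\<^sup>2) ^ (2 * k) * q ^ k / q ^ (2 * k * k))"
  proof -
    have "2 * Suc k * Suc k = 2 * k * k + 4 * k + 2" by (simp add: algebra_simps)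
    then have 1: "q ^ (2 * Suc k * Suc k) = q ^ (2 * k * k) * q ^ (4 * k) * q\<^sup>2"
      by (simp only: power_add)
    have 2: "(z / q\<^sup>2) ^ (2 * k) = z ^ (2 * k) / q ^ (4 * k)"
      by (simp add: power_divide flip: power_mult)
    show ?thesis
      unfolding 1 2 by (simp add: power2_eq_square mult_ac)
  qed
  moreover have "z / q ^ (2 * Suc k) = z / q\<^sup>2 / q ^ (2 * k)"
    by (simp add: power2_eq_square)
  ultimately show ?thesis
    unfolding kraw_term_def by (simp only: diff_Suc_Suc mult.assoc)
qed

text \<open>With the operator S described at \<open>kraw_term\<close>,
  \<open>psi_sum (Suc y)\<close> is (1 - q^(-2 y - 2) S) applied to \<open>psi_sum y\<close>: the
  exponent 2 y + 3 is 2 y + 2 from the Pascal rule and 1 from S. The expansion is the q-binomial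
  theorem for the product of these commuting factors.\<close>

lemma psi_sum_expand: "psi_sum y z x = (\<Sum>k\<le>x. kraw_coeff y k * kraw_term z x k)"
proof (induction y arbitrary: z x)
  case 0
  have "(\<Sum>k\<le>x. kraw_coeff 0 k * kraw_term z x k) = (\<Sum>k\<in>{0}. kraw_coeff 0 k * kraw_term z x k)"
    by (rule sum.mono_neutral_right) (auto simp: kraw_coeff_eq_0)
  then show ?case by (simp add: kraw_term_def)
next
  case (Suc y)
  show ?case
  proof (cases x)
    case 0
    then show ?thesis by (simp add: kraw_term_def)
  next
    case x: (Suc m)
    have "(\<Sum>k\<le>x. kraw_coeff (Suc y) k * kraw_term z x k) =
      kraw_term z x 0 + (\<Sum>k\<le>m. kraw_coeff (Suc y) (Suc k) * kraw_term z x (Suc k))"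
      unfolding x sum.atMost_Suc_shift by simp
    also have "\<dots> = kraw_term z x 0 + (\<Sum>k\<le>m. kraw_coeff y (Suc k) * kraw_term z x (Suc k)) -
        z\<^sup>2 / q ^ (2 * y + 3) * (\<Sum>k\<le>m. kraw_coeff y k * kraw_term (z / q\<^sup>2) m k)"
    proof -
      have "kraw_coeff (Suc y) (Suc k) * kraw_term z x (Suc k) = kraw_coeff y (Suc k) * kraw_term z x (Suc k) -
          z\<^sup>2 / q ^ (2 * y + 3) * (kraw_coeff y k * kraw_term (z / q\<^sup>2) m k)" for k
        unfolding kraw_coeff_Suc x kraw_term_Suc
        by (simp add: algebra_simps power_add eval_nat_numeral diff_divide_distrib)
      then show ?thesis
        by (simp add: sum_subtractf sum_distrib_left del: sum.atMost_Suc)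
    qed
    also have "kraw_term z x 0 + (\<Sum>k\<le>m. kraw_coeff y (Suc k) * kraw_term z x (Suc k)) =
        (\<Sum>k\<le>x. kraw_coeff y k * kraw_term z x k)"
      unfolding x sum.atMost_Suc_shift by simp
    finally show ?thesis
      using x by (simp add: Suc.IH del: sum.atMost_Suc)
  qed
qed

text \<open>The ratio of \<open>kraw_term z x k\<close> to \<open>psi_sum 0 z x\<close> is the part
  of the Krawtchouk summand that involves \<open>x\<close> and \<open>z\<close>. It is stated
  without division because the Pochhammer symbols on the right may vanish.\<close>

lemma psi_sum_0_kraw_term:
  assumes "z \<noteq> 0" "k \<le> x"
  shows "psi_sum 0 z x * q_poch (1 / q ^ (2 * x)) (q\<^sup>2) k * q ^ (2 * k) =
    kraw_term z x k * (q_poch (q / z) (q\<^sup>2) k * q_poch (q\<^sup>2 / z) (q\<^sup>2) k)"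
  using assms(2)
proof (induction k)
  case 0
  show ?case by (simp add: kraw_term_def)
next
  case (Suc k)
  \<comment> \<open>Passing from k to k + 1 is one application of \<open>psi_sum_0_Suc\<close> at
    the shifted argument \<open>w\<close>.\<close>
  define w where "w = z / q ^ (2 * k)"
  obtain m where m: "x = Suc (m + k)"
    using Suc.prems by (metis Suc_le_lessD add.commute less_imp_Suc_add)
  have w: "w \<noteq> 0" using assms(1) by (simp add: w_def)
  define T where "T = z ^ (2 * k) * q ^ k / q ^ (2 * k * k)"
  have T: "kraw_term z x k = T * psi_sum 0 w (Suc m)"
    by (simp add: kraw_term_def T_def m w_def Suc_diff_le)
  have T': "kraw_term z x (Suc k) = T * (w\<^sup>2 / q) * psi_sum 0 (w / q\<^sup>2) m"
  proof -
    have "2 * Suc k * Suc k = 2 * k * k + 2 * k + 2 * k + 2" by (simp add: algebra_simps)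
    then have 1: "q ^ (2 * Suc k * Suc k) = q ^ (2 * k * k) * q ^ (2 * k) * q ^ (2 * k) * q\<^sup>2"
      by (simp only: power_add)
    have "z ^ (2 * Suc k) * q ^ Suc k / q ^ (2 * Suc k * Suc k) = T * (w\<^sup>2 / q)"
      unfolding 1 T_def w_def by (simp add: power2_eq_square mult_ac)
    moreover have "z / q ^ (2 * Suc k) = w / q\<^sup>2"
      by (simp add: w_def power2_eq_square)
    ultimately show ?thesis
      unfolding kraw_term_def by (simp add: m)
  qed
  have 1: "q_poch (1 / q ^ (2 * x)) (q\<^sup>2) (Suc k) = q_poch (1 / q ^ (2 * x)) (q\<^sup>2) k * (1 - 1 / q ^ (2 * m + 2))"
    unfolding q_poch_Suc m by (simp add: power_add power_mult mult_2 power_mult_distrib power2_eq_square)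
  have 2: "q_poch (q / z) (q\<^sup>2) (Suc k) = q_poch (q / z) (q\<^sup>2) k * (1 - q / w)"
    unfolding q_poch_Suc by (simp add: w_def power_mult)
  have 3: "q_poch (q\<^sup>2 / z) (q\<^sup>2) (Suc k) = q_poch (q\<^sup>2 / z) (q\<^sup>2) k * (1 - q\<^sup>2 / w)"
    unfolding q_poch_Suc by (simp add: w_def power_mult)
  define P Q where "P = q_poch (1 / q ^ (2 * x)) (q\<^sup>2) k"
    and "Q = q_poch (q / z) (q\<^sup>2) k * q_poch (q\<^sup>2 / z) (q\<^sup>2) k"
  define e where "e = 1 - 1 / q ^ (2 * m + 2)"
  have IH: "psi_sum 0 z x * P * q ^ (2 * k) = T * psi_sum 0 w (Suc m) * Q"
    using Suc by (simp add: T P_def Q_def)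
  have "psi_sum 0 z x * (P * e) * q ^ (2 * Suc k) = (psi_sum 0 z x * P * q ^ (2 * k)) * e * q\<^sup>2"
    by (simp add: power2_eq_square mult_ac)
  also have "\<dots> = T * Q * (psi_sum 0 w (Suc m) * e) * q\<^sup>2"
    unfolding IH by (simp only: mult_ac)
  also have "\<dots> = T * Q * ((w / q - 1) * (w / q\<^sup>2 - 1) * q\<^sup>2) * psi_sum 0 (w / q\<^sup>2) m"
    unfolding psi_sum_0_Suc e_def by (simp only: mult_ac)
  also have "(w / q - 1) * (w / q\<^sup>2 - 1) * q\<^sup>2 = w\<^sup>2 / q * ((1 - q / w) * (1 - q\<^sup>2 / w))"
    using w by (simp add: field_simps power2_eq_square)
  finally show ?case
    unfolding 1 2 3 T' P_def[symmetric] e_def[symmetric] by (simp add: Q_def mult_ac)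
qed

text \<open>The 2 x factors of \<open>falling\<close> are sorted by the parity of their index into
  two Pochhammer symbols of base q^(-2), and their signs cancel in pairs. The sign (-1)^x comes from
  the denominators of \<open>coeff\<close>, the power of q from its numerators.\<close>

lemma psi_sum_0_q_poch:
  "psi_sum 0 z x = (- 1) ^ x * q ^ (x * (x + 1)) * (q_poch (z / q) (1 / q\<^sup>2) x * q_poch (z / q\<^sup>2) (1 / q\<^sup>2) x)
    / q_poch (q\<^sup>2) (q\<^sup>2) x"
proof (induction x)
  case (Suc x)
  have "falling (z / q) (2 * Suc x) = falling (z / q) (2 * x) * ((z / q / q ^ (2 * x) - 1) * (z / q\<^sup>2 / q ^ (2 * x) - 1))"
    by (simp add: falling_Suc power2_eq_square mult_ac)
  also have "(z / q / q ^ (2 * x) - 1) * (z / q\<^sup>2 / q ^ (2 * x) - 1) = 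
    (1 - z / q * (1 / q\<^sup>2) ^ x) * (1 - z / q\<^sup>2 * (1 / q\<^sup>2) ^ x)"
  proof -
    have "(u - 1) * (w - 1) = (1 - u) * (1 - w)" for u w :: 'b
      by (simp add: algebra_simps)
    then show ?thesis
      unfolding power_mult power_one_over by simp
  qed
  finally have f: "falling (z / q) (2 * Suc x) = falling (z / q) (2 * x) *
    ((1 - z / q * (1 / q\<^sup>2) ^ x) * (1 - z / q\<^sup>2 * (1 / q\<^sup>2) ^ x))" .
  define u where "u = q ^ (2 * x + 2)"
  have u: "u \<noteq> 1" using q_power[of "2 * x + 2"] by (simp add: u_def del: q_power)
  have c: "coeff (Suc x) = coeff x * (u / (u - 1))"
    by (simp add: coeff_def u_def)
  define B where "B = (- 1) ^ x * q ^ (x * (x + 1)) * (q_poch (z / q) (1 / q\<^sup>2) x * q_poch (z / q\<^sup>2) (1 / q\<^sup>2) x)"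
  define E where "E = (1 - z / q * (1 / q\<^sup>2) ^ x) * (1 - z / q\<^sup>2 * (1 / q\<^sup>2) ^ x)"
  define Q where "Q = q_poch (q\<^sup>2) (q\<^sup>2) x"
  have "psi_sum 0 z (Suc x) = B / Q * (u / (u - 1)) * E"
    unfolding B_def Q_def Suc.IH[symmetric] psi_sum.simps f c E_def by (simp only: mult_ac)
  also have "\<dots> = - (B * u * E) / (Q * (1 - u))"
    using u by (simp add: Q_def divide_simps) (simp add: algebra_simps)
  also have "q ^ (Suc x * (Suc x + 1)) = q ^ (x * (x + 1)) * u"
  proof -
    have "Suc x * (Suc x + 1) = x * (x + 1) + (2 * x + 2)" by simp
    then show ?thesis unfolding u_def by (simp only: power_add)
  qed
  then have "- (B * u * E) = (- 1) ^ Suc x * q ^ (Suc x * (Suc x + 1)) *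
      (q_poch (z / q) (1 / q\<^sup>2) (Suc x) * q_poch (z / q\<^sup>2) (1 / q\<^sup>2) (Suc x))"
    unfolding q_poch_Suc B_def E_def by (simp only:) (simp add: mult_ac)
  also have "Q * (1 - u) = q_poch (q\<^sup>2) (q\<^sup>2) (Suc x)"
    unfolding q_poch_Suc u_def q2_power Q_def ..
  finally show ?case .
qed simp

lemma psi_sum_K_Aff:
  assumes "1 \<le> n" "y \<le> (n - 1) div 2"
  defines "N \<equiv> (n - 1) div 2"
  shows "psi_sum y (q ^ n) x = (- 1) ^ x * q ^ (x * (x + 1))
      * q_poch (q powi (2 * int N + (- 1) ^ n)) (q powi (- 2)) x
      * q_binom N x (q\<^sup>2)
      * K_Aff y x (q powi (- 2 * int N - (- 1) ^ n)) N (q\<^sup>2)"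
proof -
  define z where "z = q ^ n"
  have z: "z \<noteq> 0" by (simp add: z_def)
  let ?e = "2 * int N + (- 1) ^ n"
  \<comment> \<open>q^(2 N) and q^(2 N + (-1)^n) are z / q and z / q^2 in an order that depends on
    the parity of n. All products below are symmetric in the two, so the parity disappears.\<close>
  have cases: "(q powi ?e = z / q \<and> q ^ (2 * N) = z / q\<^sup>2) \<or> (q powi ?e = z / q\<^sup>2 \<and> q ^ (2 * N) = z / q)"
  proof (cases "even n")
    case True
    then have n: "n = 2 * N + 2" using assms(1) by (auto simp: N_def elim!: evenE)
    have "?e = int (2 * N + 1)" using True by simp
    then have "q powi ?e = q ^ (2 * N + 1)" by (simp only: power_int_of_nat)
    then show ?thesis by (simp add: z_def n power2_eq_square)
  next
    case False
    then have n: "n = 2 * N + 1" by (auto simp: N_def elim!: oddE)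
    have "?e = int (2 * N) - 1" using False by simp
    then have "q powi ?e = q ^ (2 * N) / q" by (simp only: power_int_diff[OF disjI1[OF q_nonzero]] power_int_of_nat power_int_1_right)
    then show ?thesis by (simp add: z_def n power2_eq_square)
  qed
  have inv: "q powi (- 2) = 1 / q\<^sup>2" "inverse (q\<^sup>2) = 1 / q\<^sup>2" "q powi (- 2 * int N - (- 1) ^ n) = 1 / q powi ?e"
    "q\<^sup>2 powi - int m = 1 / q ^ (2 * m)" for m
  proof -
    show "q powi (- 2) = 1 / q\<^sup>2" by (simp add: power_int_minus divide_inverse)
    show "inverse (q\<^sup>2) = 1 / q\<^sup>2" by (simp add: divide_inverse)
    have "- 2 * int N - (- 1) ^ n = - ?e" by simp
    then show "q powi (- 2 * int N - (- 1) ^ n) = 1 / q powi ?e"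
      by (simp only: power_int_minus) (simp add: divide_inverse)
    show "q\<^sup>2 powi - int m = 1 / q ^ (2 * m)"
      by (simp add: power_int_minus divide_inverse flip: power_mult)
  qed
  have base: "(- 1) ^ x * q ^ (x * (x + 1)) * q_poch (q powi ?e) (q powi (- 2)) x * q_binom N x (q\<^sup>2) = psi_sum 0 z x"
    unfolding psi_sum_0_q_poch q_binom_def inv power_mult[symmetric] using cases by auto
  have den: "q_poch (1 / q ^ (2 * N)) (q\<^sup>2) k * q_poch (1 / q powi ?e) (q\<^sup>2) k = 
    q_poch (q / z) (q\<^sup>2) k * q_poch (q\<^sup>2 / z) (q\<^sup>2) k" for k
    using cases by auto
  \<comment> \<open>For i < k \<le> y \<le> N one has 2 i + 2 < n, so each factor is 1 minus a power
    of q with negative exponent.\<close>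
  have den_nz: "q_poch (q / z) (q\<^sup>2) k * q_poch (q\<^sup>2 / z) (q\<^sup>2) k \<noteq> 0" if "k \<le> y" for k
  proof -
    have *: "1 - q ^ j / z \<noteq> 0" if "j < n" for j
    proof -
      have "q ^ n = q ^ j * q ^ (n - j)" using that by (simp flip: power_add)
      then show ?thesis using q_power[of "n - j"] that by (simp add: z_def field_simps del: q_power)
    qed
    have "1 - q / z * (q\<^sup>2) ^ i \<noteq> 0" "1 - q\<^sup>2 / z * (q\<^sup>2) ^ i \<noteq> 0" if "i < k" for i
    proof -
      have "2 * i + 1 < n" "2 * i + 2 < n"
        using that \<open>k \<le> y\<close> assms(2) by auto
      from *[OF this(1)] *[OF this(2)] show "1 - q / z * (q\<^sup>2) ^ i \<noteq> 0" "1 - q\<^sup>2 / z * (q\<^sup>2) ^ i \<noteq> 0"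
        by (simp_all only: times_divide_eq_left q2_power not_False_eq_True)
    qed
    then show ?thesis by (auto simp: q_poch_def)
  qed
  let ?t = "\<lambda>k. q_poch (1 / q ^ (2 * y)) (q\<^sup>2) k * q_poch (1 / q ^ (2 * x)) (q\<^sup>2) k /
      (q_poch (q / z) (q\<^sup>2) k * q_poch (q\<^sup>2 / z) (q\<^sup>2) k * q_poch (q\<^sup>2) (q\<^sup>2) k) * q ^ (2 * k)"
  have "psi_sum 0 z x * K_Aff y x (1 / q powi ?e) N (q\<^sup>2) = (\<Sum>k\<le>y. psi_sum 0 z x * ?t k)"
    unfolding K_Aff_def inv den by (simp add: sum_distrib_left atLeast0AtMost flip: power_mult)
  \<comment> \<open>The Krawtchouk sum runs to \<open>y\<close> and the expansion to
    \<open>x\<close>. Both stop at the smaller one, as (q^(-2x); q^2)_k vanishes for k > x and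
    (q^(-2y); q^2)_k for k > y.\<close>
  also have "\<dots> = (\<Sum>k\<le>min x y. psi_sum 0 z x * ?t k)"
  proof (rule sum.mono_neutral_right)
    show "\<forall>k\<in>{..y} - {..min x y}. psi_sum 0 z x * ?t k = 0"
    proof
      fix k assume "k \<in> {..y} - {..min x y}"
      then have "q_poch (1 / q ^ (2 * x)) (q\<^sup>2) k = 0"
        by (intro q_poch_eq_0I[of x]) (auto simp flip: power_mult)
      then show "psi_sum 0 z x * ?t k = 0" by simp
    qed
  qed auto
  also have "\<dots> = (\<Sum>k\<le>min x y. kraw_coeff y k * kraw_term z x k)"
  proof (rule sum.cong)
    fix k assume k: "k \<in> {..min x y}"
    have "a * (b * c / (d * e) * f) = b / e * g" if "a * c * f = g * d" "d \<noteq> 0" "e \<noteq> 0" for a b c d e f g :: 'b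
    proof -
      have "a * (b * c / (d * e) * f) = b / e * (a * c * f / d)" by (simp add: mult_ac)
      then show ?thesis using that by simp
    qed
    then show "psi_sum 0 z x * ?t k = kraw_coeff y k * kraw_term z x k"
      unfolding kraw_coeff_def using psi_sum_0_kraw_term[OF z] den_nz k by simp
  qed simp
  also have "\<dots> = (\<Sum>k\<le>x. kraw_coeff y k * kraw_term z x k)"
    by (rule sum.mono_neutral_left) (auto simp: kraw_coeff_eq_0)
  also have "\<dots> = psi_sum y z x"
    by (rule psi_sum_expand[symmetric])
  finally show ?thesis
    unfolding base inv(3) z_def[symmetric] by simp
qed

end

section \<open>Congruence of symmetric matrices\<close>

lemma GL_orbitI:
  assumes "g \<in> carrier_mat n n" "h \<in> carrier_mat n n" "g * h = 1\<^sub>m n" "h * g = 1\<^sub>m n"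
  shows "g * a * g\<^sup>T \<in> GL_orbit n a"
proof -
  have "invertible_mat g"
    using assms unfolding invertible_mat_def inverts_mat_def by auto
  then show ?thesis
    using assms(1) unfolding GL_orbit_def by blast
qed

lemma GL_orbitE:
  assumes "b \<in> GL_orbit n a"
  obtains g h where "g \<in> carrier_mat n n" "h \<in> carrier_mat n n" "g * h = 1\<^sub>m n" "h * g = 1\<^sub>m n"
    "b = g * a * g\<^sup>T"
proof -
  obtain g where g: "g \<in> carrier_mat n n" "invertible_mat g" "b = g * a * g\<^sup>T"
    using assms unfolding GL_orbit_def by blast
  then obtain h where h: "g * h = 1\<^sub>m n" "h * g = 1\<^sub>m (dim_row h)"
    unfolding invertible_mat_def inverts_mat_def by auto
  have "dim_col (g * h) = n" "dim_col (h * g) = dim_row h"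
    by (simp_all add: h)
  then have "h \<in> carrier_mat n n" using g(1) by auto
  then show ?thesis using that g h by auto
qed

lemma GL_orbit_refl:
  fixes a :: "'a::field mat"
  assumes "a \<in> carrier_mat n n"
  shows "a \<in> GL_orbit n a"
  using GL_orbitI[of "1\<^sub>m n" n "1\<^sub>m n" a] assms by simp

lemma transpose_mult_eq_one:
  fixes g h :: "'a::field mat"
  assumes "g \<in> carrier_mat n n" "h \<in> carrier_mat n n" "g * h = 1\<^sub>m n"
  shows "h\<^sup>T * g\<^sup>T = 1\<^sub>m n"
  unfolding transpose_mult[OF assms(1,2), symmetric] assms(3) by simp

lemma mult_mat_zero_vec:
  fixes A :: "'a::field mat"
  assumes "A \<in> carrier_mat n m"
  shows "A *\<^sub>v 0\<^sub>v m = 0\<^sub>v n"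
  using assms by (auto simp: vec_eq_iff scalar_prod_def)

lemma GL_orbit_sym:
  fixes a :: "'a::field mat"
  assumes "b \<in> GL_orbit n a" "a \<in> carrier_mat n n"
  shows "a \<in> GL_orbit n b"
proof -
  obtain g h where g: "g \<in> carrier_mat n n" "h \<in> carrier_mat n n" "g * h = 1\<^sub>m n" "h * g = 1\<^sub>m n"
    "b = g * a * g\<^sup>T"
    using assms(1) by (rule GL_orbitE)
  have "g\<^sup>T * h\<^sup>T = 1\<^sub>m n"
    using g by (intro transpose_mult_eq_one)
  have "h * b * h\<^sup>T = (h * g) * a * (g\<^sup>T * h\<^sup>T)"
    unfolding g(5) using g(1,2) assms(2) by (simp add: assoc_mult_mat[of _ n n _ n _ n])
  also have "\<dots> = a"
    using g(4) \<open>g\<^sup>T * h\<^sup>T = 1\<^sub>m n\<close> assms(2) by simp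
  finally show ?thesis
    using GL_orbitI[OF g(2,1,4,3), of b] by simp
qed

lemma GL_orbit_trans:
  fixes a :: "'a::field mat"
  assumes "c \<in> GL_orbit n b" "b \<in> GL_orbit n a" "a \<in> carrier_mat n n"
  shows "c \<in> GL_orbit n a"
proof -
  obtain g h where g: "g \<in> carrier_mat n n" "h \<in> carrier_mat n n" "g * h = 1\<^sub>m n" "h * g = 1\<^sub>m n"
    "c = g * b * g\<^sup>T"
    using assms(1) by (rule GL_orbitE)
  obtain g' h' where g': "g' \<in> carrier_mat n n" "h' \<in> carrier_mat n n" "g' * h' = 1\<^sub>m n" "h' * g' = 1\<^sub>m n"
    "b = g' * a * g'\<^sup>T"
    using assms(2) by (rule GL_orbitE)
  have "c = (g * g') * a * (g * g')\<^sup>T"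
    unfolding g(5) g'(5) using g(1) g'(1) assms(3) by (simp add: transpose_mult[of _ n n _ n] assoc_mult_mat[of _ n n _ n _ n])
  moreover have "(g * g') * (h' * h) = g * (g' * h') * h" "(h' * h) * (g * g') = h' * (h * g) * g'"
    using g(1,2) g'(1,2) by (simp_all add: assoc_mult_mat[of _ n n _ n _ n])
  then have "(g * g') * (h' * h) = 1\<^sub>m n" "(h' * h) * (g * g') = 1\<^sub>m n"
    using g g' by simp_all
  ultimately show ?thesis
    using GL_orbitI[of "g * g'" n "h' * h" a] g(1,2) g'(1,2) by simp
qed

lemma GL_orbit_carrier:
  fixes a :: "'a::field mat"
  assumes "b \<in> GL_orbit n a" "a \<in> carrier_mat n n"
  shows "b \<in> carrier_mat n n"
  using assms by (auto elim!: GL_orbitE)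

lemma congruence_Sym_mat:
  fixes a :: "'a::field mat"
  assumes "g \<in> carrier_mat n n" "a \<in> Sym_mat n"
  shows "g * a * g\<^sup>T \<in> Sym_mat n"
proof -
  have a: "a \<in> carrier_mat n n" "a\<^sup>T = a" using assms(2) by (auto simp: Sym_mat_def)
  have "(g * a * g\<^sup>T)\<^sup>T = g * (g * a)\<^sup>T"
    using assms(1) a by (simp add: transpose_mult[of _ n n _ n])
  also have "\<dots> = g * (a * g\<^sup>T)"
    using assms(1) a by (simp add: transpose_mult[of _ n n _ n])
  finally show ?thesis
    using assms(1) a by (simp add: Sym_mat_def assoc_mult_mat[of _ n n _ n _ n])
qed

lemma GL_orbit_Sym_mat:
  fixes a :: "'a::field mat"
  assumes "b \<in> GL_orbit n a" "a \<in> Sym_mat n"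
  shows "b \<in> Sym_mat n"
  using assms by (auto elim!: GL_orbitE intro: congruence_Sym_mat)

lemma rank_GL_orbit:
  fixes a :: "'a::{field,finite} mat"
  assumes "b \<in> GL_orbit n a" "a \<in> carrier_mat n n"
  shows "vec_space.rank n b = vec_space.rank n a"
proof -
  obtain g h where g: "g \<in> carrier_mat n n" "h \<in> carrier_mat n n" "g * h = 1\<^sub>m n" "h * g = 1\<^sub>m n"
    "b = g * a * g\<^sup>T"
    using assms(1) by (rule GL_orbitE)
  have b: "b \<in> carrier_mat n n" using assms by (rule GL_orbit_carrier)
  have t: "g\<^sup>T * h\<^sup>T = 1\<^sub>m n" "h\<^sup>T * g\<^sup>T = 1\<^sub>m n"
    using g by (auto intro: transpose_mult_eq_one)
  have tv: "g\<^sup>T *\<^sub>v (h\<^sup>T *\<^sub>v x) = x" "h\<^sup>T *\<^sub>v (g\<^sup>T *\<^sub>v x) = x" "h *\<^sub>v (g *\<^sub>v x) = x" if "x \<in> carrier_vec n" for x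
    using that g(1,2) t g(4) assoc_mult_mat_vec[of "g\<^sup>T" n n "h\<^sup>T" n x, symmetric]
      assoc_mult_mat_vec[of "h\<^sup>T" n n "g\<^sup>T" n x, symmetric] assoc_mult_mat_vec[of h n n g n x, symmetric]
    by simp_all
  have bx: "b *\<^sub>v x = g *\<^sub>v (a *\<^sub>v (g\<^sup>T *\<^sub>v x))" if "x \<in> carrier_vec n" for x
    using that g(1) assms(2) unfolding g(5) by (simp add: assoc_mult_mat_vec[of _ n n _ n])
  have "bij_betw ((*\<^sub>v) (g\<^sup>T)) (mat_kernel b) (mat_kernel a)"
  proof (rule bij_betw_byWitness[where f' = "(*\<^sub>v) (h\<^sup>T)"])
    show "\<forall>x\<in>mat_kernel b. h\<^sup>T *\<^sub>v (g\<^sup>T *\<^sub>v x) = x" "\<forall>x\<in>mat_kernel a. g\<^sup>T *\<^sub>v (h\<^sup>T *\<^sub>v x) = x"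
      using tv b assms(2) by (auto simp: mat_kernel_def)
    show "(*\<^sub>v) (g\<^sup>T) ` mat_kernel b \<subseteq> mat_kernel a"
    proof clarify
      fix x assume "x \<in> mat_kernel b"
      then have x: "x \<in> carrier_vec n" "b *\<^sub>v x = 0\<^sub>v n" using b by (auto simp: mat_kernel_def)
      have "a *\<^sub>v (g\<^sup>T *\<^sub>v x) = h *\<^sub>v (b *\<^sub>v x)"
        unfolding bx[OF x(1)] using x(1) g(1) assms(2) by (intro tv(3)[symmetric]) simp
      also have "\<dots> = 0\<^sub>v n" using g(2) by (simp add: x(2) mult_mat_zero_vec)
      finally show "g\<^sup>T *\<^sub>v x \<in> mat_kernel a"
        using x(1) g(1) assms(2) by (simp add: mat_kernel_def)
    qed
    show "(*\<^sub>v) (h\<^sup>T) ` mat_kernel a \<subseteq> mat_kernel b"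
    proof clarify
      fix x assume "x \<in> mat_kernel a"
      then have x: "x \<in> carrier_vec n" "a *\<^sub>v x = 0\<^sub>v n" using assms(2) by (auto simp: mat_kernel_def)
      have hx: "h\<^sup>T *\<^sub>v x \<in> carrier_vec n" using g(2) x(1) by simp
      have "b *\<^sub>v (h\<^sup>T *\<^sub>v x) = 0\<^sub>v n"
        unfolding bx[OF hx] tv(1)[OF x(1)] x(2) using g(1) by (rule mult_mat_zero_vec)
      then show "h\<^sup>T *\<^sub>v x \<in> mat_kernel b"
        using hx b by (simp add: mat_kernel_def)
    qed
  qed
  then have "card (mat_kernel b) = card (mat_kernel a)" by (rule bij_betw_same_card)
  then show ?thesis
    using rank_eqI[OF assms(2) b, where k = 0 and l = 0 and d = 0] by simp
qed

lemma mat_trace_comm: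
  fixes a b :: "'a::field mat"
  assumes "a \<in> carrier_mat n n" "b \<in> carrier_mat n n"
  shows "mat_trace (a * b) = mat_trace (b * a)"
proof -
  have "mat_trace (a * b) = (\<Sum>i<n. \<Sum>k<n. a $$ (i, k) * b $$ (k, i))"
    using assms by (simp add: mat_trace_def scalar_prod_def atLeast0LessThan)
  also have "\<dots> = (\<Sum>k<n. \<Sum>i<n. b $$ (k, i) * a $$ (i, k))"
    by (subst sum.swap) (simp add: mult.commute)
  also have "\<dots> = mat_trace (b * a)"
    using assms by (simp add: mat_trace_def scalar_prod_def atLeast0LessThan)
  finally show ?thesis .
qed

text \<open>By cyclicity of the trace, the congruence of \<open>b\<close> by \<open>g\<close> is
  carried over to the congruence of the summation variable by the transpose of \<open>g\<close>,
  which permutes the symmetric matrices of each rank.\<close>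

lemma sum_trace_GL_orbit:
  fixes b :: "'a::{field,finite} mat"
  assumes "b' \<in> GL_orbit n b" "b \<in> carrier_mat n n"
  shows "(\<Sum>a\<in>Sym_mat n. of_bool (vec_space.rank n a = r) * f (mat_trace (b'\<^sup>T * a))) =
    (\<Sum>a\<in>Sym_mat n. of_bool (vec_space.rank n a = r) * f (mat_trace (b\<^sup>T * a)) :: complex)"
proof -
  obtain g h where g: "g \<in> carrier_mat n n" "h \<in> carrier_mat n n" "g * h = 1\<^sub>m n" "h * g = 1\<^sub>m n"
    "b' = g * b * g\<^sup>T"
    using assms(1) by (rule GL_orbitE)
  have t: "g\<^sup>T * h\<^sup>T = 1\<^sub>m n" "h\<^sup>T * g\<^sup>T = 1\<^sub>m n"
    using g by (auto intro: transpose_mult_eq_one)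
  have inv: "h\<^sup>T * (g\<^sup>T * a * g) * h = a" "g\<^sup>T * (h\<^sup>T * a * h) * g = a" if "a \<in> carrier_mat n n" for a
  proof -
    have "h\<^sup>T * (g\<^sup>T * a * g) * h = (h\<^sup>T * g\<^sup>T) * a * (g * h)" "g\<^sup>T * (h\<^sup>T * a * h) * g = (g\<^sup>T * h\<^sup>T) * a * (h * g)"
      using g(1,2) that by (simp_all add: assoc_mult_mat[of _ n n _ n _ n])
    then show "h\<^sup>T * (g\<^sup>T * a * g) * h = a" "g\<^sup>T * (h\<^sup>T * a * h) * g = a"
      using g t that by simp_all
  qed
  have orb: "g\<^sup>T * a * g \<in> GL_orbit n a" for a
    using GL_orbitI[of "g\<^sup>T" n "h\<^sup>T" a] g t by simp
  have sym: "g\<^sup>T * a * g \<in> Sym_mat n" "h\<^sup>T * a * h \<in> Sym_mat n" if "a \<in> Sym_mat n" for a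
    using congruence_Sym_mat[of "g\<^sup>T" n a] congruence_Sym_mat[of "h\<^sup>T" n a] g(1,2) that by simp_all
  have "a \<in> carrier_mat n n" if "a \<in> Sym_mat n" for a :: "'a mat"
    using that by (simp add: Sym_mat_def)
  note inv = inv[OF this]
  have "bij_betw (\<lambda>a. g\<^sup>T * a * g) (Sym_mat n) (Sym_mat n)"
    by (rule bij_betw_byWitness[where f' = "\<lambda>a. h\<^sup>T * a * h"]) (simp_all add: inv sym image_subset_iff)
  then have "(\<Sum>a\<in>Sym_mat n. of_bool (vec_space.rank n a = r) * f (mat_trace (b\<^sup>T * a))) =
    (\<Sum>a\<in>Sym_mat n. of_bool (vec_space.rank n (g\<^sup>T * a * g) = r) * f (mat_trace (b\<^sup>T * (g\<^sup>T * a * g))) :: complex)"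
    by (rule sum.reindex_bij_betw[symmetric])
  also have "\<dots> = (\<Sum>a\<in>Sym_mat n. of_bool (vec_space.rank n a = r) * f (mat_trace (b'\<^sup>T * a)))"
  proof (rule sum.cong)
    fix a :: "'a mat" assume "a \<in> Sym_mat n"
    then have a: "a \<in> carrier_mat n n" by (simp add: Sym_mat_def)
    have "b'\<^sup>T * a = g * (b\<^sup>T * g\<^sup>T * a)"
      using g(1) assms(2) a unfolding g(5)
      by (simp add: transpose_mult[of _ n n _ n] assoc_mult_mat[of _ n n _ n _ n])
    then have "mat_trace (b'\<^sup>T * a) = mat_trace (b\<^sup>T * g\<^sup>T * a * g)"
      using g(1) assms(2) a by (simp add: mat_trace_comm[of g n])
    also have "b\<^sup>T * g\<^sup>T * a * g = b\<^sup>T * (g\<^sup>T * a * g)"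
      using g(1) assms(2) a by (simp add: assoc_mult_mat[of _ n n _ n _ n])
    finally show "of_bool (vec_space.rank n (g\<^sup>T * a * g) = r) * f (mat_trace (b\<^sup>T * (g\<^sup>T * a * g))) =
      (of_bool (vec_space.rank n a = r) * f (mat_trace (b'\<^sup>T * a)) :: complex)"
      using rank_GL_orbit[OF orb a] by simp
  qed simp
  finally show ?thesis by simp
qed

section \<open>Diagonal matrices and elementary congruences\<close>

definition diagonal :: "nat \<Rightarrow> (nat \<Rightarrow> 'a::zero) \<Rightarrow> 'a mat" where
  "diagonal n f = mat n n (\<lambda>(i, k). if i = k then f i else 0)"

text \<open>Kept apart from the size, since the recurrence uses the same entries at several sizes.
  For r = 0 it is the zero function for every \<open>d\<close>.\<close>

definition diag_rep_entry :: "nat \<Rightarrow> 'a::field \<Rightarrow> nat \<Rightarrow> 'a" where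
  "diag_rep_entry r d i = (if i + 1 < r then 1 else if i + 1 = r then d else 0)"

lemma diag_rep_diagonal: "diag_rep n r d = diagonal n (diag_rep_entry r d)"
  by (auto simp: diag_rep_def diagonal_def diag_rep_entry_def mat_eq_iff)

lemma diagonal_simps [simp]:
  "diagonal n f \<in> carrier_mat n n"
  "i < n \<Longrightarrow> k < n \<Longrightarrow> diagonal n f $$ (i, k) = (if i = k then f i else 0)"
  "dim_row (diagonal n f) = n" "dim_col (diagonal n f) = n"
  by (simp_all add: diagonal_def)

lemma diagonal_Sym_mat: "diagonal n f \<in> (Sym_mat n :: 'a::field mat set)"
  by (auto simp: Sym_mat_iff)

lemma mat_trace_diagonal:
  fixes a :: "'a::field mat"
  assumes "a \<in> carrier_mat n n"
  shows "mat_trace ((diagonal n f)\<^sup>T * a) = (\<Sum>i<n. f i * a $$ (i, i))"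
proof -
  have "mat_trace ((diagonal n f)\<^sup>T * a) = (\<Sum>i<n. \<Sum>k<n. (if k = i then f k else 0) * a $$ (k, i))"
    using assms by (simp add: mat_trace_def scalar_prod_def atLeast0LessThan)
  also have "\<dots> = (\<Sum>i<n. \<Sum>k<n. if k = i then f i * a $$ (k, i) else 0)"
    by (intro sum.cong) auto
  finally show ?thesis by simp
qed

lemma rank_diag_rep:
  fixes d :: "'a::{field,finite}"
  assumes "t \<le> n" "d \<noteq> 0"
  shows "vec_space.rank n (diag_rep n t d) = t"
proof -
  let ?D = "diagonal n (diag_rep_entry t d)"
  have e: "diag_rep_entry t d i = 0 \<longleftrightarrow> t \<le> i" for i
    using assms(2) by (auto simp: diag_rep_entry_def)
  have "mat_kernel ?D = {x \<in> carrier_vec n. \<forall>i<t. x $ i = 0}"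
  proof -
    have "(\<Sum>k<n. ?D $$ (i, k) * x $ k) = diag_rep_entry t d i * x $ i" if "i < n" for i x
    proof -
      have "(\<Sum>k<n. ?D $$ (i, k) * x $ k) = (\<Sum>k<n. if k = i then diag_rep_entry t d i * x $ i else 0)"
        using that by (intro sum.cong) auto
      then show ?thesis using that by simp
    qed
    then have "x \<in> mat_kernel ?D \<longleftrightarrow> x \<in> carrier_vec n \<and> (\<forall>i<n. diag_rep_entry t d i = 0 \<or> x $ i = 0)" for x
      by (simp add: in_mat_kernel_iff[of ?D n n])
    moreover have "(\<forall>i<n. t \<le> i \<or> P i) \<longleftrightarrow> (\<forall>i<t. P i)" for P
      using assms(1) by (meson less_le_trans not_le)
    ultimately show ?thesis by (simp add: e set_eq_iff)
  qed
  then have "CARD('a) ^ (n - vec_space.rank n ?D) = CARD('a) ^ (n - t)"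
    using card_mat_kernel[of ?D n] card_carrier_vec_vanishing[OF assms(1), where 'a = 'a] by simp
  then have "n - vec_space.rank n ?D = n - t"
    using CARD_field_gt_1[where 'a='a] by simp
  then show ?thesis
    using assms(1) vec_space.rank_le_nc[of ?D n n] by (simp add: diag_rep_diagonal)
qed

text \<open>Congruence by I + u e_j^T, whose determinant is 1 + u_j; this explains the hypothesis on
  \<open>u j\<close>.\<close>

lemma transvection_GL_orbit:
  fixes b :: "'a::field mat"
  assumes b: "b \<in> carrier_mat n n" and j: "j < n" and u: "u j \<noteq> - 1"
  shows "mat n n (\<lambda>(i, k). b $$ (i, k) + u i * b $$ (j, k) + u k * b $$ (i, j) + u i * u k * b $$ (j, j))
    \<in> GL_orbit n b"
proof -
  define T where "T = (\<lambda>w :: nat \<Rightarrow> 'a. mat n n (\<lambda>(i, k). (if k = i then 1 else 0) + (if k = j then w i else 0)))"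
  have Tc: "T w \<in> carrier_mat n n" for w by (simp add: T_def)
  have T_sum: "(\<Sum>k<n. T w $$ (i, k) * x k) = x i + w i * x j" if "i < n" for w i x
  proof -
    have "(\<Sum>k<n. T w $$ (i, k) * x k) = (\<Sum>k<n. (if k = i then x i else 0) + (if k = j then w i * x j else 0))"
      using that by (intro sum.cong) (auto simp: T_def distrib_right)
    also have "\<dots> = x i + w i * x j"
      using that j by (simp add: sum.distrib)
    finally show ?thesis .
  qed
  \<comment> \<open>The inverse of I + u e_j^T is I + w e_j^T (Sherman-Morrison).\<close>
  define w where "w = (\<lambda>i. - u i / (1 + u j))"
  have u': "1 + u j \<noteq> 0" using u by (metis add.commute eq_neg_iff_add_eq_0)
  have T_mult: "T v * c = mat n n (\<lambda>(i, k). c $$ (i, k) + v i * c $$ (j, k))" if "c \<in> carrier_mat n n" for v c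
  proof (rule eq_matI)
    fix i k assume "i < dim_row (mat n n (\<lambda>(i, k). c $$ (i, k) + v i * c $$ (j, k)))"
      "k < dim_col (mat n n (\<lambda>(i, k). c $$ (i, k) + v i * c $$ (j, k)))"
    then have ik: "i < n" "k < n" by auto
    have "(T v * c) $$ (i, k) = (\<Sum>l<n. T v $$ (i, l) * c $$ (l, k))"
      using ik that Tc[of v] by (simp add: scalar_prod_def atLeast0LessThan)
    then show "(T v * c) $$ (i, k) = mat n n (\<lambda>(i, k). c $$ (i, k) + v i * c $$ (j, k)) $$ (i, k)"
      using ik T_sum[OF ik(1), of v "\<lambda>l. c $$ (l, k)"] by simp
  qed (use that Tc[of v] in auto)
  have mult_T: "c * (T v)\<^sup>T = mat n n (\<lambda>(i, k). c $$ (i, k) + v k * c $$ (i, j))" if "c \<in> carrier_mat n n" for v c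
  proof (rule eq_matI)
    fix i k assume "i < dim_row (mat n n (\<lambda>(i, k). c $$ (i, k) + v k * c $$ (i, j)))"
      "k < dim_col (mat n n (\<lambda>(i, k). c $$ (i, k) + v k * c $$ (i, j)))"
    then have ik: "i < n" "k < n" by auto
    have "(c * (T v)\<^sup>T) $$ (i, k) = (\<Sum>l<n. T v $$ (k, l) * c $$ (i, l))"
      using ik that Tc[of v] by (simp add: scalar_prod_def atLeast0LessThan mult.commute)
    then show "(c * (T v)\<^sup>T) $$ (i, k) = mat n n (\<lambda>(i, k). c $$ (i, k) + v k * c $$ (i, j)) $$ (i, k)"
      using ik T_sum[OF ik(2), of v "\<lambda>l. c $$ (i, l)"] by simp
  qed (use that Tc[of v] in auto)
  have "T u * T w = 1\<^sub>m n" "T w * T u = 1\<^sub>m n"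
  proof -
    have "w i + u i + u i * w j = 0" "u i + w i + w i * u j = 0" for i
      using u' by (simp_all add: w_def field_simps)
    then have *: "w i + (u i + u i * w j) = 0" "u i + (w i + w i * u j) = 0" for i
      by (simp_all add: add.assoc)
    show "T u * T w = 1\<^sub>m n" "T w * T u = 1\<^sub>m n"
      unfolding T_mult[OF Tc] using j * by (auto simp: mat_eq_iff T_def algebra_simps)
  qed
  then have "T u * b * (T u)\<^sup>T \<in> GL_orbit n b"
    by (rule GL_orbitI[OF Tc Tc])
  also have "T u * b * (T u)\<^sup>T = 
    mat n n (\<lambda>(i, k). b $$ (i, k) + u i * b $$ (j, k) + u k * b $$ (i, j) + u i * u k * b $$ (j, j))"
    unfolding T_mult[OF b] using j by (subst mult_T) (auto simp: mat_eq_iff algebra_simps)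
  finally show ?thesis .
qed

lemma diagonal_scale_GL_orbit:
  fixes f :: "nat \<Rightarrow> 'a::field"
  assumes "j < n" "p \<noteq> 0"
  shows "diagonal n (f(j := p\<^sup>2 * f j)) \<in> GL_orbit n (diagonal n f)"
proof -
  \<comment> \<open>Row and column \<open>j\<close> are multiplied by 1 + u j = p.\<close>
  define u where "u = (\<lambda>i. if i = j then p - 1 else 0)"
  have "mat n n (\<lambda>(i, k). diagonal n f $$ (i, k) + u i * diagonal n f $$ (j, k) +
      u k * diagonal n f $$ (i, j) + u i * u k * diagonal n f $$ (j, j)) = diagonal n (f(j := p\<^sup>2 * f j))"
    using assms(1) by (auto simp: mat_eq_iff u_def power2_eq_square algebra_simps)
  moreover have "u j \<noteq> - 1" using assms(2) by (simp add: u_def)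
  ultimately show ?thesis
    using transvection_GL_orbit[of "diagonal n f" n j u] assms(1) by simp
qed

text \<open>The vectors \<open>p e\<^sub>i + w e\<^sub>j\<close> and \<open>- f j w e\<^sub>i + f i p e\<^sub>j\<close> are orthogonal, and the change of
  basis has determinant 1.\<close>

lemma diagonal_pair_GL_orbit:
  fixes f :: "nat \<Rightarrow> 'a::field"
  assumes ij: "i < n" "j < n" "i \<noteq> j" and pw: "f i * p\<^sup>2 + f j * w\<^sup>2 = 1"
  shows "diagonal n (f(i := 1, j := f i * f j)) \<in> GL_orbit n (diagonal n f)"
proof -
  define B where "B = (\<lambda>\<alpha> \<beta> \<gamma> \<epsilon> :: 'a. mat n n (\<lambda>(k, l).
    if k = i then (if l = i then \<alpha> else if l = j then \<beta> else 0)
    else if k = j then (if l = i then \<gamma> else if l = j then \<epsilon> else 0) else if k = l then 1 else 0))"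
  have Bc: "B \<alpha> \<beta> \<gamma> \<epsilon> \<in> carrier_mat n n" for \<alpha> \<beta> \<gamma> \<epsilon> by (simp add: B_def)
  have B_sum: "(\<Sum>l<n. B \<alpha> \<beta> \<gamma> \<epsilon> $$ (k, l) * x l) =
      (if k = i then \<alpha> * x i + \<beta> * x j else if k = j then \<gamma> * x i + \<epsilon> * x j else x k)"
    if k: "k < n" for k x \<alpha> \<beta> \<gamma> \<epsilon>
  proof -
    have "(\<Sum>l<n. B \<alpha> \<beta> \<gamma> \<epsilon> $$ (k, l) * x l) =
      (\<Sum>l<n. (if l = i then (if k = i then \<alpha> else if k = j then \<gamma> else 0) * x i else 0) +
        ((if l = j then (if k = i then \<beta> else if k = j then \<epsilon> else 0) * x j else 0) +
         (if l = k then (if k = i \<or> k = j then 0 else x k) else 0)))"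
      using k ij by (intro sum.cong) (auto simp: B_def)
    also have "\<dots> = (if k = i then \<alpha> * x i + \<beta> * x j else if k = j then \<gamma> * x i + \<epsilon> * x j else x k)"
      using k ij by (simp add: sum.distrib)
    finally show ?thesis .
  qed
  have B_mult: "(B \<alpha> \<beta> \<gamma> \<epsilon> * c) $$ (k, m) =
      (if k = i then \<alpha> * c $$ (i, m) + \<beta> * c $$ (j, m) else if k = j then \<gamma> * c $$ (i, m) + \<epsilon> * c $$ (j, m) else c $$ (k, m))"
    if "c \<in> carrier_mat n n" "k < n" "m < n" for c k m \<alpha> \<beta> \<gamma> \<epsilon>
  proof -
    have "(B \<alpha> \<beta> \<gamma> \<epsilon> * c) $$ (k, m) = (\<Sum>l<n. B \<alpha> \<beta> \<gamma> \<epsilon> $$ (k, l) * c $$ (l, m))"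
      using that Bc[of \<alpha> \<beta> \<gamma> \<epsilon>] by (simp add: scalar_prod_def atLeast0LessThan)
    then show ?thesis
      using B_sum[OF that(2), of \<alpha> \<beta> \<gamma> \<epsilon> "\<lambda>l. c $$ (l, m)"] by simp
  qed
  have mult_B: "(c * (B \<alpha> \<beta> \<gamma> \<epsilon>)\<^sup>T) $$ (m, k) =
      (if k = i then \<alpha> * c $$ (m, i) + \<beta> * c $$ (m, j) else if k = j then \<gamma> * c $$ (m, i) + \<epsilon> * c $$ (m, j) else c $$ (m, k))"
    if "c \<in> carrier_mat n n" "k < n" "m < n" for c k m \<alpha> \<beta> \<gamma> \<epsilon>
  proof -
    have "(c * (B \<alpha> \<beta> \<gamma> \<epsilon>)\<^sup>T) $$ (m, k) = (\<Sum>l<n. B \<alpha> \<beta> \<gamma> \<epsilon> $$ (k, l) * c $$ (m, l))"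
      using that Bc[of \<alpha> \<beta> \<gamma> \<epsilon>] by (simp add: scalar_prod_def atLeast0LessThan mult.commute)
    then show ?thesis
      using B_sum[OF that(2), of \<alpha> \<beta> \<gamma> \<epsilon> "\<lambda>l. c $$ (m, l)"] by simp
  qed
  \<comment> \<open>The 2 by 2 block of \<open>h\<close> is the adjugate of the block of
    \<open>g\<close>.\<close>
  define g h where "g = B p w (- f j * w) (f i * p)" and "h = B (f i * p) (- w) (f j * w) p"
  have gc: "g \<in> carrier_mat n n" "h \<in> carrier_mat n n" by (simp_all add: g_def h_def Bc)
  have B_entry: "B \<alpha> \<beta> \<gamma> \<epsilon> $$ (k, l) = (if k = i then (if l = i then \<alpha> else if l = j then \<beta> else 0)
    else if k = j then (if l = i then \<gamma> else if l = j then \<epsilon> else 0) else if k = l then 1 else 0)"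
    if "k < n" "l < n" for k l \<alpha> \<beta> \<gamma> \<epsilon>
    using that by (simp add: B_def)
  have pw': "p * (f i * p) + w * (f j * w) = 1" "f i * p * p + f j * w * w = 1"
    "f j * w * w + f i * p * p = 1"
    using pw by (simp_all add: power2_eq_square mult_ac add.commute)
  have "g * h = 1\<^sub>m n"
  proof (rule eq_matI)
    fix k l assume "k < dim_row (1\<^sub>m n :: 'a mat)" "l < dim_col (1\<^sub>m n :: 'a mat)"
    then have kl: "k < n" "l < n" by simp_all
    show "(g * h) $$ (k, l) = 1\<^sub>m n $$ (k, l)"
      unfolding g_def B_mult[OF gc(2) kl] unfolding h_def using kl ij pw' by (auto simp: B_entry algebra_simps)
  qed (use gc in auto)
  moreover have "h * g = 1\<^sub>m n"
  proof (rule eq_matI)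
    fix k l assume "k < dim_row (1\<^sub>m n :: 'a mat)" "l < dim_col (1\<^sub>m n :: 'a mat)"
    then have kl: "k < n" "l < n" by simp_all
    show "(h * g) $$ (k, l) = 1\<^sub>m n $$ (k, l)"
      unfolding h_def B_mult[OF gc(1) kl] unfolding g_def using kl ij pw' by (auto simp: B_entry algebra_simps)
  qed (use gc in auto)
  ultimately have "g * diagonal n f * g\<^sup>T \<in> GL_orbit n (diagonal n f)"
    by (rule GL_orbitI[OF gc])
  also have "g * diagonal n f * g\<^sup>T = diagonal n (f(i := 1, j := f i * f j))"
  proof (rule eq_matI)
    let ?D = "diagonal n (f(i := 1, j := f i * f j))"
    fix k l assume "k < dim_row ?D" "l < dim_col ?D"
    then have kl: "k < n" "l < n" by (simp_all add: diagonal_def)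
    have c: "g * diagonal n f \<in> carrier_mat n n" using gc(1) by simp
    have fij: "f i * (f j * (f j * (w * w))) + f i * (f i * (f j * (p * p))) = f i * f j"
    proof -
      have "f i * (f j * (f j * (w * w))) + f i * (f i * (f j * (p * p))) = f i * f j * (f j * w * w + f i * p * p)"
        by (simp add: algebra_simps)
      then show ?thesis using pw'(3) by simp
    qed
    show "(g * diagonal n f * g\<^sup>T) $$ (k, l) = ?D $$ (k, l)"
      using mult_B[OF c kl(2,1), of p w "- f j * w" "f i * p", folded g_def] kl ij pw' fij
      by (auto simp: g_def B_mult algebra_simps)
  qed (use gc in auto)
  finally show ?thesis .
qed

section \<open>Classification up to congruence\<close>

text \<open>Adding 1 permutes the field and so fixes the sum of all its elements.\<close>

lemma of_nat_CARD_field: "of_nat CARD('a::{field,finite}) = (0 :: 'a)"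
proof -
  have "(\<Sum>x\<in>(UNIV :: 'a set). x) = (\<Sum>x\<in>UNIV. x + 1)"
    by (rule sum.reindex_bij_witness[where i = "\<lambda>x. x + 1" and j = "\<lambda>x. x - 1"]) auto
  then show ?thesis by (simp add: sum.distrib)
qed

lemma two_nonzero_of_odd_CARD:
  assumes "odd CARD('a::{field,finite})"
  shows "(2 :: 'a) \<noteq> 0"
proof
  assume 2: "(2 :: 'a) = 0"
  obtain k where "CARD('a) = 2 * k + 1" using assms by (auto elim: oddE)
  then have "of_nat CARD('a) = 2 * of_nat k + (1 :: 'a)" by simp
  then show False by (simp only: of_nat_CARD_field 2) simp
qed

lemma card_squares_ge: "CARD('a::{field,finite}) + 1 \<le> 2 * card (range (\<lambda>x :: 'a. x\<^sup>2))"
proof -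
  let ?S = "range (\<lambda>x :: 'a. x\<^sup>2)"
  have fib: "card {x. x\<^sup>2 = y} \<le> 2" if y: "y \<in> ?S" for y :: 'a
  proof -
    obtain r where "y = r\<^sup>2" using y by auto
    then have "{x. x\<^sup>2 = y} \<subseteq> {r, - r}" by (auto simp: power2_eq_iff)
    then have "card {x. x\<^sup>2 = y} \<le> card {r, - r}" by (intro card_mono) auto
    also have "\<dots> \<le> 2" by (simp add: card_insert_if)
    finally show ?thesis .
  qed
  have S0: "0 \<in> ?S" by (auto intro: image_eqI[where x = 0])
  have "CARD('a) = (\<Sum>y\<in>?S. card {x. x\<^sup>2 = y})"
    using sum.image_gen[of "UNIV :: 'a set" "\<lambda>_. 1 :: nat" "\<lambda>x. x\<^sup>2"] by simp
  also have "\<dots> = card {x :: 'a. x\<^sup>2 = 0} + (\<Sum>y\<in>?S - {0}. card {x. x\<^sup>2 = y})"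
    by (rule sum.remove[OF _ S0]) simp
  also have "\<dots> \<le> 1 + (\<Sum>y\<in>?S - {0}. 2)"
    using fib by (intro add_mono sum_mono) auto
  also have "\<dots> = 1 + 2 * (card ?S - 1)"
    using S0 by simp
  finally have "CARD('a) \<le> 1 + 2 * (card ?S - 1)" .
  moreover have "card ?S > 0" using S0 by (auto simp: card_gt_0_iff)
  ultimately show ?thesis by linarith
qed

text \<open>Pigeonhole: the values c p^2 and the values 1 - d w^2 each fill more than half of the
  field.\<close>

lemma binary_form_represents_one:
  fixes c d :: "'a::{field,finite}"
  assumes "c \<noteq> 0" "d \<noteq> 0"
  obtains p w where "c * p\<^sup>2 + d * w\<^sup>2 = 1"
proof -
  let ?S = "range (\<lambda>x :: 'a. x\<^sup>2)"
  let ?A = "(\<lambda>y. c * y) ` ?S" and ?B = "(\<lambda>y. 1 - d * y) ` ?S"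
  have "card ?A = card ?S" "card ?B = card ?S"
    using assms by (auto intro!: card_image simp: inj_on_def)
  moreover have "card (?A \<union> ?B) \<le> CARD('a)" by (rule card_mono) auto
  moreover have "card ?A + card ?B = card (?A \<union> ?B) + card (?A \<inter> ?B)"
    by (rule card_Un_Int) auto
  ultimately have "card (?A \<inter> ?B) > 0"
    using card_squares_ge[where 'a = 'a] by linarith
  then obtain p w where "c * p\<^sup>2 = 1 - d * w\<^sup>2"
    by (auto simp: card_gt_0_iff)
  then show ?thesis by (intro that[of p w]) simp
qed

definition nonzero_squares :: "'a::field set" where
  "nonzero_squares = {x\<^sup>2 | x. x \<noteq> 0}"

text \<open>The squares and their \<delta>-multiples are disjoint because \<delta> is not a square,
  and by \<open>card_squares_ge\<close> they are numerous enough to exhaust the non-zero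
  scalars.\<close>

lemma nonzero_squares_split:
  fixes \<delta> :: "'a::{field,finite}"
  assumes "\<nexists>z. \<delta> = z\<^sup>2"
  shows "UNIV - {0} = nonzero_squares \<union> (\<lambda>y. \<delta> * y) ` nonzero_squares" (is "_ = ?S \<union> ?T")
    and "nonzero_squares \<inter> (\<lambda>y. \<delta> * y) ` nonzero_squares = {}"
    and "card ((\<lambda>y. \<delta> * y) ` nonzero_squares) = card (nonzero_squares :: 'a set)"
    and "2 * card (nonzero_squares :: 'a set) = CARD('a) - 1"
proof -
  have \<delta>: "\<delta> \<noteq> 0" using assms by (metis zero_power2)
  have S: "nonzero_squares = range (\<lambda>x :: 'a. x\<^sup>2) - {0}"
    by (auto simp: nonzero_squares_def)
  have "0 \<in> range (\<lambda>x :: 'a. x\<^sup>2)" by (auto intro: image_eqI[where x = 0])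
  then have ge: "CARD('a) - 1 \<le> 2 * card ?S"
    using card_squares_ge[where 'a = 'a] by (simp add: S)
  show disj: "?S \<inter> ?T = {}"
  proof (rule ccontr)
    assume "?S \<inter> ?T \<noteq> {}"
    then obtain x y where "x \<noteq> 0" "y \<noteq> 0" "x\<^sup>2 = \<delta> * y\<^sup>2"
      unfolding nonzero_squares_def by blast
    then have "\<delta> = (x / y)\<^sup>2" by (simp add: power_divide)
    then show False using assms by blast
  qed
  show cT: "card ?T = card ?S"
    using \<delta> by (auto intro!: card_image simp: inj_on_def)
  have "card (?S \<union> ?T) = 2 * card ?S"
    using disj cT by (simp add: card_Un_disjoint)
  moreover have sub: "?S \<union> ?T \<subseteq> UNIV - {0}"
    using \<delta> by (auto simp: nonzero_squares_def)
  moreover have "card (UNIV - {0 :: 'a}) = CARD('a) - 1" by simp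
  moreover have "card (?S \<union> ?T) \<le> card (UNIV - {0 :: 'a})"
    using sub by (intro card_mono) auto
  ultimately show "2 * card ?S = CARD('a) - 1" "UNIV - {0} = ?S \<union> ?T"
    using ge card_subset_eq[OF _ sub] by auto
qed

section \<open>Diagonalisation of symmetric matrices\<close>

lemma mat_eq_insert_indexI:
  assumes "A \<in> carrier_mat (Suc m) (Suc m)" "B \<in> carrier_mat (Suc m) (Suc m)" "j \<le> m"
    "A $$ (j, j) = B $$ (j, j)"
    "\<And>i. i < m \<Longrightarrow> A $$ (insert_index j i, j) = B $$ (insert_index j i, j)"
    "\<And>i. i < m \<Longrightarrow> A $$ (j, insert_index j i) = B $$ (j, insert_index j i)"
    "\<And>i k. i < m \<Longrightarrow> k < m \<Longrightarrow> A $$ (insert_index j i, insert_index j k) = B $$ (insert_index j i, insert_index j k)"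
  shows "A = B"
proof -
  have "\<forall>i<Suc m. \<forall>k<Suc m. A $$ (i, k) = B $$ (i, k)"
    unfolding all_less_Suc_insert_index[OF assms(3)] using assms(4-7) by blast
  then show ?thesis using assms(1,2) by (auto simp: mat_eq_iff)
qed

text \<open>With border 0, \<open>bordered\<close> is a direct sum with a scalar at place
  \<open>j\<close>. Multiplicativity lifts congruences from size \<open>m\<close> to
  \<open>Suc m\<close>.\<close>

lemma bordered_mult:
  fixes A B :: "'a::field mat"
  assumes A: "A \<in> carrier_mat m m" and B: "B \<in> carrier_mat m m" and j: "j \<le> m"
  shows "bordered j A (0\<^sub>v m) c * bordered j B (0\<^sub>v m) d = bordered j (A * B) (0\<^sub>v m) (c * d)"
proof (rule mat_eq_insert_indexI[OF _ _ j])
  have AB: "A * B \<in> carrier_mat m m" using A B by simp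
  note a = bordered_simps[OF A j, where v = "0\<^sub>v m" and c = c]
    and b = bordered_simps[OF B j, where v = "0\<^sub>v m" and c = d]
    and ab = bordered_simps[OF AB j, where v = "0\<^sub>v m" and c = "c * d"]
  have mult: "(bordered j A (0\<^sub>v m) c * bordered j B (0\<^sub>v m) d) $$ (i, k) =
      bordered j A (0\<^sub>v m) c $$ (i, j) * bordered j B (0\<^sub>v m) d $$ (j, k) +
      (\<Sum>l<m. bordered j A (0\<^sub>v m) c $$ (i, insert_index j l) * bordered j B (0\<^sub>v m) d $$ (insert_index j l, k))"
    if "i < Suc m" "k < Suc m" for i k
  proof -
    have "(bordered j A (0\<^sub>v m) c * bordered j B (0\<^sub>v m) d) $$ (i, k) =
        (\<Sum>l<Suc m. bordered j A (0\<^sub>v m) c $$ (i, l) * bordered j B (0\<^sub>v m) d $$ (l, k))"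
      using that carrier_matD[OF a(1)] carrier_matD[OF b(1)]
      by (simp add: scalar_prod_def atLeast0LessThan del: sum.lessThan_Suc)
    then show ?thesis unfolding sum_lessThan_Suc_insert_index[OF j] .
  qed
  show "bordered j A (0\<^sub>v m) c * bordered j B (0\<^sub>v m) d \<in> carrier_mat (Suc m) (Suc m)"
    using a(1) b(1) by simp
  show "bordered j (A * B) (0\<^sub>v m) (c * d) \<in> carrier_mat (Suc m) (Suc m)" by (rule ab(1))
  show "(bordered j A (0\<^sub>v m) c * bordered j B (0\<^sub>v m) d) $$ (j, j) = bordered j (A * B) (0\<^sub>v m) (c * d) $$ (j, j)"
    using j by (simp add: mult a b ab)
  fix i assume i: "i < m"
  then have i': "insert_index j i < Suc m" by (rule insert_index_less)
  show "(bordered j A (0\<^sub>v m) c * bordered j B (0\<^sub>v m) d) $$ (insert_index j i, j) =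
      bordered j (A * B) (0\<^sub>v m) (c * d) $$ (insert_index j i, j)"
    using i j by (simp add: mult[OF i'] a b ab)
  show "(bordered j A (0\<^sub>v m) c * bordered j B (0\<^sub>v m) d) $$ (j, insert_index j i) =
      bordered j (A * B) (0\<^sub>v m) (c * d) $$ (j, insert_index j i)"
    using i j by (simp add: mult[OF _ i'] a b ab)
  fix k assume k: "k < m"
  then have k': "insert_index j k < Suc m" by (rule insert_index_less)
  show "(bordered j A (0\<^sub>v m) c * bordered j B (0\<^sub>v m) d) $$ (insert_index j i, insert_index j k) =
      bordered j (A * B) (0\<^sub>v m) (c * d) $$ (insert_index j i, insert_index j k)"
    using i k A B by (simp add: mult[OF i' k'] a b ab scalar_prod_def atLeast0LessThan)
qed

lemma bordered_one: "j \<le> m \<Longrightarrow> bordered j (1\<^sub>m m) (0\<^sub>v m) 1 = (1\<^sub>m (Suc m) :: 'a::field mat)"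
  by (rule mat_eq_insert_indexI[of _ m _ j])
    (auto simp: insert_index_less bordered_simps[of "1\<^sub>m m" m], auto simp: insert_index_def split: if_splits)

lemma bordered_transpose:
  fixes A :: "'a::field mat"
  assumes A: "A \<in> carrier_mat m m" and j: "j \<le> m"
  shows "(bordered j A (0\<^sub>v m) c)\<^sup>T = bordered j A\<^sup>T (0\<^sub>v m) c"
proof -
  have At: "A\<^sup>T \<in> carrier_mat m m" using A by simp
  note a = bordered_simps[OF A j] and at = bordered_simps[OF At j]
  show ?thesis
    by (rule mat_eq_insert_indexI[OF _ _ j]) 
      (use j A a(1) in \<open>simp_all add: a at insert_index_less index_transpose_mat(1) carrier_matD[OF a(1)]\<close>)
qed

lemma bordered_GL_orbit:
  fixes a :: "'a::field mat"
  assumes "b \<in> GL_orbit m a" "a \<in> carrier_mat m m" and j: "j \<le> m"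
  shows "bordered j b (0\<^sub>v m) c \<in> GL_orbit (Suc m) (bordered j a (0\<^sub>v m) c)"
proof -
  obtain g h where g: "g \<in> carrier_mat m m" "h \<in> carrier_mat m m" "g * h = 1\<^sub>m m" "h * g = 1\<^sub>m m"
    "b = g * a * g\<^sup>T"
    using assms(1) by (rule GL_orbitE)
  let ?B = "\<lambda>x c. bordered j x (0\<^sub>v m) c"
  have "?B g 1 * ?B h 1 = 1\<^sub>m (Suc m)" "?B h 1 * ?B g 1 = 1\<^sub>m (Suc m)"
    using bordered_mult[OF g(1,2) j, of 1 1] bordered_mult[OF g(2,1) j, of 1 1] g(3,4) bordered_one[OF j, where 'a = 'a]
    by simp_all
  then have "?B g 1 * ?B a c * (?B g 1)\<^sup>T \<in> GL_orbit (Suc m) (?B a c)"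
    using bordered_simps(1)[OF g(1) j] bordered_simps(1)[OF g(2) j] by (intro GL_orbitI)
  also have "?B g 1 * ?B a c * (?B g 1)\<^sup>T = ?B b c"
    unfolding bordered_transpose[OF g(1) j] g(5) using g(1) assms(2) j by (simp add: bordered_mult)
  finally show ?thesis .
qed

lemma GL_orbit_corner_nonzero:
  fixes b :: "'a::field mat"
  assumes b: "b \<in> Sym_mat n" "b \<noteq> 0\<^sub>m n n" and two: "(2 :: 'a) \<noteq> 0"
  obtains b' where "b' \<in> GL_orbit n b" "b' $$ (0, 0) \<noteq> 0"
proof -
  have bc: "b \<in> carrier_mat n n" and bs: "\<And>i k. i < n \<Longrightarrow> k < n \<Longrightarrow> b $$ (i, k) = b $$ (k, i)"
    using b(1) by (auto simp: Sym_mat_iff)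
  obtain i k where ik: "i < n" "k < n" "b $$ (i, k) \<noteq> 0"
    using b(2) bc by (auto simp: mat_eq_iff)
  have "\<exists>a\<in>GL_orbit n b. \<exists>j<n. a $$ (j, j) \<noteq> 0"
  proof (cases "b $$ (i, i) = 0 \<and> b $$ (k, k) = 0")
    case False
    then show ?thesis using ik GL_orbit_refl[OF bc] by blast
  next
    case True
    \<comment> \<open>Adding row and column \<open>k\<close> to row and column \<open>i\<close>
      makes the diagonal entry 2 b_ik, since b_ii and b_kk are 0.\<close>
    define u where "u = (\<lambda>l. if l = i then 1 else 0 :: 'a)"
    define a where "a = mat n n (\<lambda>(i, l). b $$ (i, l) + u i * b $$ (k, l) + u l * b $$ (i, k) + u i * u l * b $$ (k, k))"
    have "i \<noteq> k" using True ik by auto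
    then have "a \<in> GL_orbit n b"
      unfolding a_def by (intro transvection_GL_orbit bc ik) (simp add: u_def)
    moreover have "a $$ (i, i) = 2 * b $$ (i, k)"
      using ik True bs[OF ik(1,2)] by (simp add: a_def u_def)
    then have "a $$ (i, i) \<noteq> 0" using ik(3) two by simp
    ultimately show ?thesis using ik(1) by blast
  qed
  then obtain a j where a: "a \<in> GL_orbit n b" "j < n" "a $$ (j, j) \<noteq> 0" by blast
  have as: "a \<in> Sym_mat n" using GL_orbit_Sym_mat[OF a(1) b(1)] .
  have ac: "a \<in> carrier_mat n n" using as by (simp add: Sym_mat_def)
  have n: "0 < n" using ik by simp
  show ?thesis
  proof (cases "a $$ (0, 0) = 0")
    case False
    then show ?thesis using that a by blast
  next
    case True
    then have j: "j \<noteq> 0" using a by metis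
    have sym: "a $$ (j, 0) = a $$ (0, j)" using as n a(2) by (auto simp: Sym_mat_iff)
    \<comment> \<open>Rather than permuting, \<open>e\<close> times row and column \<open>j\<close>
      is added to row and column 0. The corner becomes 2 e a_0j + e^2 a_jj; the values at e = 1 and
      e = -1 add up to 2 a_jj, so one of them is non-zero.\<close>
    define v where "v = (\<lambda>(e :: 'a) (l :: nat). if l = 0 then e else 0 :: 'a)"
    let ?a = "\<lambda>e. mat n n (\<lambda>(i, l). a $$ (i, l) + v e i * a $$ (j, l) + v e l * a $$ (i, j) + v e i * v e l * a $$ (j, j))"
    have orb: "?a e \<in> GL_orbit n b" for e
    proof (rule GL_orbit_trans[OF _ a(1) bc])
      show "?a e \<in> GL_orbit n a"
        using j by (intro transvection_GL_orbit ac a(2)) (simp add: v_def)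
    qed
    have val: "?a e $$ (0, 0) = 2 * e * a $$ (0, j) + e * e * a $$ (j, j)" for e
      using n True sym by (simp add: v_def algebra_simps)
    have "?a 1 $$ (0, 0) \<noteq> 0 \<or> ?a (- 1) $$ (0, 0) \<noteq> 0"
    proof (rule ccontr)
      assume "\<not> ?thesis"
      then have "2 * 1 * a $$ (0, j) + 1 * 1 * a $$ (j, j) = 0" "2 * (- 1) * a $$ (0, j) + (- 1) * (- 1) * a $$ (j, j) = 0"
        using val[of 1] val[of "- 1"] by argo+
      then have e: "2 * a $$ (0, j) + a $$ (j, j) = 0" "- (2 * a $$ (0, j)) + a $$ (j, j) = 0"
        by (simp_all only: mult_1_right mult_1_left mult_minus_right mult_minus_left minus_minus)
      have "2 * y = (x + y) + (- x + y)" for x y :: 'a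
      proof -
        have "(x + y) + (- x + y) = (x + - x) + (y + y)" by (simp only: add_ac)
        then show ?thesis by (simp only: mult_2 add.right_inverse add_0_left)
      qed
      then have "2 * a $$ (j, j) = (2 * a $$ (0, j) + a $$ (j, j)) + (- (2 * a $$ (0, j)) + a $$ (j, j))" .
      then have "2 * a $$ (j, j) = 0" unfolding e by (simp only: add_0_left)
      then show False using a(3) two by (simp only: mult_eq_0_iff simp_thms)
    qed
    then show ?thesis using that orb by blast
  qed
qed

lemma GL_orbit_split_corner:
  fixes b :: "'a::field mat"
  assumes b: "b \<in> Sym_mat (Suc m)" and c: "b $$ (0, 0) \<noteq> 0"
  obtains b' where "b' \<in> Sym_mat m" "bordered 0 b' (0\<^sub>v m) (b $$ (0, 0)) \<in> GL_orbit (Suc m) b"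
proof -
  have bc: "b \<in> carrier_mat (Suc m) (Suc m)" using b by (simp add: Sym_mat_def)
  have bs: "b $$ (0, k) = b $$ (k, 0)" if "k < Suc m" for k
    using b that by (auto simp: Sym_mat_iff)
  \<comment> \<open>Clears the column below the pivot \<open>b $$ (0, 0)\<close>;
    \<open>u 0 = 0\<close> keeps the pivot itself.\<close>
  define u where "u = (\<lambda>i. if i = 0 then 0 else - b $$ (i, 0) / b $$ (0, 0))"
  define a where "a = mat (Suc m) (Suc m)
    (\<lambda>(i, k). b $$ (i, k) + u i * b $$ (0, k) + u k * b $$ (i, 0) + u i * u k * b $$ (0, 0))"
  have a: "a \<in> GL_orbit (Suc m) b"
    unfolding a_def by (rule transvection_GL_orbit[OF bc]) (simp_all add: u_def)
  have as: "a \<in> Sym_mat (Suc m)" using GL_orbit_Sym_mat[OF a b] .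
  obtain b' v d where d: "b' \<in> Sym_mat m" "v \<in> carrier_vec m" "a = bordered 0 b' v d"
    using Sym_mat_bordered_cases[OF as le0] by blast
  have b'c: "b' \<in> carrier_mat m m" using d(1) by (simp add: Sym_mat_def)
  note s = bordered_simps[OF b'c le0, where v = v and c = d, folded d(3)]
  have "d = b $$ (0, 0)" using s(2) by (simp add: a_def u_def)
  moreover have "v = 0\<^sub>v m"
  proof (rule eq_vecI)
    fix i assume "i < dim_vec (0\<^sub>v m :: 'a vec)"
    then have i: "i < m" by simp
    have "v $ i = a $$ (insert_index 0 i, 0)" using s(3)[OF i] by simp
    also have "\<dots> = 0" using i c by (simp add: a_def u_def)
    finally show "v $ i = 0\<^sub>v m $ i" using i by simp
  qed (use d(2) in auto)
  ultimately show ?thesis using that[of b'] d a by simp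
qed

text \<open>The entries \<open>c\<close> and \<open>d\<close> are exchanged for 1 and c * d, because
  their binary form represents 1. The place \<open>i\<close> is free: diagonalisation uses i = 0,
  averaging i = t - 1.\<close>

lemma diagonal_pair_diag_rep:
  fixes c d :: "'a::{field,finite}"
  assumes "t \<le> m" "1 \<le> t" "i < t" "c \<noteq> 0" "d \<noteq> 0"
    and f: "\<And>k. f k = (if k = i then c else if k = t then d else if k < t then 1 else 0)"
  shows "diag_rep (Suc m) (Suc t) (c * d) \<in> GL_orbit (Suc m) (diagonal (Suc m) f)"
proof -
  obtain p w where pw: "c * p\<^sup>2 + d * w\<^sup>2 = 1"
    using binary_form_represents_one[OF assms(4,5)] .
  have "diag_rep_entry (Suc t) (c * d) = f(i := 1, t := f i * f t)"
    using assms(3) by (auto simp: fun_eq_iff diag_rep_entry_def f)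
  then show ?thesis
    using diagonal_pair_GL_orbit[of i "Suc m" t f p w] assms(1,3) pw by (simp add: f diag_rep_diagonal)
qed

lemma Sym_mat_diag_rep:
  fixes b :: "'a::{field,finite} mat"
  assumes "(2 :: 'a) \<noteq> 0" "b \<in> Sym_mat n"
  obtains t d where "t \<le> n" "d \<noteq> 0" "diag_rep n t d \<in> GL_orbit n b"
proof -
  have "\<exists>t\<le>n. \<exists>d. d \<noteq> 0 \<and> diag_rep n t d \<in> GL_orbit n b"
    using assms(2)
  proof (induction n arbitrary: b)
    case 0
    then have "b \<in> carrier_mat 0 0" by (simp add: Sym_mat_def)
    moreover from this have "b = diag_rep 0 0 1" by (auto simp: mat_eq_iff diag_rep_def)
    ultimately show ?case using GL_orbit_refl[of b 0] by (metis le0 one_neq_zero)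
  next
    case (Suc m)
    have bc: "b \<in> carrier_mat (Suc m) (Suc m)" using Suc.prems by (simp add: Sym_mat_def)
    show ?case
    proof (cases "b = 0\<^sub>m (Suc m) (Suc m)")
      case True
      then have "b = diag_rep (Suc m) 0 1" by (auto simp: mat_eq_iff diag_rep_def)
      then show ?thesis using GL_orbit_refl[OF bc] by (metis le0 one_neq_zero)
    next
      case False
      then obtain b1 where b1: "b1 \<in> GL_orbit (Suc m) b" "b1 $$ (0, 0) \<noteq> 0"
        using GL_orbit_corner_nonzero[OF Suc.prems _ assms(1)] by blast
      define c where "c = b1 $$ (0, 0)"
      obtain b2 where b2: "b2 \<in> Sym_mat m" "bordered 0 b2 (0\<^sub>v m) c \<in> GL_orbit (Suc m) b1"
        using GL_orbit_split_corner[OF GL_orbit_Sym_mat[OF b1(1) Suc.prems] b1(2)] c_def by blast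
      obtain t d where t: "t \<le> m" "d \<noteq> 0" "diag_rep m t d \<in> GL_orbit m b2"
        using Suc.IH[OF b2(1)] by blast
      let ?D = "bordered 0 (diag_rep m t d) (0\<^sub>v m) c"
      have "?D \<in> GL_orbit (Suc m) (bordered 0 b2 (0\<^sub>v m) c)"
        using bordered_GL_orbit[OF t(3) _ le0] b2(1) by (simp add: Sym_mat_def)
      then have D: "?D \<in> GL_orbit (Suc m) b"
        using GL_orbit_trans[OF _ GL_orbit_trans[OF b2(2) b1(1) bc] bc] by blast
      define f where "f = (\<lambda>k. if k = 0 then c else if k = t then d else if k < t then 1 else 0 :: 'a)"
      have De: "?D = diagonal (Suc m) f"
      proof (rule mat_eq_insert_indexI[OF _ _ le0])
        have r: "diag_rep m t d \<in> carrier_mat m m" by (simp add: diag_rep_def)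
        note s = bordered_simps[OF r le0, where v = "0\<^sub>v m" and c = c]
        show "?D \<in> carrier_mat (Suc m) (Suc m)" "diagonal (Suc m) f \<in> carrier_mat (Suc m) (Suc m)"
          using s by simp_all
        show "?D $$ (0, 0) = diagonal (Suc m) f $$ (0, 0)"
          using s(2) by (simp add: f_def)
        fix i assume i: "i < m"
        then show "?D $$ (insert_index 0 i, 0) = diagonal (Suc m) f $$ (insert_index 0 i, 0)"
          "?D $$ (0, insert_index 0 i) = diagonal (Suc m) f $$ (0, insert_index 0 i)"
          using s(3,4) by simp_all
        fix k assume k: "k < m"
        show "?D $$ (insert_index 0 i, insert_index 0 k) = diagonal (Suc m) f $$ (insert_index 0 i, insert_index 0 k)"
          unfolding s(5)[OF i k] using i k by (auto simp: diag_rep_def f_def)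
      qed
      have c0: "c \<noteq> 0" using b1(2) by (simp add: c_def)
      show ?thesis
      \<comment> \<open>For t = 0 the remaining block is zero and \<open>d\<close> does not occur in
        it, so \<open>c\<close> itself becomes the last non-zero entry.\<close>
      proof (cases "t = 0")
        case True
        then have "diag_rep (Suc m) 1 c = ?D"
          unfolding De by (auto simp: diag_rep_diagonal diag_rep_entry_def f_def mat_eq_iff)
        then show ?thesis using D c0 by (metis Suc_le_mono le0 One_nat_def)
      next
        case False
        then have "diag_rep (Suc m) (Suc t) (c * d) \<in> GL_orbit (Suc m) ?D"
          unfolding De using t c0 by (intro diagonal_pair_diag_rep[of t m 0]) (auto simp: f_def)
        then have "diag_rep (Suc m) (Suc t) (c * d) \<in> GL_orbit (Suc m) b"
          using D bc by (rule GL_orbit_trans)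
        then show ?thesis using t c0 by (intro exI[of _ "Suc t"] conjI exI[of _ "c * d"]) auto
      qed
    qed
  qed
  then show ?thesis using that by blast
qed

lemma diag_rep_scale:
  fixes d :: "'a::field"
  assumes "1 \<le> t" "t \<le> n" "w \<noteq> 0"
  shows "diag_rep n t (w\<^sup>2 * d) \<in> GL_orbit n (diag_rep n t d)"
proof -
  have "diag_rep_entry t (w\<^sup>2 * d) = (diag_rep_entry t d)(t - 1 := w\<^sup>2 * diag_rep_entry t d (t - 1))"
    using assms(1) by (auto simp: fun_eq_iff diag_rep_entry_def)
  then show ?thesis
    using diagonal_scale_GL_orbit[of "t - 1" n w "diag_rep_entry t d"] assms by (simp add: diag_rep_diagonal)
qed

text \<open>Compare the leading \<open>t\<close> by \<open>t\<close> minors: the vanishing rows and columns make the relation hold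
  for the corresponding block of the transforming matrix.\<close>

lemma diag_rep_GL_orbit_square:
  fixes d :: "'a::field"
  assumes t: "1 \<le> t" "t \<le> n" and orb: "diag_rep n t d \<in> GL_orbit n (diag_rep n t 1)"
  obtains z where "d = z\<^sup>2"
proof -
  obtain g where g: "g \<in> carrier_mat n n" "diag_rep n t d = g * diag_rep n t 1 * g\<^sup>T"
    using orb by (rule GL_orbitE)
  define G where "G = mat t t (($$) g)"
  have G: "G \<in> carrier_mat t t" by (simp add: G_def)
  have e: "(G * G\<^sup>T) $$ (i, k) = diag_rep n t d $$ (i, k)" if "i < t" "k < t" for i k
  proof -
    have ik: "i < n" "k < n" using that t by auto
    have R: "diag_rep n t (1 :: 'a) \<in> carrier_mat n n" by (simp add: diag_rep_def)
    have gr: "(g * diag_rep n t 1) $$ (i, l) = (if l < t then g $$ (i, l) else 0)" if "l < n" for l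
    proof -
      have "(g * diag_rep n t 1) $$ (i, l) = (\<Sum>p<n. g $$ (i, p) * diag_rep n t 1 $$ (p, l))"
        using ik that g(1) R by (simp add: scalar_prod_def atLeast0LessThan)
      also have "\<dots> = (\<Sum>p<n. if p = l then (if l < t then g $$ (i, l) else 0) else 0)"
        using that by (intro sum.cong) (auto simp: diag_rep_def)
      finally show ?thesis using that by simp
    qed
    have "diag_rep n t d $$ (i, k) = (\<Sum>l<n. (g * diag_rep n t 1) $$ (i, l) * g $$ (k, l))"
    proof -
      have "(M * g\<^sup>T) $$ (i, k) = (\<Sum>l<n. M $$ (i, l) * g $$ (k, l))" if "M \<in> carrier_mat n n" for M
        using that ik g(1) by (simp add: scalar_prod_def atLeast0LessThan)
      then show ?thesis unfolding g(2) using g(1) R by (meson mult_carrier_mat)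
    qed
    also have "\<dots> = (\<Sum>l<n. if l < t then g $$ (i, l) * g $$ (k, l) else 0)"
      by (intro sum.cong) (auto simp: gr)
    also have "\<dots> = (\<Sum>l<t. g $$ (i, l) * g $$ (k, l))"
      using t by (intro sum.mono_neutral_cong_right) auto
    also have "\<dots> = (G * G\<^sup>T) $$ (i, k)"
      using that by (simp add: G_def scalar_prod_def atLeast0LessThan)
    finally show ?thesis by simp
  qed
  have GD: "G * G\<^sup>T = diag_rep t t d"
    by (rule eq_matI) (use e t G in \<open>auto simp: diag_rep_def\<close>)
  have "det (diag_rep t t d) = prod_list (diag_mat (diag_rep t t d))"
    by (rule det_upper_triangular[of _ t]) (auto simp: diag_rep_def)
  also have "\<dots> = (\<Prod>i<t. diag_rep t t d $$ (i, i))"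
    by (simp add: prod_list_diag_prod diag_rep_def atLeast0LessThan)
  also have "\<dots> = (\<Prod>i<t. if i = t - 1 then d else 1)"
    using t by (intro prod.cong) (auto simp: diag_rep_def)
  also have "\<dots> = d" using t by simp
  finally have "d = det (G * G\<^sup>T)" using GD by simp
  also have "\<dots> = (det G)\<^sup>2"
    using G by (simp add: det_mult[of _ t] det_transpose[of _ t] power2_eq_square)
  finally show ?thesis by (rule that)
qed

section \<open>The Fourier coefficients\<close>

context nontrivial_character
begin

definition rank_fourier :: "nat \<Rightarrow> nat \<Rightarrow> 'a mat \<Rightarrow> complex" where
  "rank_fourier n r b = (\<Sum>a\<in>Sym_mat n. of_bool (vec_space.rank n a = r) * \<psi> (mat_trace (b\<^sup>T * a)))"

lemma rank_fourier_diagonal: "rank_fourier n r (diagonal n f) = rank_sum n r f"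
  unfolding rank_fourier_def rank_sum_def by (intro sum.cong) (auto simp: mat_trace_diagonal Sym_mat_def)

lemma rank_fourier_GL_orbit:
  assumes "b' \<in> GL_orbit n b" "b \<in> carrier_mat n n"
  shows "rank_fourier n r b' = rank_fourier n r b"
  unfolding rank_fourier_def by (rule sum_trace_GL_orbit[OF assms])

lemma rank_fourier_diag_rep: "rank_fourier n r (diag_rep n s d) = rank_sum n r (diag_rep_entry s d)"
  by (simp add: diag_rep_diagonal rank_fourier_diagonal)

lemma q_gt_1: "q \<noteq> 1" "q \<noteq> 0" "0 < k \<Longrightarrow> q ^ k \<noteq> 1"
proof -
  have g: "CARD('a) > 1" by (rule CARD_field_gt_1)
  show "q \<noteq> 1" "q \<noteq> 0" using g by (simp_all add: q)
  assume "0 < k"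
  then have "CARD('a) ^ k \<noteq> 1" using g one_less_power[of "CARD('a)" k] by simp
  then show "q ^ k \<noteq> 1" unfolding q by (metis of_nat_eq_1_iff of_nat_power)
qed

sublocale q_base q
  by unfold_locales (use q_gt_1 in auto)

text \<open>The \<open>P n s r\<close> of the overview. Averaging over all non-zero
  \<open>d\<close>, not over the two classes, makes the term d = 0 the only one missing from a sum
  over the whole field.\<close>

definition rank_avg :: "nat \<Rightarrow> nat \<Rightarrow> nat \<Rightarrow> complex" where
  "rank_avg n s r = (\<Sum>d\<in>UNIV - {0}. rank_sum n r (diag_rep_entry s d)) / (q - 1)"

lemma rank_avg_sum: "(\<Sum>d\<in>UNIV - {0}. rank_sum n r (diag_rep_entry s d)) = (q - 1) * rank_avg n s r"
  using q_gt_1 by (simp add: rank_avg_def)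

lemma sum_nonzero_const: "(\<Sum>d\<in>UNIV - {0 :: 'a}. c) = (q - 1) * c"
  using CARD_field_gt_1[where 'a = 'a] by (simp add: q)

lemma rank_avg_0: "rank_avg n 0 r = rank_sum n r (\<lambda>_. 0)"
proof -
  have "diag_rep_entry 0 d = (\<lambda>_. 0)" for d :: 'a
    by (auto simp: diag_rep_entry_def)
  then show ?thesis
    unfolding rank_avg_def sum_nonzero_const using q_gt_1 by (simp add: sum_nonzero_const del: sum_constant)
qed

text \<open>The new entry \<open>d\<close> absorbs \<open>e\<close>: the pair is exchanged for 1 and
  e * d, and d \<mapsto> e * d permutes the non-zero scalars. For t = 0 the entry \<open>e\<close>
  does not occur.\<close>

lemma sum_rank_sum_pair:
  assumes t: "t \<le> m" and e: "e \<noteq> 0"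
  shows "(\<Sum>d\<in>UNIV - {0}. rank_sum (Suc m) r ((diag_rep_entry t e)(t := d))) = (q - 1) * rank_avg (Suc m) (Suc t) r"
proof (cases "t = 0")
  case True
  then have "(diag_rep_entry t e)(t := d) = diag_rep_entry (Suc t) d" for d
    by (auto simp: diag_rep_entry_def)
  then show ?thesis by (simp only: rank_avg_sum)
next
  case False
  have "rank_sum (Suc m) r ((diag_rep_entry t e)(t := d)) = rank_sum (Suc m) r (diag_rep_entry (Suc t) (e * d))"
    if "d \<noteq> 0" for d
  proof -
    have "((diag_rep_entry t e)(t := d)) k = (if k = t - 1 then e else if k = t then d else if k < t then 1 else 0)" for k
      using False by (auto simp: diag_rep_entry_def)
    then have orb: "diag_rep (Suc m) (Suc t) (e * d) \<in> GL_orbit (Suc m) (diagonal (Suc m) ((diag_rep_entry t e)(t := d)))"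
      using False that t e by (intro diagonal_pair_diag_rep) auto
    then show ?thesis
      using rank_fourier_GL_orbit[OF orb, of r] by (simp add: rank_fourier_diag_rep rank_fourier_diagonal)
  qed
  then have "(\<Sum>d\<in>UNIV - {0}. rank_sum (Suc m) r ((diag_rep_entry t e)(t := d))) =
    (\<Sum>d\<in>UNIV - {0}. rank_sum (Suc m) r (diag_rep_entry (Suc t) (e * d)))"
    by simp
  also have "\<dots> = (\<Sum>d\<in>UNIV - {0}. rank_sum (Suc m) r (diag_rep_entry (Suc t) d))"
    using e by (intro sum.reindex_bij_witness[where i = "\<lambda>d. d / e" and j = "\<lambda>d. e * d"]) auto
  finally show ?thesis by (simp only: rank_avg_sum)
qed

lemma rank_avg_rec:
  assumes t: "t \<le> m"
  shows "(q - 1) * rank_avg (Suc m) (Suc t) r + rank_avg (Suc m) t r =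
    q * (rank_avg m t r + (q ^ (m - t) - 1) * q ^ m * (if 2 \<le> r then rank_avg (m - 1) t (r - 2) else 0))"
proof -
  let ?U = "UNIV - {0 :: 'a}"
  let ?G = "\<lambda>e. if 2 \<le> r then rank_sum (m - 1) (r - 2) (diag_rep_entry t e) else 0"
  \<comment> \<open>For fixed \<open>e\<close>, the term d = 0 stays at rank \<open>t\<close> and
    the terms d \<noteq> 0 form the average for rank \<open>Suc t\<close>. The later sum over
    \<open>e\<close> turns the remaining single values into averages as well.\<close>
  have eq: "(q - 1) * rank_avg (Suc m) (Suc t) r + rank_sum (Suc m) r (diag_rep_entry t e) =
      q * (rank_sum m r (diag_rep_entry t e) + (q ^ (m - t) - 1) * q ^ m * ?G e)" if e: "e \<noteq> 0" for e
  proof -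
    have "(diag_rep_entry t e)(t := 0) = diag_rep_entry t e"
      by (auto simp: diag_rep_entry_def)
    then have "(\<Sum>d\<in>UNIV. rank_sum (Suc m) r ((diag_rep_entry t e)(t := d))) =
      rank_sum (Suc m) r (diag_rep_entry t e) + (q - 1) * rank_avg (Suc m) (Suc t) r"
      by (simp only: sum.remove[OF finite UNIV_I, of _ 0] sum_rank_sum_pair[OF t e])
    moreover have "diag_rep_entry t e i = 0 \<longleftrightarrow> t \<le> i" for i
      using e by (auto simp: diag_rep_entry_def)
    ultimately show ?thesis
      using sum_rank_sum_update[OF t, of "diag_rep_entry t e" r] by (simp add: add.commute)
  qed
  have "(q - 1) * ((q - 1) * rank_avg (Suc m) (Suc t) r + rank_avg (Suc m) t r) =
    (\<Sum>e\<in>?U. (q - 1) * rank_avg (Suc m) (Suc t) r + rank_sum (Suc m) r (diag_rep_entry t e))"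
    by (simp only: sum.distrib sum_nonzero_const rank_avg_sum distrib_left)
  also have "\<dots> = (\<Sum>e\<in>?U. q * (rank_sum m r (diag_rep_entry t e) + (q ^ (m - t) - 1) * q ^ m * ?G e))"
    by (rule sum.cong) (use eq in auto)
  also have "\<dots> = q * ((\<Sum>e\<in>?U. rank_sum m r (diag_rep_entry t e)) + (q ^ (m - t) - 1) * q ^ m * (\<Sum>e\<in>?U. ?G e))"
    by (simp only: sum.distrib flip: sum_distrib_left)
  also have "(\<Sum>e\<in>?U. ?G e) = (q - 1) * (if 2 \<le> r then rank_avg (m - 1) t (r - 2) else 0)"
    by (simp add: rank_avg_sum)
  finally have "(q - 1) * ((q - 1) * rank_avg (Suc m) (Suc t) r + rank_avg (Suc m) t r) = (q - 1) *
    (q * (rank_avg m t r + (q ^ (m - t) - 1) * q ^ m * (if 2 \<le> r then rank_avg (m - 1) t (r - 2) else 0)))"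
    by (simp only: rank_avg_sum) (simp only: distrib_left mult_ac)
  then show ?thesis
    using q_gt_1(1) by simp
qed

lemma rank_sum_zero: "rank_sum n r (\<lambda>_. 0) = rank_count (q ^ n) r"
proof (induction n arbitrary: r rule: less_induct)
  case (less n)
  show ?case
  proof (cases n)
    case 0
    have "Sym_mat 0 = {0\<^sub>m 0 0 :: 'a mat}"
      by (auto simp: Sym_mat_def)
    then have "rank_sum 0 r (\<lambda>_. 0) = of_bool (r = 0)"
      using vec_space.rank_0I[of 0, where 'a = 'a and nc = 0] by (simp add: rank_sum_def zero)
    moreover have "rank_count 1 r = of_bool (r = 0)"
      using falling_power_eq_0[of 0 r] by (cases "r = 0") (simp_all add: rank_count_def)
    ultimately show ?thesis using 0 by simp
  next
    case (Suc m)
    \<comment> \<open>For m = 0 the size m - 1 is truncated, but then the factor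
      \<open>q ^ m - 1\<close> is 0.\<close>
    have "(q ^ m - 1) * q ^ m * (if 2 \<le> r then rank_sum (m - 1) (r - 2) (\<lambda>_. 0) else 0) =
      (q ^ m - 1) * q ^ m * (if 2 \<le> r then rank_count (q ^ m / q) (r - 2) else 0)"
    proof (cases m)
      case (Suc k)
      then show ?thesis using less.IH[of k "r - 2"] \<open>n = Suc m\<close> by simp
    qed simp
    then show ?thesis
      unfolding Suc rank_sum_zero_Suc power_Suc rank_count_rec[of "q ^ m"]
      using less.IH[of m] Suc by simp
  qed
qed

lemma rank_avg_eq_psi_sum:
  assumes "1 \<le> s" "s \<le> n"
  shows "rank_avg n s r = (- 1) ^ r * psi_sum ((s - 1) div 2) (q ^ n) (r div 2)"
  using assms
proof (induction s arbitrary: n r rule: less_induct)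
  case (less s)
  obtain t where s: "s = Suc t" using less.prems by (cases s) auto
  obtain m where n: "n = Suc m" using less.prems by (cases n) auto
  have t: "t \<le> m" using less.prems by (simp add: s n)
  show ?case
  proof (cases "t = 0")
    case True
    \<comment> \<open>At s = 1 all other terms are counts. Substituting the counting recurrence
      removes the terms of rank r - 2 and leaves the difference of
      \<open>rank_count_diff\<close>.\<close>
    have "(q - 1) * rank_avg (Suc m) (Suc 0) r = q * (rank_sum m r (\<lambda>_. 0) +
        (q ^ m - 1) * q ^ m * (if 2 \<le> r then rank_sum (m - 1) (r - 2) (\<lambda>_. 0) else 0)) - rank_sum (Suc m) r (\<lambda>_. 0)"
      using rank_avg_rec[of 0 m r, OF le0] unfolding rank_avg_0 diff_zero by (simp only: eq_diff_eq)
    also have "\<dots> = (q - 1) * (rank_sum (Suc m) r (\<lambda>_. 0) - q ^ Suc m * (if 1 \<le> r then rank_sum m (r - 1) (\<lambda>_. 0) else 0))"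
      unfolding rank_sum_zero_Suc by (simp add: algebra_simps)
    also have "rank_sum (Suc m) r (\<lambda>_. 0) - q ^ Suc m * (if 1 \<le> r then rank_sum m (r - 1) (\<lambda>_. 0) else 0) =
        (- 1) ^ r * psi_sum 0 (q ^ Suc m) (r div 2)"
    proof -
      have "q ^ Suc m / q = q ^ m" by simp
      then show ?thesis using rank_count_diff[of "q ^ Suc m" r] unfolding rank_sum_zero by (simp only:)
    qed
    finally show ?thesis using q_gt_1(1) True by (simp add: s n)
  next
    case False
    define y where "y = (t - 1) div 2"
    define x where "x = r div 2"
    define z where "z = q ^ n"
    define V where "V = (if x = 0 then 0 else psi_sum y (z / q\<^sup>2) (x - 1))"
    have zq: "q ^ m = z / q" "q ^ (m - t) = z / q ^ s"
    proof -
      show "q ^ m = z / q" by (simp add: z_def n)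
      have "n = (m - t) + s" using t by (simp add: n s)
      then have "z = q ^ (m - t) * q ^ s" unfolding z_def by (metis power_add)
      then show "q ^ (m - t) = z / q ^ s" by simp
    qed
    have a1: "rank_avg (Suc m) t r = (- 1) ^ r * psi_sum y z x"
      using less.IH[of t n r] False t by (simp add: s n y_def x_def z_def)
    have a2: "rank_avg m t r = (- 1) ^ r * psi_sum y (z / q) x"
      using less.IH[of t m r] False t zq(1) by (simp add: s y_def x_def)
    have a3: "(q ^ (m - t) - 1) * q ^ m * (if 2 \<le> r then rank_avg (m - 1) t (r - 2) else 0) =
      (z / q ^ s - 1) * (z / q) * ((- 1) ^ r * V)"
    \<comment> \<open>For t = m the size m - 1 is below t, beyond the reach of the induction
      hypothesis; there \<open>q ^ (m - t) - 1\<close> is 0. For r < 2 both sides are 0.\<close>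
    proof (cases "t = m \<or> r < 2")
      case True
      then show ?thesis
      proof
        assume "t = m"
        then have "z / q ^ s = 1" using zq(2) by simp
        then show ?thesis using zq(2) by simp
      qed (simp add: V_def x_def)
    next
      case tm: False
      have "rank_avg (m - 1) t (r - 2) = (- 1) ^ (r - 2) * psi_sum y (q ^ (m - 1)) ((r - 2) div 2)"
      proof -
        have "t \<le> m - 1" using t tm by linarith
        then show ?thesis using less.IH[of t "m - 1" "r - 2"] False by (simp add: s y_def)
      qed
      moreover have "(r - 2) div 2 = x - 1" "x \<noteq> 0" using tm by (auto simp: x_def)
      moreover have "(- 1) ^ (r - 2) = ((- 1) ^ r :: complex)"
        using tm by (auto simp: minus_one_power_iff)
      moreover have "q ^ (m - 1) = z / q\<^sup>2"
        using tm t False by (cases m) (simp_all add: z_def n power2_eq_square)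
      ultimately show ?thesis
        using tm by (simp add: V_def zq)
    qed
    have rec: "(q - 1) * rank_avg n s r = (- 1) ^ r *
      (q * (psi_sum y (z / q) x + (z / q ^ s - 1) * (z / q) * V) - psi_sum y z x)"
    proof -
      have "(q - 1) * rank_avg n s r = q * ((- 1) ^ r * psi_sum y (z / q) x + (z / q ^ s - 1) * (z / q) * ((- 1) ^ r * V))
        - (- 1) ^ r * psi_sum y z x"
        using rank_avg_rec[OF t, of r] unfolding a1 a2 a3 s n by (simp only: eq_diff_eq)
      then show ?thesis by (simp only: right_diff_distrib distrib_left mult_ac)
    qed
    have A: "psi_sum y (z / q) x = psi_sum y z x - (z / q ^ (2 * y + 2) - 1) * (z / q) * V"
      using psi_sum_rec[of y z x] unfolding V_def by (simp only: eq_diff_eq)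
    have "q * (psi_sum y (z / q) x + (z / q ^ s - 1) * (z / q) * V) - psi_sum y z x = (q - 1) * psi_sum ((s - 1) div 2) z x"
    \<comment> \<open>After substituting \<open>A\<close>: for odd t, s = 2 y + 2, the two multiples
      of \<open>V\<close> cancel and \<open>y\<close> stays. For even t, s = 2 y + 3, and they
      combine to the term subtracted in \<open>psi_sum (Suc y)\<close>.\<close>
    proof (cases "odd t")
      case True
      then have "s = 2 * y + 2" "(s - 1) div 2 = y" by (auto simp: s y_def elim!: oddE)
      then show ?thesis unfolding A by (simp add: algebra_simps)
    next
      case even: False
      then have sy: "s = 2 * y + 3" "(s - 1) div 2 = Suc y"
        using False by (auto simp: s y_def elim!: evenE)
      define b where "b = z / q ^ (2 * y + 3)"
      have b: "z / q ^ (2 * y + 2) = q * b" by (simp add: b_def eval_nat_numeral)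
      have "psi_sum (Suc y) z x = psi_sum y z x - z * b * V"
        by (simp add: V_def b_def power2_eq_square)
      moreover have "q * (psi_sum y z x - (q * b - 1) * (z / q) * V + (b - 1) * (z / q) * V) - psi_sum y z x =
        (q - 1) * (psi_sum y z x - z * b * V)"
        by (simp add: field_simps)
      ultimately show ?thesis
        unfolding A sy(2) b unfolding sy(1) b_def[symmetric] by simp
    qed
    then have "(q - 1) * rank_avg n s r = (q - 1) * ((- 1) ^ r * psi_sum ((s - 1) div 2) z x)"
      unfolding rec by (simp only: mult_ac)
    then show ?thesis
      using q_gt_1(1) by (simp add: x_def z_def)
  qed
qed

text \<open>Scaling the last entry by a square is a congruence, so the value at \<open>d\<close>
  depends only on whether \<open>d\<close> is a square, and each class of scalars has (q - 1) / 2
  elements.\<close>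

lemma rank_avg_eq_mean:
  assumes \<delta>: "\<nexists>z. \<delta> = z\<^sup>2" and s: "1 \<le> s" "s \<le> n"
  shows "rank_avg n s r = (rank_fourier n r (diag_rep n s 1) + rank_fourier n r (diag_rep n s \<delta>)) / 2"
proof -
  let ?F = "\<lambda>d. rank_sum n r (diag_rep_entry s d)"
  have scale: "?F (w\<^sup>2 * d) = ?F d" if "w \<noteq> 0" for w d
  proof -
    have "diag_rep n s d \<in> carrier_mat n n" by (simp add: diag_rep_def)
    then show ?thesis
      using rank_fourier_GL_orbit[OF diag_rep_scale[OF s that]] by (simp add: rank_fourier_diag_rep)
  qed
  note split = nonzero_squares_split[OF \<delta>]
  have 1: "?F d = ?F 1" if "d \<in> nonzero_squares" for d
    using that scale[of _ 1] by (auto simp: nonzero_squares_def)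
  have 2: "?F d = ?F \<delta>" if "d \<in> (\<lambda>y. \<delta> * y) ` nonzero_squares" for d
    using that scale[of _ \<delta>] by (auto simp: nonzero_squares_def mult.commute)
  have "(\<Sum>d\<in>UNIV - {0}. ?F d) = (\<Sum>d\<in>nonzero_squares. ?F d) + (\<Sum>d\<in>(\<lambda>y. \<delta> * y) ` nonzero_squares. ?F d)"
    unfolding split(1) by (rule sum.union_disjoint) (use split(2) in auto)
  also have "\<dots> = of_nat (card (nonzero_squares :: 'a set)) * (?F 1 + ?F \<delta>)"
    using 1 2 by (simp add: split(3) distrib_left)
  also have "of_nat (card (nonzero_squares :: 'a set)) = (q - 1) / 2"
  proof -
    have "of_nat (2 * card (nonzero_squares :: 'a set)) = q - 1"
      unfolding split(4) using CARD_field_gt_1[where 'a = 'a] by (simp add: q)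
    then show ?thesis by (simp add: mult.commute)
  qed
  finally show ?thesis
    using q_gt_1(1) by (simp add: rank_avg_def rank_fourier_diag_rep)
qed

end

section \<open>Signs of orbits and identification of the coefficient\<close>

lemma sym_sgn_GL_orbit_1:
  assumes "1 \<le> t" "t \<le> n" "b \<in> GL_orbit n (diag_rep n t 1)"
  shows "sym_sgn \<delta> n b = 1"
  using assms by (auto simp: sym_sgn_def)

text \<open>The first branch of \<open>sym_sgn\<close> is excluded: the rank forces the two
  representatives to have equally many non-zero entries, and their congruence would make \<delta> a
  square.\<close>

lemma sym_sgn_GL_orbit_nonsquare:
  fixes \<delta> :: "'a::{field,finite}"
  assumes \<delta>: "\<nexists>z. \<delta> = z\<^sup>2" and t: "1 \<le> t" "t \<le> n" and b: "b \<in> GL_orbit n (diag_rep n t \<delta>)"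
  shows "sym_sgn \<delta> n b = - 1"
proof -
  have rep: "diag_rep n s d \<in> carrier_mat n n" for s and d :: 'a by (simp add: diag_rep_def)
  have "\<delta> \<noteq> 0" using \<delta> by (metis zero_power2)
  then have rank: "vec_space.rank n b = t"
    using rank_GL_orbit[OF b rep] rank_diag_rep[OF t(2)] by simp
  have "b \<noteq> 0\<^sub>m n n"
    using rank vec_space.rank_0I[of n n, where 'a = 'a] t by auto
  moreover have "b \<notin> GL_orbit n (diag_rep n s 1)" if s: "s \<in> {1..n}" for s
  proof
    assume bs: "b \<in> GL_orbit n (diag_rep n s 1)"
    then have "s = t"
      using rank_GL_orbit[OF bs rep] rank_diag_rep[of s n "1 :: 'a"] s rank by simp
    moreover have "diag_rep n t \<delta> \<in> GL_orbit n (diag_rep n s 1)"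
      using GL_orbit_trans[OF GL_orbit_sym[OF b rep] bs rep] .
    ultimately show False
      using diag_rep_GL_orbit_square[OF t] \<delta> by metis
  qed
  ultimately show ?thesis
    using t b by (auto simp: sym_sgn_def)
qed

theorem proposition6p4p1:
  fixes \<theta> :: "'a::{field,finite} \<Rightarrow> complex"
    and \<delta> :: 'a
    and q :: complex
    and n s r N y x :: nat
  assumes "odd CARD('a)"
    and "\<nexists>z. \<delta> = z\<^sup>2"
    and "nontrivial_additive_character \<theta>"
    and "n \<ge> 1"
    and "1 \<le> s" and "s \<le> n"
    and "r \<le> n"
  defines "q \<equiv> of_nat CARD('a)"
    and "N \<equiv> (n - 1) div 2"
    and "y \<equiv> (s - 1) div 2"
    and "x \<equiv> r div 2"
  shows "Psi1 \<theta> \<delta> n s r =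
    (- 1) ^ (r + x) * q ^ (x * (x + 1))
      * q_poch (q powi (2 * int N + (- 1) ^ n)) (q powi (- 2)) x
      * q_binom N x (q\<^sup>2)
      * K_Aff y x (q powi (- 2 * int N - (- 1) ^ n)) N (q\<^sup>2)"
proof -
  have two: "(2 :: 'a) \<noteq> 0" by (rule two_nonzero_of_odd_CARD[OF assms(1)])
  have \<delta>0: "\<delta> \<noteq> 0" using assms(2) by (metis zero_power2)
  interpret nontrivial_character "\<lambda>u. cnj (\<theta> u)" q
  proof
    show "cnj (\<theta> 0) = 1" "cnj (\<theta> (u + v)) = cnj (\<theta> u) * cnj (\<theta> v)" for u v
      using assms(3) by (simp_all add: nontrivial_additive_character_def additive_character_def)
    obtain u where "\<theta> u \<noteq> 1"
      using assms(3) by (auto simp: nontrivial_additive_character_def)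
    then have "cnj (\<theta> u) \<noteq> 1" by (metis complex_cnj_cnj complex_cnj_one)
    then show "\<exists>u. cnj (\<theta> u) \<noteq> 1" by blast
  qed (use two in \<open>simp_all add: q_def\<close>)
  let ?F = "rank_fourier n r"
  let ?p = "\<lambda>t. ?F (diag_rep n t 1)" and ?m = "\<lambda>t. ?F (diag_rep n t \<delta>)"
  have rep: "diag_rep n t d \<in> Sym_mat n" for t and d :: 'a
    by (simp add: diag_rep_diagonal diagonal_Sym_mat)
  have repc: "diag_rep n t d \<in> carrier_mat n n" for t and d :: 'a
    by (simp add: diag_rep_def)
  have fourier: "sym_fourier n (rank_chi n r) (dual_char \<theta> b) = ?F b" for b
    unfolding sym_fourier_def rank_fourier_def dual_char_def rank_chi_def by (intro sum.cong) auto
  \<comment> \<open>Each sum has a single surviving term, the one for the rank of \<open>b\<close>;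
    the signed sum starts at 1, so rank 0 contributes nothing to it.\<close>
  have expand: "(\<Sum>t=0..n. c t * rank_chi n t b) + (\<Sum>t=1..n. d t * sgn_rank_chi \<delta> n t b) =
      c (vec_space.rank n b) + (if vec_space.rank n b = 0 then 0 else d (vec_space.rank n b) * sym_sgn \<delta> n b)"
    if "b \<in> Sym_mat n" for b c d
  proof -
    let ?r = "vec_space.rank n b"
    have "?r \<le> n" using that vec_space.rank_le_nc[of b n n] by (simp add: Sym_mat_def)
    have "(\<Sum>t=0..n. c t * rank_chi n t b) = (\<Sum>t=0..n. if t = ?r then c t else 0)"
      by (intro sum.cong) (auto simp: rank_chi_def)
    also have "\<dots> = c ?r" using \<open>?r \<le> n\<close> by simp
    finally have 1: "(\<Sum>t=0..n. c t * rank_chi n t b) = c ?r" .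
    have "(\<Sum>t=1..n. d t * sgn_rank_chi \<delta> n t b) = (\<Sum>t=1..n. if t = ?r then d t * sym_sgn \<delta> n b else 0)"
      by (intro sum.cong) (auto simp: rank_chi_def sgn_rank_chi_def)
    also have "\<dots> = (if ?r = 0 then 0 else d ?r * sym_sgn \<delta> n b)" using \<open>?r \<le> n\<close> by simp
    finally show ?thesis using 1 by simp
  qed
  \<comment> \<open>The solution of c + d = p and c - d = m on the two classes of each rank, where
    the sign is 1 and -1. At t = 0 both representatives are the zero matrix, and \<open>c 0\<close>
    is the value there.\<close>
  define c where "c = (\<lambda>t. (?p t + ?m t) / 2)"
  define d where "d = (\<lambda>t. (?p t - ?m t) / 2)"
  have "fourier_expansion \<theta> \<delta> n (rank_chi n r) c d"
    unfolding fourier_expansion_def fourier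
  proof (intro ballI)
    fix b :: "'a mat" assume b: "b \<in> Sym_mat n"
    have bc: "b \<in> carrier_mat n n" using b by (simp add: Sym_mat_def)
    obtain t e where t: "t \<le> n" "e \<noteq> 0" "diag_rep n t e \<in> GL_orbit n b"
      using Sym_mat_diag_rep[OF two b] by blast
    have bt: "b \<in> GL_orbit n (diag_rep n t e)" using GL_orbit_sym[OF t(3) bc] .
    have rank: "vec_space.rank n b = t"
      using rank_GL_orbit[OF bt repc] rank_diag_rep[OF t(1,2)] by simp
    have "?F b = c t + (if t = 0 then 0 else d t * sym_sgn \<delta> n b)"
    proof (cases "t = 0")
      case True
      have "diag_rep n 0 e' = diag_rep n 0 1" for e' :: 'a
        by (auto simp: diag_rep_def mat_eq_iff)
      then have "?F b = ?p 0" "?m 0 = ?p 0"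
        using rank_fourier_GL_orbit[OF bt repc] True by metis+
      then show ?thesis using True by (simp add: c_def)
    next
      case False
      have "e \<in> nonzero_squares \<union> (\<lambda>y. \<delta> * y) ` nonzero_squares"
        using nonzero_squares_split(1)[OF assms(2)] t(2) by blast
      then consider w where "w \<noteq> 0" "e = w\<^sup>2 * 1" | w where "w \<noteq> 0" "e = w\<^sup>2 * \<delta>"
        by (auto simp: nonzero_squares_def mult.commute)
      then show ?thesis
      proof cases
        case (1 w)
        then have "b \<in> GL_orbit n (diag_rep n t 1)"
          using GL_orbit_trans[OF bt _ repc] diag_rep_scale[of t n w 1] False t(1) by simp
        then show ?thesis
          using False t(1) rank_fourier_GL_orbit[OF _ repc] sym_sgn_GL_orbit_1[of t n b \<delta>]
          by (simp add: c_def d_def add_divide_distrib[symmetric])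
      next
        case (2 w)
        then have "b \<in> GL_orbit n (diag_rep n t \<delta>)"
          using GL_orbit_trans[OF bt _ repc] diag_rep_scale[of t n w \<delta>] False t(1) by simp
        then show ?thesis
          using False t(1) rank_fourier_GL_orbit[OF _ repc] sym_sgn_GL_orbit_nonsquare[OF assms(2), of t n b]
          by (simp add: c_def d_def diff_divide_distrib[symmetric])
      qed
    qed
    then show "?F b = (\<Sum>t=0..n. c t * rank_chi n t b) + (\<Sum>t=1..n. d t * sgn_rank_chi \<delta> n t b)"
      unfolding expand[OF b] rank by simp
  qed
  \<comment> \<open>Uniqueness: evaluation at the two representatives of rank \<open>s\<close> gives
    c' s + d' s and c' s - d' s, and their mean eliminates \<open>d'\<close>.\<close>
  moreover have "c' s = c s" if "fourier_expansion \<theta> \<delta> n (rank_chi n r) c' d'" for c' d'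
  proof -
    have "?F b = c' (vec_space.rank n b) + (if vec_space.rank n b = 0 then 0 else d' (vec_space.rank n b) * sym_sgn \<delta> n b)"
      if "b \<in> Sym_mat n" for b
      using \<open>fourier_expansion \<theta> \<delta> n (rank_chi n r) c' d'\<close> that
      unfolding fourier_expansion_def fourier by (simp only: expand[OF that] simp_thms)
    then have "?p s = c' s + d' s" "?m s = c' s - d' s"
      using rep rank_diag_rep[OF assms(6) \<delta>0] rank_diag_rep[OF assms(6), of "1 :: 'a"] assms(5,6)
        sym_sgn_GL_orbit_1[OF assms(5,6) GL_orbit_refl[OF repc], of \<delta>]
        sym_sgn_GL_orbit_nonsquare[OF assms(2,5,6) GL_orbit_refl[OF repc]] by simp_all
    then show ?thesis by (simp add: c_def)
  qed
  ultimately have "Psi1 \<theta> \<delta> n s r = c s"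
    unfolding Psi1_def by (intro the_equality) blast+
  also have "\<dots> = rank_avg n s r"
    unfolding c_def by (rule rank_avg_eq_mean[OF assms(2,5,6), symmetric])
  also have "\<dots> = (- 1) ^ r * psi_sum y (q ^ n) x"
    unfolding y_def x_def by (rule rank_avg_eq_psi_sum[OF assms(5,6)])
  also have "psi_sum y (q ^ n) x = (- 1) ^ x * q ^ (x * (x + 1))
      * q_poch (q powi (2 * int N + (- 1) ^ n)) (q powi (- 2)) x
      * q_binom N x (q\<^sup>2)
      * K_Aff y x (q powi (- 2 * int N - (- 1) ^ n)) N (q\<^sup>2)"
    unfolding N_def using assms(4,6) by (intro psi_sum_K_Aff) (auto simp: y_def div_le_mono)
  finally show ?thesis
    by (simp only: power_add mult.assoc)
qed

end
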